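(* Let $\alpha\in(0,2)$ and let $\{X_j\}_{j\ge 1}$ be a strictly stationary and associated sequence of real random variables satisfying the following conditions. (i) $\mathbb{P}(|X_1|>x)=x^{-\alpha}\ell(x)$, where $\ell$ is a slowly varying function (at $+\infty$). Let $\{B_n\}$ be a sequence of positive normalizing constants such that $n\,\mathbb{P}(|X_1|>B_n)\to 1$ as $n\to\infty$. (ii) For each $N\in\mathbb{N}$, as $n\to\infty$, $$n\,\mathbb{P}\Big(\Big(\frac{X_1}{B_n},\frac{X_2}{B_n},\ldots,\frac{X_N}{B_n}\Big)\in\cdot\,\Big)\longrightarrow \nu_N(\cdot)\quad\text{vaguely on }\overline{\mathbb{R}}^N\setminus\{\mathbf{0}\},$$ where $\nu_N$ is a Lévy measure on $\mathbb{R}^N$. (iii) If $\alpha=1$, then for every $N\in\mathbb{N}$ the vector $(X_1,\ldots,X_N)$ has a symmetric distribution; if $\alpha\in(1,2)$, then $\mathbb{E}X_1=0$. (iv) The function $a\mapsto\sum_{j=2}^{\infty}\mathrm{Cov}\big(f_a(X_1),f_a(X_j)\big)$ is regularly varying (at $+\infty$). (v) $$n\sum_{j=2}^{\infty}\mathrm{Cov}\Big(f_1\big(\tfrac{X_1}{B_n}\big),f_1\big(\tfrac{X_j}{B_n}\big)\Big)\xrightarrow[n\to\infty]{}\sum_{j=2}^{\infty}\int_{\mathbb{R}^2}f_1(x_1)f_1(x_2)\,\nu_{\{1,j\}}(dx_1,dx_2)<+\infty .$$ Then there exists a strictly $\alpha$-stable distribution $\mu_\infty$ on $\mathbb{R}$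 such that $$\frac{X_1+X_2+\cdots+X_n}{B_n}\longrightarrow\mu_\infty\quad\text{in distribution as } n\to\infty.$$
   Context: Association: random variables $X_1,\ldots,X_n$ are associated if $\mathrm{Cov}\big(f(X_1,\ldots,X_n),g(X_1,\ldots,X_n)\big)\ge 0$ for every pair of functions $f,g:\mathbb{R}^n\to\mathbb{R}$ that are non-decreasing in each coordinate and for which this covariance exists. An infinite collection of random variables is associated if every finite subset of it consists of associated random variables. Truncation: for $a>0$, $f_a:\mathbb{R}\to\mathbb{R}$ is defined by $f_a(x)=a$ if $x>a$, $f_a(x)=x$ if $|x|\le a$, $f_a(x)=-a$ if $x<-a$. Here $\overline{\mathbb{R}}=[-\infty,+\infty]$, and vague convergence on $\overline{\mathbb{R}}^N\setminus\{\mathbf 0\}$ means convergence of integrals of continuous functions with compact support in $\overline{\mathbb{R}}^N\setminus\{\mathbf 0\}$ (i.e. vanishing in a neighbourhood of $\mathbf 0$). A random vector has symmetric distribution if it has the same law as its negative. The measure $\nu_{\{1,j\}}$ ($j\ge2$): under (i)–(iii), for each $N$, the sums of $n$ independent copies of $(X_1,\ldots,X_N)$ divided by $B_n$ converge in distribution to a strictly $\alpha$-stable random vector $(Y_1^N,\ldots,Y_N^N)$ with distribution determined by $\nu_N$; $\nu_{\{1,j\}}$ is the Lévy measure of the law of $(Y_1^j,Y_j^j)$. Equivalently, it is the image of $\nu_j$ under the projection $(x_1,\ldots,x_j)\mapsto(x_1,x_j)$, restricted to $\mathbb{R}^2\setminus\{\mathbf 0\}$. Strictly $\alpha$-stable distribution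 on $\mathbb{R}$, $0<\alpha<2$: a distribution with characteristic function $$t\mapsto\exp\Big(ibt+\int_{\{-1,1\}}\int_0^\infty g(t,s,r)\frac{dr}{r^{\alpha+1}}\,\Gamma(ds)\Big),$$ where $b\in\mathbb{R}$, $\Gamma$ is a finite measure on $\{-1,1\}$, and $g(t,s,r)=e^{itsr}-1$ if $0<\alpha<1$; $g(t,s,r)=e^{itsr}-1-itsr\,I(r\le 1)$ if $\alpha=1$; $g(t,s,r)=e^{itsr}-1-itsr$ if $1<\alpha<2$; and with $b=0$ when $\alpha\neq1$, respectively $\Gamma(\{1\})=\Gamma(\{-1\})$ when $\alpha=1$. Degenerate distributions (the case $\Gamma=0$) are not excluded. *)

theory Defs
  imports "HOL-Probability.Probability"
begin

section \<open>Families of random variables\<close>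

text \<open>
  A vector in \<open>\<real>\<^sup>I\<close> is an extensional function on \<open>I\<close>, i.e. a point of
  the product space \<open>\<Pi>\<^sub>M i\<in>I. borel\<close>.
\<close>

definition joint_law :: "'a measure \<Rightarrow> (nat \<Rightarrow> 'a \<Rightarrow> real) \<Rightarrow> nat set \<Rightarrow> (nat \<Rightarrow> real) measure" where
  "joint_law M X I = distr M (\<Pi>\<^sub>M i\<in>I. borel) (\<lambda>\<omega>. \<lambda>i\<in>I. X i \<omega>)"

definition covariance :: "'a measure \<Rightarrow> ('a \<Rightarrow> real) \<Rightarrow> ('a \<Rightarrow> real) \<Rightarrow> real" where
  "covariance M U V = (LINT \<omega>|M. (U \<omega> - (LINT \<omega>'|M. U \<omega>')) * (V \<omega> - (LINT \<omega>'|M. V \<omega>')))"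

definition covariance_exists :: "'a measure \<Rightarrow> ('a \<Rightarrow> real) \<Rightarrow> ('a \<Rightarrow> real) \<Rightarrow> bool" where
  "covariance_exists M U V \<longleftrightarrow>
     integrable M U \<and> integrable M V \<and> integrable M (\<lambda>\<omega>. U \<omega> * V \<omega>)"

definition coordinatewise_nondecreasing :: "nat set \<Rightarrow> ((nat \<Rightarrow> real) \<Rightarrow> real) \<Rightarrow> bool" where
  "coordinatewise_nondecreasing I f \<longleftrightarrow>
     (\<forall>x \<in> extensional I. \<forall>i \<in> I. mono (\<lambda>t. f (x(i := t))))"

text \<open>
  The covariance is taken under the joint law, so only Borel functions \<open>f\<close>, \<open>g\<close> are tested.
\<close>

definition associated :: "'a measure \<Rightarrow> (nat \<Rightarrow> 'a \<Rightarrow> real) \<Rightarrow> nat set \<Rightarrow> bool" where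
  "associated M X I \<longleftrightarrow>
     (\<forall>f g. coordinatewise_nondecreasing I f \<longrightarrow> coordinatewise_nondecreasing I g \<longrightarrow>
        covariance_exists (joint_law M X I) f g \<longrightarrow> covariance (joint_law M X I) f g \<ge> 0)"

definition associated_family :: "'a measure \<Rightarrow> (nat \<Rightarrow> 'a \<Rightarrow> real) \<Rightarrow> nat set \<Rightarrow> bool" where
  "associated_family M X J \<longleftrightarrow> (\<forall>I. finite I \<longrightarrow> I \<subseteq> J \<longrightarrow> associated M X I)"

text \<open>Sequences are indexed by \<open>1, 2, \<dots>\<close>; the value at index \<open>0\<close> is irrelevant.\<close>

definition strictly_stationary :: "'a measure \<Rightarrow> (nat \<Rightarrow> 'a \<Rightarrow> real) \<Rightarrow> bool" where
  "strictly_stationary M X \<longleftrightarrow>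
     (\<forall>N k. joint_law M (\<lambda>i. X (i + k)) {1..N} = joint_law M X {1..N})"

definition symmetric_vector :: "'a measure \<Rightarrow> (nat \<Rightarrow> 'a \<Rightarrow> real) \<Rightarrow> nat \<Rightarrow> bool" where
  "symmetric_vector M X N \<longleftrightarrow> joint_law M (\<lambda>i \<omega>. - X i \<omega>) {1..N} = joint_law M X {1..N}"

definition truncation :: "real \<Rightarrow> real \<Rightarrow> real" where
  "truncation a x = (if x > a then a else if \<bar>x\<bar> \<le> a then x else - a)"


section \<open>Regular variation at infinity\<close>

definition regularly_varying_index :: "real \<Rightarrow> (real \<Rightarrow> real) \<Rightarrow> bool" where
  "regularly_varying_index \<rho> f \<longleftrightarrow>
     (\<exists>A>0. f \<in> borel_measurable (restrict_space borel {A..}) \<and> (\<forall>x\<ge>A. f x > 0)) \<and>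
     (\<forall>c>0. ((\<lambda>x. f (c * x) / f x) \<longlongrightarrow> c powr \<rho>) at_top)"

definition regularly_varying :: "(real \<Rightarrow> real) \<Rightarrow> bool" where
  "regularly_varying f \<longleftrightarrow> (\<exists>\<rho>. regularly_varying_index \<rho> f)"

definition slowly_varying :: "(real \<Rightarrow> real) \<Rightarrow> bool" where
  "slowly_varying f \<longleftrightarrow> regularly_varying_index 0 f"


section \<open>Vague convergence\<close>

definition compactly_supported :: "'a topology \<Rightarrow> ('a \<Rightarrow> real) \<Rightarrow> bool" where
  "compactly_supported T h \<longleftrightarrow> compactin T (T closure_of {x \<in> topspace T. h x \<noteq> 0})"

text \<open>
  The measures may live on a larger space than that of \<open>T\<close>; only their restrictions
  to \<open>topspace T\<close> matter.
\<close>

definition vaguely_converges ::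
  "'a topology \<Rightarrow> (nat \<Rightarrow> 'a measure) \<Rightarrow> 'a measure \<Rightarrow> bool" where
  "vaguely_converges T m l \<longleftrightarrow>
     (\<forall>h. continuous_map T euclideanreal h \<longrightarrow> compactly_supported T h \<longrightarrow>
        (\<lambda>n. LINT x:topspace T|m n. h x) \<longlonglongrightarrow> (LINT x:topspace T|l. h x))"

definition extended_punctured :: "nat \<Rightarrow> (nat \<Rightarrow> ereal) topology" where
  "extended_punctured N =
     subtopology (product_topology (\<lambda>_. euclidean) {1..N}) (- {\<lambda>i\<in>{1..N}. 0})"

definition to_extended :: "nat \<Rightarrow> (nat \<Rightarrow> real) measure \<Rightarrow> (nat \<Rightarrow> ereal) measure" where
  "to_extended N m = distr m (\<Pi>\<^sub>M i\<in>{1..N}. borel) (\<lambda>x. \<lambda>i\<in>{1..N}. ereal (x i))"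


section \<open>Levy measures and strictly stable distributions\<close>

definition levy_measure :: "nat \<Rightarrow> (nat \<Rightarrow> real) measure \<Rightarrow> bool" where
  "levy_measure N m \<longleftrightarrow>
     sets m = sets (\<Pi>\<^sub>M i\<in>{1..N}. borel) \<and>
     emeasure m {\<lambda>i\<in>{1..N}. 0} = 0 \<and>
     (\<integral>\<^sup>+ x. ennreal (min 1 (\<Sum>i\<in>{1..N}. (x i)\<^sup>2)) \<partial>m) < \<infinity>"

text \<open>
  The image of a measure on \<open>\<real>\<^sup>j\<close> under \<open>(x\<^sub>1, \<dots>, x\<^sub>j) \<mapsto> (x\<^sub>1, x\<^sub>j)\<close>, away from the
  origin. Applied to the Levy measure of a stable vector \<open>(Y\<^sub>1, \<dots>, Y\<^sub>j)\<close>, this is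
  the Levy measure of \<open>(Y\<^sub>1, Y\<^sub>j)\<close>.
\<close>

definition pair_levy_measure :: "nat \<Rightarrow> (nat \<Rightarrow> real) measure \<Rightarrow> (real \<times> real) measure" where
  "pair_levy_measure j m = restrict_space (distr m borel (\<lambda>x. (x 1, x j))) (- {(0, 0)})"

definition stable_kernel :: "real \<Rightarrow> real \<Rightarrow> real \<Rightarrow> real \<Rightarrow> complex" where
  "stable_kernel \<alpha> t s r =
     (if \<alpha> < 1 then iexp (t * s * r) - 1
      else if \<alpha> = 1 then iexp (t * s * r) - 1 - \<i> * of_real (t * s * r * indicator {..1} r)
      else iexp (t * s * r) - 1 - \<i> * of_real (t * s * r))"

definition strictly_stable :: "real \<Rightarrow> real measure \<Rightarrow> bool" where
  "strictly_stable \<alpha> \<mu> \<longleftrightarrow>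
     0 < \<alpha> \<and> \<alpha> < 2 \<and> real_distribution \<mu> \<and>
     (\<exists>(b::real) (\<Gamma>::real measure).
        sets \<Gamma> = sets (count_space {-1, 1}) \<and> finite_measure \<Gamma> \<and>
        (if \<alpha> = 1 then measure \<Gamma> {1} = measure \<Gamma> {-1} else b = 0) \<and>
        (\<forall>t. char \<mu> t =
           exp (\<i> * of_real (b * t) +
                (CLINT s|\<Gamma>. CLINT r:{0<..}|lborel.
                   stable_kernel \<alpha> t s r / of_real (r powr (\<alpha> + 1))))))"

end

theory Submission
  imports Defs "HOL-Real_Asymp.Real_Asymp"
begin

text \<open>
  Write \<open>R(x) = P(\<bar>X\<^sub>1\<bar> > x)\<close>, \<open>S\<^sub>n\<close> for the partial sums and \<open>f\<^sub>a\<close> for the truncation at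
  level \<open>a\<close>. The proof is a two-scale argument: blocks of a fixed length \<open>m\<close> are
  asymptotically independent and each block sum lies in a stable domain of attraction;
  then \<open>m\<close> tends to infinity.
  
  Block sums. Vague convergence shows that \<open>n P(S\<^sub>m > x B\<^sub>n)\<close> has matching upper and lower
  limits as far as small changes of \<open>x\<close> are concerned. Regular variation of \<open>R\<close> forces
  homogeneity, because changing \<open>x\<close> amounts to replacing \<open>n\<close> by a multiple of \<open>n\<close>; so
  \<open>n P(S\<^sub>m > x B\<^sub>n)\<close> converges to \<open>c x\<^sup>-\<^sup>\<alpha>\<close> (\<open>partial_sum_pareto_tails\<close>), and likewise for
  \<open>- S\<^sub>m\<close>. A layer-cake formula with Potter's bounds as domination turns convergence of tails
  into convergence of \<open>n (E exp(i t S\<^sub>m / B\<^sub>n) - 1)\<close> to a strictly stable exponent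
  (\<open>char_pareto_tails\<close>).
  
  Asymptotic independence. For associated variables, covariances of Lipschitz functions are
  dominated by covariances of the variables themselves. For the truncated variables
  \<open>f\<^sub>a(X\<^sub>j / B\<^sub>n)\<close> this gives Newman's inequality: the characteristic function of a
  sum of \<open>k\<close> blocks differs from the product over the blocks by at most \<open>4 t\<^sup>2 k\<close> times
  \<open>\<Sum>\<^sub>p\<^sub>\<le>\<^sub>m C\<^sub>p\<close>, where \<open>C\<^sub>p\<close> is the sum of the covariances of lag at least \<open>p\<close>
  (\<open>char_block_sums\<close>). At level \<open>a = 1\<close>, the convergence of the total covariance together
  with the convergence of each single lag identifies the limit of \<open>n C\<^sub>p\<close> as the tail of a
  convergent series (\<open>cov_tail_limit\<close>). Covariances of truncations increase with the level,
  so a general level \<open>a B\<^sub>n\<close> can be compared with the level \<open>B\<^sub>Q\<^sub>n\<close> for a large integer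
  \<open>Q\<close> (\<open>cov_tail_bound\<close>). With \<open>k\<close> about \<open>n / m\<close>, the error is a Cesaro mean of tails
  of a convergent series and vanishes as \<open>m\<close> grows (\<open>char_asymptotic_independence\<close>).
  
  Conclusion. Second moments of truncated sums give tightness of \<open>S\<^sub>n / B\<^sub>n\<close> and a bound
  linear in \<open>m\<close> for the tail constants of \<open>S\<^sub>m\<close>. A weak limit point therefore has the
  characteristic function \<open>lim\<^sub>m exp(p\<^sub>m A(t) + q\<^sub>m A(-t))\<close> with bounded
  \<open>p\<^sub>m, q\<^sub>m \<ge> 0\<close>; compactness makes this strictly stable, and the same limit is reached
  along all \<open>n\<close> (\<open>strictly_stable_limit\<close>).
\<close>

section \<open>Truncation and regularly varying tails\<close>

lemma truncation_eq_clamp: "0 < a \<Longrightarrow> truncation a x = max (- a) (min a x)"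
  by (auto simp: truncation_def min_def max_def)

lemma truncation_mono: "0 < a \<Longrightarrow> x \<le> y \<Longrightarrow> truncation a x \<le> truncation a y"
  by (auto simp: truncation_eq_clamp min_def max_def)

lemma truncation_diff_mono:
  "0 < a \<Longrightarrow> a \<le> b \<Longrightarrow> x \<le> y \<Longrightarrow>
     truncation b x - truncation a x \<le> truncation b y - truncation a y"
  by (auto simp: truncation_eq_clamp min_def max_def)

lemma abs_truncation_le: "0 < a \<Longrightarrow> \<bar>truncation a x\<bar> \<le> a"
  by (auto simp: truncation_eq_clamp min_def max_def)

lemma abs_truncation_le_abs: "0 < a \<Longrightarrow> \<bar>truncation a x\<bar> \<le> \<bar>x\<bar>"
  by (auto simp: truncation_eq_clamp min_def max_def)

lemma abs_truncation: "0 < a \<Longrightarrow> \<bar>truncation a x\<bar> = min a \<bar>x\<bar>"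
  by (auto simp: truncation_eq_clamp min_def max_def)

lemma truncation_minus: "0 < a \<Longrightarrow> truncation a (- x) = - truncation a x"
  by (auto simp: truncation_eq_clamp min_def max_def)

lemma truncation_id: "\<bar>x\<bar> \<le> a \<Longrightarrow> truncation a x = x"
  by (auto simp: truncation_def)

lemma truncation_scale:
  assumes "0 < a" "0 < b" shows "truncation a (x / b) = truncation (a * b) x / b"
  using assms by (auto simp: truncation_def field_simps abs_if)

lemma truncation_measurable [measurable]: "truncation a \<in> borel_measurable borel"
  unfolding truncation_def by measurable

lemma dyadic_bracket:
  fixes z :: real
  assumes "1 \<le> z" shows "\<exists>k. 2 ^ k \<le> z \<and> z < 2 ^ (k + 1)"
proof -
  obtain k0 where k0: "z < 2 ^ k0" using real_arch_pow[of 2 z] by auto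
  define k where "k = (LEAST k. z < 2 ^ k)"
  have k: "z < 2 ^ k" unfolding k_def using k0 by (rule LeastI)
  then have "k \<noteq> 0" using assms by (cases k) auto
  then have "\<not> z < 2 ^ (k - 1)" unfolding k_def by (intro not_less_Least) simp
  with k \<open>k \<noteq> 0\<close> show ?thesis by (intro exI[of _ "k - 1"]) auto
qed

text \<open>
  A regularly varying tail function with norming constants \<open>B\<close>, chosen so that the
  expected number of exceedances of \<open>B n\<close> among \<open>n\<close> variables tends to one.
\<close>

locale regular_tail =
  fixes R :: "real \<Rightarrow> real" and \<alpha> :: real and B :: "nat \<Rightarrow> real"
  assumes tail_antimono: "x \<le> y \<Longrightarrow> R y \<le> R x"
    and tail_pos: "0 < R x"
    and tail_le_1: "R x \<le> 1"
    and index_pos: "0 < \<alpha>"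
    and tail_ratio: "0 < c \<Longrightarrow> ((\<lambda>x. R (c * x) / R x) \<longlongrightarrow> c powr - \<alpha>) at_top"
    and norming_pos: "1 \<le> n \<Longrightarrow> 0 < B n"
    and norming: "(\<lambda>n. real n * R (B n)) \<longlonglongrightarrow> 1"
begin

lemma norming_at_top: "filterlim B at_top sequentially"
proof (rule filterlim_at_top_dense[THEN iffD2], intro allI)
  fix Z
  have "(\<lambda>n. (real n * R (B n)) * (1 / real n)) \<longlonglongrightarrow> 1 * 0"
    by (intro tendsto_mult norming lim_1_over_n)
  then have "\<forall>\<^sub>F n in sequentially. (real n * R (B n)) * (1 / real n) < R Z"
    using tail_pos[of Z] by (intro order_tendstoD(2)) auto
  then show "\<forall>\<^sub>F n in sequentially. Z < B n"
    using eventually_gt_at_top[of 0]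
  proof eventually_elim
    case (elim n)
    then have "R (B n) < R Z" by simp
    then show ?case using tail_antimono[of "B n" Z] by force
  qed
qed

lemma scaled_tail:
  assumes "0 < x" shows "(\<lambda>n. real n * R (x * B n)) \<longlonglongrightarrow> x powr - \<alpha>"
proof -
  have "(\<lambda>n. (real n * R (B n)) * (R (x * B n) / R (B n))) \<longlonglongrightarrow> 1 * x powr - \<alpha>"
    by (intro tendsto_mult norming filterlim_compose[OF tail_ratio[OF assms] norming_at_top])
  moreover have "R (B n) \<noteq> 0" for n using tail_pos[of "B n"] by simp
  ultimately show ?thesis by simp
qed

lemma norming_subsequence_tail:
  assumes k: "(\<lambda>n. real (k n) / real n) \<longlonglongrightarrow> q" and q: "0 < q"
  shows "(\<lambda>n. real n * R (B (k n))) \<longlonglongrightarrow> 1 / q"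
    and "filterlim k at_top sequentially"
proof -
  have *: "filterlim (\<lambda>n. (real (k n) / real n) * real n) at_top sequentially"
    by (rule filterlim_tendsto_pos_mult_at_top[OF k q filterlim_real_sequentially])
  have "filterlim (\<lambda>n. real (k n)) at_top sequentially"
    by (rule filterlim_at_top_mono[OF *]) (auto simp: divide_simps intro!: always_eventually)
  then show kk: "filterlim k at_top sequentially"
    using filterlim_sequentially_iff_filterlim_real by blast
  have "(\<lambda>n. (real (k n) * R (B (k n))) / (real (k n) / real n)) \<longlonglongrightarrow> 1 / q"
    using q by (intro tendsto_divide filterlim_compose[OF norming kk] k) auto
  moreover have "\<forall>\<^sub>F n in sequentially.
      (real (k n) * R (B (k n))) / (real (k n) / real n) = real n * R (B (k n))"
    using eventually_gt_at_top[of 0] kk[THEN filterlim_at_top[THEN iffD1], rule_format, of 1]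
    by eventually_elim auto
  ultimately show "(\<lambda>n. real n * R (B (k n))) \<longlonglongrightarrow> 1 / q"
    by (rule Lim_transform_eventually)
qed

text \<open>
  Norming constants are ordered by comparing tails: at \<open>x B n\<close> the rescaled tail is near
  \<open>x\<^sup>-\<^sup>\<alpha>\<close>, at \<open>B (k n)\<close> it is near \<open>1 / q\<close>. This and the next lemma give
  \<open>B (k n) / B n \<rightarrow> q\<^sup>1\<^sup>/\<^sup>\<alpha>\<close> in the form in which it is used.
\<close>

lemma norming_subsequence_gt:
  assumes k: "(\<lambda>n. real (k n) / real n) \<longlonglongrightarrow> q" and x: "0 < x" "x powr \<alpha> < q"
  shows "\<forall>\<^sub>F n in sequentially. x * B n < B (k n)"
proof -
  have xa: "0 < x powr \<alpha>" using x by simp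
  have q: "0 < q" using xa x by linarith
  have "1 / q < x powr - \<alpha>"
    using x xa q by (simp add: powr_minus field_simps)
  then obtain y where y: "1 / q < y" "y < x powr - \<alpha>" using dense by blast
  show ?thesis
    using order_tendstoD(2)[OF norming_subsequence_tail(1)[OF k q] y(1)]
      order_tendstoD(1)[OF scaled_tail[OF x(1)] y(2)]
  proof eventually_elim
    case (elim n)
    then have "real n * R (B (k n)) < real n * R (x * B n)" by linarith
    then have "R (B (k n)) < R (x * B n)" by (simp add: mult_less_cancel_left)
    then show ?case using tail_antimono[of "B (k n)" "x * B n"] by force
  qed
qed

lemma norming_subsequence_lt:
  assumes k: "(\<lambda>n. real (k n) / real n) \<longlonglongrightarrow> q" and x: "0 < x" "0 < q" "q < x powr \<alpha>"
  shows "\<forall>\<^sub>F n in sequentially. B (k n) < x * B n"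
proof -
  have xa: "0 < x powr \<alpha>" using x by simp
  have "x powr - \<alpha> < 1 / q"
    using x xa by (simp add: powr_minus field_simps)
  then obtain y where y: "x powr - \<alpha> < y" "y < 1 / q" using dense by blast
  show ?thesis
    using order_tendstoD(1)[OF norming_subsequence_tail(1)[OF k x(2)] y(2)]
      order_tendstoD(2)[OF scaled_tail[OF x(1)] y(1)]
  proof eventually_elim
    case (elim n)
    then have "real n * R (x * B n) < real n * R (B (k n))" by linarith
    then have "R (x * B n) < R (B (k n))" by (simp add: mult_less_cancel_left)
    then show ?case using tail_antimono[of "x * B n" "B (k n)"] by force
  qed
qed

text \<open>
  Potter's bounds: one doubling step changes the tail by a factor between
  \<open>2\<^sup>-\<^sup>(\<^sup>\<alpha>\<^sup>+\<^sup>\<delta>\<^sup>)\<close> and \<open>2\<^sup>-\<^sup>(\<^sup>\<alpha>\<^sup>-\<^sup>\<delta>\<^sup>)\<close>; iterating along powers of two and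
  bracketing \<open>y / x\<close> between two of them costs the extra factors \<open>2\<close>.
\<close>

lemma potter:
  assumes \<delta>: "0 < \<delta>" "\<delta> < \<alpha>"
  obtains x0 where "0 < x0"
    "\<And>x y. x0 \<le> x \<Longrightarrow> x \<le> y \<Longrightarrow> R x \<le> (2 * (y / x)) powr (\<alpha> + \<delta>) * R y"
    "\<And>x y. x0 \<le> x \<Longrightarrow> x \<le> y \<Longrightarrow> R y \<le> (y / x / 2) powr - (\<alpha> - \<delta>) * R x"
proof -
  have r: "((\<lambda>x. R (2 * x) / R x) \<longlongrightarrow> 2 powr - \<alpha>) at_top" by (rule tail_ratio) simp
  have "\<forall>\<^sub>F x in at_top. 2 powr - (\<alpha> + \<delta>) < R (2 * x) / R x \<and> R (2 * x) / R x < 2 powr - (\<alpha> - \<delta>) \<and> 0 < (x::real)"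
    using order_tendstoD(1)[OF r, of "2 powr - (\<alpha> + \<delta>)"] order_tendstoD(2)[OF r, of "2 powr - (\<alpha> - \<delta>)"] \<delta>
    by (intro eventually_conj) auto
  then obtain x1 where x1: "\<And>x. x1 \<le> x \<Longrightarrow> 2 powr - (\<alpha> + \<delta>) < R (2 * x) / R x \<and> R (2 * x) / R x < 2 powr - (\<alpha> - \<delta>) \<and> 0 < x"
    by (auto simp: eventually_at_top_linorder)
  define x0 where "x0 = x1"
  have x0: "0 < x0" unfolding x0_def using x1[of x1] by simp
  have up1: "R x \<le> 2 powr (\<alpha> + \<delta>) * R (2 * x)" if "x0 \<le> x" for x
    using x1[of x] that tail_pos[of x] by (simp add: x0_def powr_minus field_simps del: minus_add_distrib)
  have lo1: "R (2 * x) \<le> 2 powr - (\<alpha> - \<delta>) * R x" if "x0 \<le> x" for x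
    using x1[of x] that tail_pos[of x] by (simp add: x0_def divide_less_eq del: minus_diff_eq)
  have ge: "x0 \<le> 2 ^ k * x" if "x0 \<le> x" for k x
  proof -
    have "1 * x \<le> 2 ^ k * x" using that x0 by (intro mult_right_mono one_le_power) auto
    then show ?thesis using that by simp
  qed
  have up: "R x \<le> (2 ^ k) powr (\<alpha> + \<delta>) * R (2 ^ k * x)" if x: "x0 \<le> x" for k x
  proof (induction k)
    case (Suc k)
    note Suc
    also have "R (2 ^ k * x) \<le> 2 powr (\<alpha> + \<delta>) * R (2 * (2 ^ k * x))"
      by (rule up1[OF ge[OF x]])
    finally show ?case
      by (simp add: powr_mult mult_ac)
  qed simp
  have lo: "R (2 ^ k * x) \<le> (2 ^ k) powr - (\<alpha> - \<delta>) * R x" if x: "x0 \<le> x" for k x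
  proof (induction k)
    case (Suc k)
    have "R (2 * (2 ^ k * x)) \<le> 2 powr - (\<alpha> - \<delta>) * R (2 ^ k * x)"
      by (rule lo1[OF ge[OF x]])
    also have "\<dots> \<le> 2 powr - (\<alpha> - \<delta>) * ((2 ^ k) powr - (\<alpha> - \<delta>) * R x)"
      by (intro mult_left_mono Suc) simp
    finally show ?case
      by (simp add: powr_mult mult_ac)
  qed simp
  show ?thesis
  proof (rule that[OF x0])
    fix x y assume x: "x0 \<le> x" "x \<le> y"
    have xp: "0 < x" using x x0 by linarith
    then have "1 \<le> y / x" using x by simp
    then obtain k where k: "2 ^ k \<le> y / x" "y / x < 2 ^ (k + 1)"
      using dyadic_bracket by blast
    have "R x \<le> (2 ^ (k+1)) powr (\<alpha> + \<delta>) * R (2 ^ (k+1) * x)" by (rule up[OF x(1)])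
    also have "\<dots> \<le> (2 * (y / x)) powr (\<alpha> + \<delta>) * R y"
      using k xp \<delta> tail_pos[of "2 ^ (k+1) * x"]
      by (intro mult_mono powr_mono2 tail_antimono) (auto simp: field_simps less_imp_le)
    finally show "R x \<le> (2 * (y / x)) powr (\<alpha> + \<delta>) * R y" .
    have "R y \<le> R (2 ^ k * x)" using k xp by (intro tail_antimono) (simp add: field_simps)
    also have "\<dots> \<le> (2 ^ k) powr - (\<alpha> - \<delta>) * R x" by (rule lo[OF x(1)])
    also have "\<dots> \<le> (y / x / 2) powr - (\<alpha> - \<delta>) * R x"
      using k xp \<delta> tail_pos[of x] x
      by (intro mult_right_mono powr_mono2') (auto simp: field_simps less_imp_le)
    finally show "R y \<le> (y / x / 2) powr - (\<alpha> - \<delta>) * R x" .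
  qed
qed

text \<open>
  The bounds relative to \<open>B n\<close>. For very small \<open>r\<close> the point \<open>r B n\<close> leaves the range in
  which Potter's bounds hold; there the trivial bound \<open>n R \<le> n\<close> suffices, since the value at the
  edge of that range already shows that \<open>n\<close> itself is dominated.
\<close>

lemma potter_scaled:
  assumes \<delta>: "0 < \<delta>" "\<delta> < \<alpha>"
  obtains C where "0 < C"
    "\<forall>\<^sub>F n in sequentially. \<forall>r. 0 < r \<and> r \<le> 1 \<longrightarrow> real n * R (r * B n) \<le> C * r powr - (\<alpha> + \<delta>)"
    "\<forall>\<^sub>F n in sequentially. \<forall>r\<ge>1. real n * R (r * B n) \<le> C * r powr - (\<alpha> - \<delta>)"
proof -
  obtain x0 where x0: "0 < x0"
    and up: "\<And>x y. x0 \<le> x \<Longrightarrow> x \<le> y \<Longrightarrow> R x \<le> (2 * (y / x)) powr (\<alpha> + \<delta>) * R y"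
    and lo: "\<And>x y. x0 \<le> x \<Longrightarrow> x \<le> y \<Longrightarrow> R y \<le> (y / x / 2) powr - (\<alpha> - \<delta>) * R x"
    using potter[OF \<delta>] by blast
  \<comment> \<open>The factor 2 bounds \<open>n R(B n)\<close>; dividing by \<open>R x0 \<le> 1\<close> covers the points \<open>r B n < x0\<close>.\<close>
  define C where "C = 2 * 2 powr (\<alpha> + \<delta>) / R x0"
  have C: "0 < C" "2 * 2 powr (\<alpha> + \<delta>) \<le> C"
    using tail_pos[of x0] tail_le_1[of x0] by (auto simp: C_def field_simps intro: mult_left_le)
  have ev: "\<forall>\<^sub>F n in sequentially. x0 \<le> B n \<and> real n * R (B n) < 2"
    using filterlim_at_top[THEN iffD1, OF norming_at_top, rule_format, of x0]
      order_tendstoD(2)[OF norming, of 2] by (intro eventually_conj) auto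
  show ?thesis
  proof (rule that[OF C(1)])
    show "\<forall>\<^sub>F n in sequentially. \<forall>r. 0 < r \<and> r \<le> 1 \<longrightarrow> real n * R (r * B n) \<le> C * r powr - (\<alpha> + \<delta>)"
      using ev
    proof eventually_elim
      case (elim n)
      have Bp: "0 < B n" using elim x0 by linarith
      show ?case
      proof safe
        fix r :: real assume r: "0 < r" "r \<le> 1"
        have pw: "(2 / r) powr (\<alpha> + \<delta>) = 2 powr (\<alpha> + \<delta>) * r powr - (\<alpha> + \<delta>)"
          using r by (subst powr_minus) (simp add: powr_divide divide_inverse[symmetric])
        show "real n * R (r * B n) \<le> C * r powr - (\<alpha> + \<delta>)"
        proof (cases "x0 \<le> r * B n")
          case True
          have "R (r * B n) \<le> (2 * (B n / (r * B n))) powr (\<alpha> + \<delta>) * R (B n)"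
            using r Bp by (intro up True) (simp add: mult_le_cancel_right2)
          then have "R (r * B n) \<le> (2 / r) powr (\<alpha> + \<delta>) * R (B n)" using Bp by simp
          then have "real n * R (r * B n) \<le> real n * ((2 / r) powr (\<alpha> + \<delta>) * R (B n))"
            by (intro mult_left_mono) auto
          also have "\<dots> = (2 / r) powr (\<alpha> + \<delta>) * (real n * R (B n))" by simp
          also have "\<dots> \<le> (2 / r) powr (\<alpha> + \<delta>) * 2"
            using elim by (intro mult_left_mono) auto
          also have "\<dots> = (2 * 2 powr (\<alpha> + \<delta>)) * r powr - (\<alpha> + \<delta>)" by (simp add: pw)
          also have "\<dots> \<le> C * r powr - (\<alpha> + \<delta>)" by (intro mult_right_mono C) simp
          finally show ?thesis .
        next
          case False
          have "R x0 \<le> (2 * (B n / x0)) powr (\<alpha> + \<delta>) * R (B n)"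
            using elim by (intro up) auto
          then have "real n * R x0 \<le> real n * ((2 * (B n / x0)) powr (\<alpha> + \<delta>) * R (B n))"
            by (intro mult_left_mono) auto
          also have "\<dots> = (2 * (B n / x0)) powr (\<alpha> + \<delta>) * (real n * R (B n))" by simp
          also have "\<dots> \<le> (2 / r) powr (\<alpha> + \<delta>) * 2"
            using elim False Bp r x0 \<delta>
            by (intro mult_mono powr_mono2) (auto simp: field_simps intro!: mult_nonneg_nonneg less_imp_le[OF tail_pos])
          finally have "real n \<le> (2 / r) powr (\<alpha> + \<delta>) * 2 / R x0"
            using tail_pos[of x0] by (simp add: field_simps)
          also have "\<dots> = C * r powr - (\<alpha> + \<delta>)" by (simp add: pw C_def)
          finally have "real n \<le> C * r powr - (\<alpha> + \<delta>)" .
          moreover have "real n * R (r * B n) \<le> real n * 1"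
            by (intro mult_left_mono tail_le_1) simp
          ultimately show ?thesis by linarith
        qed
      qed
    qed
    show "\<forall>\<^sub>F n in sequentially. \<forall>r\<ge>1. real n * R (r * B n) \<le> C * r powr - (\<alpha> - \<delta>)"
      using ev
    proof eventually_elim
      case (elim n)
      have Bp: "0 < B n" using elim x0 by linarith
      show ?case
      proof safe
        fix r :: real assume r: "1 \<le> r"
        have "R (r * B n) \<le> (r * B n / B n / 2) powr - (\<alpha> - \<delta>) * R (B n)"
          using elim r Bp by (intro lo) (auto simp: mult_le_cancel_right1)
        then have "R (r * B n) \<le> (r / 2) powr - (\<alpha> - \<delta>) * R (B n)" using Bp by simp
        then have "real n * R (r * B n) \<le> real n * ((r / 2) powr - (\<alpha> - \<delta>) * R (B n))"
          by (intro mult_left_mono) auto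
        also have "\<dots> = (r / 2) powr - (\<alpha> - \<delta>) * (real n * R (B n))" by simp
        also have "\<dots> \<le> (r / 2) powr - (\<alpha> - \<delta>) * 2"
          using elim by (intro mult_left_mono) auto
        also have "\<dots> = (2 * 2 powr (\<alpha> - \<delta>)) * r powr - (\<alpha> - \<delta>)"
          using r by (simp add: powr_divide powr_minus field_simps del: minus_diff_eq)
        also have "\<dots> \<le> (2 * 2 powr (\<alpha> + \<delta>)) * r powr - (\<alpha> - \<delta>)"
          using \<delta> by (intro mult_right_mono mult_left_mono powr_mono) auto
        also have "\<dots> \<le> C * r powr - (\<alpha> - \<delta>)" by (intro mult_right_mono C) simp
        finally show "real n * R (r * B n) \<le> C * r powr - (\<alpha> - \<delta>)" .
      qed
    qed
  qed
qed

text \<open>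
  An eventual bound on \<open>n Q(r B n)\<close> transfers to any other point \<open>s\<close> with the factor
  \<open>(r / s)\<^sup>\<alpha>\<close>: replace \<open>n\<close> by \<open>k n\<close> of order \<open>(s / r)\<^sup>\<alpha> n\<close>, for which
  \<open>r B (k n)\<close> is about \<open>s B n\<close>.
\<close>

lemma rescaled_tail_upper:
  assumes Q: "\<And>x y. x \<le> y \<Longrightarrow> Q y \<le> Q x" and rs: "0 < r" "0 < s"
    and up: "\<forall>\<^sub>F n in sequentially. real n * Q (r * B n) \<le> u" and u: "0 \<le> u" "u * (r / s) powr \<alpha> < u'"
  shows "\<forall>\<^sub>F n in sequentially. real n * Q (s * B n) \<le> u'"
proof -
  have sr: "0 < (s / r) powr \<alpha>" using rs by simp
  have inv: "(r / s) powr \<alpha> = 1 / (s / r) powr \<alpha>" using rs by (simp add: powr_divide)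
  have "((\<lambda>q. u / q) \<longlongrightarrow> u / (s / r) powr \<alpha>) (at_left ((s / r) powr \<alpha>))"
    using sr by (intro tendsto_intros) auto
  \<comment> \<open>A growth rate \<open>q\<close> slightly below \<open>(s / r)\<^sup>\<alpha>\<close> makes \<open>r B (k n)\<close> fall below \<open>s B n\<close>.\<close>
  then have "\<forall>\<^sub>F q in at_left ((s / r) powr \<alpha>). u / q < u'"
    using u inv by (intro order_tendstoD(2)) auto
  moreover have "\<forall>\<^sub>F q in at_left ((s / r) powr \<alpha>). 0 < q \<and> q < (s / r) powr \<alpha>"
    using eventually_at_left_real[OF sr] by eventually_elim auto
  ultimately have "\<forall>\<^sub>F q in at_left ((s / r) powr \<alpha>). u / q < u' \<and> 0 < q \<and> q < (s / r) powr \<alpha>"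
    by (rule eventually_conj)
  then obtain q where q: "u / q < u'" "0 < q" "q < (s / r) powr \<alpha>"
    using eventually_happens' trivial_limit_at_left_real by blast
  define k where "k = (\<lambda>n. nat \<lceil>q * real n\<rceil>)"
  have k: "(\<lambda>n. real (k n) / real n) \<longlonglongrightarrow> q"
    unfolding k_def using q(2) by real_asymp
  have kk: "filterlim k at_top sequentially" by (rule norming_subsequence_tail(2)[OF k q(2)])
  have "(\<lambda>n. u / (real (k n) / real n)) \<longlonglongrightarrow> u / q"
    using q by (intro tendsto_intros k) auto
  then have "\<forall>\<^sub>F n in sequentially. u / (real (k n) / real n) < u'" by (rule order_tendstoD(2)) (rule q)
  moreover have "\<forall>\<^sub>F n in sequentially. B (k n) < s / r * B n"
    by (rule norming_subsequence_lt[OF k]) (use rs q in auto)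
  moreover have "\<forall>\<^sub>F n in sequentially. real (k n) * Q (r * B (k n)) \<le> u"
    using kk up by (rule eventually_compose_filterlim[rotated])
  ultimately show ?thesis
    using eventually_gt_at_top[of 0] kk[THEN filterlim_at_top[THEN iffD1], rule_format, of 1]
  proof eventually_elim
    case (elim n)
    have "Q (s * B n) \<le> Q (r * B (k n))" using elim rs by (intro Q) (simp add: field_simps)
    then have "real n * Q (s * B n) \<le> real n * Q (r * B (k n))" by (intro mult_left_mono) auto
    also have "\<dots> = (real (k n) * Q (r * B (k n))) / (real (k n) / real n)" using elim by simp
    also have "\<dots> \<le> u / (real (k n) / real n)" using elim by (intro divide_right_mono) auto
    finally show ?case using elim by linarith
  qed
qed

lemma rescaled_tail_lower:
  assumes Q: "\<And>x y. x \<le> y \<Longrightarrow> Q y \<le> Q x" "\<And>x. 0 \<le> Q x" and rs: "0 < r" "0 < s"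
    and lo: "\<forall>\<^sub>F n in sequentially. l \<le> real n * Q (r * B n)" and l: "l' < l * (r / s) powr \<alpha>"
  shows "\<forall>\<^sub>F n in sequentially. l' \<le> real n * Q (s * B n)"
proof (cases "0 < l'")
  case False
  then have "l' \<le> real n * Q (s * B n)" for n using Q(2)[of "s * B n"] by (meson order_trans not_less mult_nonneg_nonneg of_nat_0_le_iff)
  then show ?thesis by simp
next
  case True
  have sr: "0 < (s / r) powr \<alpha>" using rs by simp
  have inv: "(r / s) powr \<alpha> = 1 / (s / r) powr \<alpha>" using rs by (simp add: powr_divide)
  have "((\<lambda>q. l / q) \<longlongrightarrow> l / (s / r) powr \<alpha>) (at_right ((s / r) powr \<alpha>))"
    using sr by (intro tendsto_intros) auto
  then have "\<forall>\<^sub>F q in at_right ((s / r) powr \<alpha>). l' < l / q"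
    using l inv by (intro order_tendstoD(1)) auto
  moreover have "\<forall>\<^sub>F q in at_right ((s / r) powr \<alpha>). (s / r) powr \<alpha> < q"
    by (rule eventually_at_right_less)
  ultimately have "\<forall>\<^sub>F q in at_right ((s / r) powr \<alpha>). l' < l / q \<and> (s / r) powr \<alpha> < q"
    by (rule eventually_conj)
  then obtain q where q: "l' < l / q" "(s / r) powr \<alpha> < q"
    using eventually_happens' trivial_limit_at_right_real by blast
  have q0: "0 < q" using q sr by linarith
  define k where "k = (\<lambda>n. nat \<lceil>q * real n\<rceil>)"
  have k: "(\<lambda>n. real (k n) / real n) \<longlonglongrightarrow> q"
    unfolding k_def using q0 by real_asymp
  have kk: "filterlim k at_top sequentially" by (rule norming_subsequence_tail(2)[OF k q0])
  have "(\<lambda>n. l / (real (k n) / real n)) \<longlonglongrightarrow> l / q"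
    using q0 by (intro tendsto_intros k) auto
  then have "\<forall>\<^sub>F n in sequentially. l' < l / (real (k n) / real n)" by (rule order_tendstoD(1)) (rule q)
  moreover have "\<forall>\<^sub>F n in sequentially. s / r * B n < B (k n)"
    by (rule norming_subsequence_gt[OF k]) (use rs q in auto)
  moreover have "\<forall>\<^sub>F n in sequentially. l \<le> real (k n) * Q (r * B (k n))"
    using kk lo by (rule eventually_compose_filterlim[rotated])
  ultimately show ?thesis
    using eventually_gt_at_top[of 0] kk[THEN filterlim_at_top[THEN iffD1], rule_format, of 1]
  proof eventually_elim
    case (elim n)
    have "Q (r * B (k n)) \<le> Q (s * B n)" using elim rs by (intro Q) (simp add: field_simps)
    then have "real n * Q (r * B (k n)) \<le> real n * Q (s * B n)" by (intro mult_left_mono) auto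
    moreover have "real n * Q (r * B (k n)) = (real (k n) * Q (r * B (k n))) / (real (k n) / real n)" using elim by simp
    moreover have "l / (real (k n) / real n) \<le> (real (k n) * Q (r * B (k n))) / (real (k n) / real n)"
      using elim by (intro divide_right_mono) auto
    ultimately show ?case using elim by linarith
  qed
qed

text \<open>
  If the upper limit of the rescaled tail at \<open>b\<close> never exceeds its lower limit at a smaller
  \<open>a\<close>, the limit exists and is homogeneous: the change of scale from \<open>a\<close> and \<open>b\<close> back to
  \<open>1\<close> costs factors that tend to one as \<open>a, b \<rightarrow> 1\<close>.
\<close>

lemma tail_limit_exists:
  assumes Q: "\<And>x y. x \<le> y \<Longrightarrow> Q y \<le> Q x" "\<And>x. 0 \<le> Q x"
    and bdd: "\<forall>\<^sub>F n in sequentially. real n * Q (B n) \<le> C"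
    and sandwich: "\<And>a b \<eta>. 0 < a \<Longrightarrow> a < b \<Longrightarrow> 0 < \<eta> \<Longrightarrow>
      \<exists>l. \<forall>\<^sub>F n in sequentially. real n * Q (b * B n) \<le> l + \<eta> \<and> l - \<eta> \<le> real n * Q (a * B n)"
  obtains c where "0 \<le> c" "\<And>r. 0 < r \<Longrightarrow> (\<lambda>n. real n * Q (r * B n)) \<longlonglongrightarrow> c * r powr - \<alpha>"
proof -
  define U where "U = {u. \<forall>\<^sub>F n in sequentially. real n * Q (B n) \<le> u}"
  have U0: "0 \<le> u" if "u \<in> U" for u
  proof -
    have "\<forall>\<^sub>F n in sequentially. real n * Q (B n) \<le> u" using that by (simp add: U_def)
    then obtain n where "real n * Q (B n) \<le> u" by (auto simp: eventually_sequentially)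
    moreover have "0 \<le> real n * Q (B n)" using Q(2) by simp
    ultimately show ?thesis by linarith
  qed
  have U_ne: "U \<noteq> {}" using bdd by (auto simp: U_def)
  have U_bdd: "bdd_below U" using U0 by (rule bdd_belowI)
  \<comment> \<open>The candidate limit is the upper limit at \<open>1\<close>, taken as the infimum of the eventual upper bounds.\<close>
  define c where "c = Inf U"
  have c0: "0 \<le> c" unfolding c_def using U_ne U0 by (rule cInf_greatest)
  have upper: "\<forall>\<^sub>F n in sequentially. real n * Q (1 * B n) \<le> u" if "c < u" for u
  proof -
    obtain v where v: "v \<in> U" "v < u" using \<open>c < u\<close> cInf_lessD[OF U_ne] unfolding c_def by blast
    then have "\<forall>\<^sub>F n in sequentially. real n * Q (B n) \<le> v" by (simp add: U_def)
    then show ?thesis by eventually_elim (use v in simp)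
  qed
  have lower: "\<forall>\<^sub>F n in sequentially. c - \<epsilon> \<le> real n * Q (1 * B n)" if \<epsilon>: "0 < \<epsilon>" for \<epsilon>
  proof -
    have "((\<lambda>a. c * (a powr (2 * \<alpha>))) \<longlongrightarrow> c * 1 powr (2 * \<alpha>)) (at_left (1::real))"
      by (intro tendsto_intros) auto
    then have "\<forall>\<^sub>F a in at_left (1::real). c - \<epsilon> / 2 < c * (a powr (2 * \<alpha>))"
      using \<epsilon> by (intro order_tendstoD(1)) auto
    moreover have "\<forall>\<^sub>F a in at_left (1::real). 0 < a \<and> a < 1"
      using eventually_at_left_real[of 0 1] by (rule eventually_mono) auto
    ultimately have "\<forall>\<^sub>F a in at_left (1::real). c - \<epsilon> / 2 < c * (a powr (2 * \<alpha>)) \<and> 0 < a \<and> a < 1"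
      by (rule eventually_conj)
    then obtain a where a: "c - \<epsilon> / 2 < c * (a powr (2 * \<alpha>))" "0 < a" "a < 1"
      using eventually_happens' trivial_limit_at_left_real by blast
    have a1: "a < 1 / a" using a mult_strict_mono[of a 1 a 1] by (simp add: field_simps)
    \<comment> \<open>The sandwich is used between \<open>a\<close> and \<open>1 / a\<close>, which lie symmetrically around \<open>1\<close>.\<close>
    define \<eta> where "\<eta> = \<epsilon> / 8"
    obtain l where l: "\<forall>\<^sub>F n in sequentially. real n * Q (1 / a * B n) \<le> l + \<eta> \<and> l - \<eta> \<le> real n * Q (a * B n)"
      using sandwich[of a "1 / a" \<eta>] a1 a \<epsilon> by (auto simp: \<eta>_def)
    have lU: "\<forall>\<^sub>F n in sequentially. real n * Q (1 / a * B n) \<le> l + \<eta>"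
      and lL: "\<forall>\<^sub>F n in sequentially. l - \<eta> \<le> real n * Q (a * B n)"
      using l by (rule eventually_mono, blast)+
    obtain n where "real n * Q (1 / a * B n) \<le> l + \<eta>"
      using lU by (meson eventually_sequentially order_refl)
    then have l0: "0 \<le> l + \<eta>" using Q(2)[of "1 / a * B n"] by (meson order_trans mult_nonneg_nonneg of_nat_0_le_iff)
    have "c \<le> (l + \<eta>) * (1 / a) powr \<alpha>"
    proof (rule field_le_epsilon)
      fix e :: real assume "0 < e"
      have "\<forall>\<^sub>F n in sequentially. real n * Q (1 * B n) \<le> (l + \<eta>) * (1 / a) powr \<alpha> + e"
        by (rule rescaled_tail_upper[OF Q(1) _ _ lU l0]) (use a \<open>0 < e\<close> in simp_all)
      then have "(l + \<eta>) * (1 / a) powr \<alpha> + e \<in> U" by (simp add: U_def)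
      then show "c \<le> (l + \<eta>) * (1 / a) powr \<alpha> + e" unfolding c_def by (rule cInf_lower[OF _ U_bdd])
    qed
    then have "c * a powr \<alpha> \<le> l + \<eta>"
      using a by (simp add: powr_divide field_simps)
    then have "c * a powr \<alpha> * a powr \<alpha> \<le> (l + \<eta>) * a powr \<alpha>" by (intro mult_right_mono) auto
    moreover have "c * a powr (2 * \<alpha>) = c * a powr \<alpha> * a powr \<alpha>"
      using powr_add[of a \<alpha> \<alpha>] by simp
    moreover have "a powr \<alpha> \<le> 1" using a index_pos by (intro powr_le1) auto
    moreover from this have "\<eta> * a powr \<alpha> \<le> \<eta> * 1" using \<epsilon> by (intro mult_left_mono) (auto simp: \<eta>_def)
    moreover have "(l - \<eta>) * a powr \<alpha> = (l + \<eta>) * a powr \<alpha> - 2 * (\<eta> * a powr \<alpha>)" by (simp add: algebra_simps)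
    moreover have "\<epsilon> = 8 * \<eta>" by (simp add: \<eta>_def)
    ultimately have "c - \<epsilon> < (l - \<eta>) * a powr \<alpha>" using a \<epsilon> by linarith
    then show ?thesis
      by (intro rescaled_tail_lower[OF Q _ _ lL]) (use a in simp_all)
  qed
  show ?thesis
  proof (rule that[OF c0])
    fix r :: real assume r: "0 < r"
    have pw: "(1 / r) powr \<alpha> = r powr - \<alpha>" using r by (simp add: powr_divide powr_minus_divide)
    have pos: "0 < r powr - \<alpha>" using r by simp
    show "(\<lambda>n. real n * Q (r * B n)) \<longlonglongrightarrow> c * r powr - \<alpha>"
    proof (rule LIMSEQ_I)
      fix e :: real assume e: "0 < e"
      define d where "d = e / (2 * r powr - \<alpha>) / 2"
      have d: "0 < d" "d * r powr - \<alpha> = e / 4" using e pos by (auto simp: d_def)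
      have 1: "\<forall>\<^sub>F n in sequentially. real n * Q (r * B n) \<le> c * r powr - \<alpha> + e / 2"
        by (rule rescaled_tail_upper[OF Q(1), where r = 1 and u = "c + d"])
           (use r c0 d e upper[of "c + d"] in \<open>auto simp: pw distrib_right\<close>)
      have 2: "\<forall>\<^sub>F n in sequentially. c * r powr - \<alpha> - e / 2 \<le> real n * Q (r * B n)"
        by (rule rescaled_tail_lower[OF Q, where r = 1 and l = "c - d"])
           (use r d e lower[of d] in \<open>auto simp: pw left_diff_distrib\<close>)
      have "\<forall>\<^sub>F n in sequentially. norm (real n * Q (r * B n) - c * r powr - \<alpha>) < e"
        using 1 2 by eventually_elim (use e in \<open>auto simp: abs_le_iff abs_less_iff\<close>)
      then show "\<exists>no. \<forall>n\<ge>no. norm (real n * Q (r * B n) - c * r powr - \<alpha>) < e"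
        by (simp add: eventually_sequentially)
    qed
  qed
qed

end

section \<open>Layer-cake integration and Pareto tails\<close>

text \<open>
  Fubini for \<open>\<gamma>(r)\<close> on the region \<open>0 < r < Z\<close>. It reduces integrals of a function of \<open>Z\<close>
  to its tail, and is used both for laws of random variables and for infinite Pareto measures.
\<close>

lemma layer_cake:
  fixes \<gamma> :: "real \<Rightarrow> 'b::{banach, second_countable_topology}"
  assumes "sigma_finite_measure m"
    and Z [measurable]: "Z \<in> borel_measurable m"
    and \<gamma> [measurable]: "\<gamma> \<in> borel_measurable borel"
    and fin: "\<And>r. 0 < r \<Longrightarrow> emeasure m {\<omega> \<in> space m. r < Z \<omega>} < \<infinity>"
    and int: "set_integrable lborel {0<..} (\<lambda>r. measure m {\<omega> \<in> space m. r < Z \<omega>} *\<^sub>R \<gamma> r)"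
  shows "integrable m (\<lambda>\<omega>. LINT r:{0<..<Z \<omega>}|lborel. \<gamma> r)"
    and "(LINT \<omega>|m. (LINT r:{0<..<Z \<omega>}|lborel. \<gamma> r)) =
         (LINT r:{0<..}|lborel. measure m {\<omega> \<in> space m. r < Z \<omega>} *\<^sub>R \<gamma> r)"
proof -
  interpret m: sigma_finite_measure m by fact
  interpret P: pair_sigma_finite lborel m ..
  define f where "f = (\<lambda>r \<omega>. (indicator {0<..} r * indicator {\<omega> \<in> space m. r < Z \<omega>} \<omega>) *\<^sub>R \<gamma> r)"
  have meas [measurable]: "case_prod f \<in> borel_measurable (lborel \<Otimes>\<^sub>M m)"
  proof -
    have "(\<lambda>(r, \<omega>). (indicator {0<..} r * indicator {x \<in> space (lborel \<Otimes>\<^sub>M m). fst x < Z (snd x)} (r, \<omega>)) *\<^sub>R \<gamma> r)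
        \<in> borel_measurable (lborel \<Otimes>\<^sub>M m)"
      by measurable
    also have "?this \<longleftrightarrow> ?thesis"
      by (rule measurable_cong) (auto simp: f_def space_pair_measure indicator_def)
    finally show ?thesis .
  qed
  have inner: "integrable m (f r)" for r
  proof (cases "0 < r")
    case True
    have "integrable m (\<lambda>\<omega>. indicator {\<omega> \<in> space m. r < Z \<omega>} \<omega> *\<^sub>R \<gamma> r)"
      by (intro integrable_scaleR_left integrable_real_indicator fin True) auto
    then show ?thesis using True by (simp add: f_def)
  qed (simp add: f_def)
  have "(\<lambda>r. LINT \<omega>|m. norm (f r \<omega>)) =
      (\<lambda>r. norm (indicator {0<..} r *\<^sub>R (measure m {\<omega> \<in> space m. r < Z \<omega>} *\<^sub>R \<gamma> r)))"
    by (auto simp: f_def indicator_def[of "{0<..}"])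
  then have "integrable lborel (\<lambda>r. LINT \<omega>|m. norm (case_prod f (r, \<omega>)))"
    using integrable_norm[OF int[unfolded set_integrable_def]] by simp
  then have I: "integrable (lborel \<Otimes>\<^sub>M m) (case_prod f)"
    by (intro P.Fubini_integrable meas) (auto simp: inner)
  have eq: "(LINT r|lborel. f r \<omega>) = (LINT r:{0<..<Z \<omega>}|lborel. \<gamma> r)" if "\<omega> \<in> space m" for \<omega>
    using that unfolding set_lebesgue_integral_def f_def
    by (intro Bochner_Integration.integral_cong) (auto simp: indicator_def)
  have eq2: "(LINT \<omega>|m. f r \<omega>) = indicator {0<..} r *\<^sub>R (measure m {\<omega> \<in> space m. r < Z \<omega>} *\<^sub>R \<gamma> r)" for r
  proof (cases "0 < r")
    case True
    then show ?thesis
      using has_bochner_integral_integral_eq[OF has_bochner_integral_indicator[OF _ fin[OF True]]]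
      by (simp add: f_def)
  qed (simp add: f_def)
  have "integrable m (\<lambda>\<omega>. LINT r|lborel. f r \<omega>)"
    using P.integrable_snd[OF I] by simp
  also have "?this \<longleftrightarrow> integrable m (\<lambda>\<omega>. LINT r:{0<..<Z \<omega>}|lborel. \<gamma> r)"
    by (intro Bochner_Integration.integrable_cong) (auto simp: eq)
  finally show "integrable m (\<lambda>\<omega>. LINT r:{0<..<Z \<omega>}|lborel. \<gamma> r)" .
  have "(LINT \<omega>|m. LINT r|lborel. f r \<omega>) = (LINT r|lborel. LINT \<omega>|m. f r \<omega>)"
    by (rule P.Fubini_integral[OF I])
  then show "(LINT \<omega>|m. (LINT r:{0<..<Z \<omega>}|lborel. \<gamma> r)) =
         (LINT r:{0<..}|lborel. measure m {\<omega> \<in> space m. r < Z \<omega>} *\<^sub>R \<gamma> r)"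
    unfolding eq2 set_lebesgue_integral_def[of _ "{0<..}"]
    by (subst (asm) Bochner_Integration.integral_cong[OF refl eq]) auto
qed

text \<open>
  The layer-cake formula for the measure on the positive half-line with tail \<open>r\<^sup>-\<^sup>\<alpha>\<close>,
  i.e. with density \<open>\<alpha> / r\<^sup>\<alpha>\<^sup>+\<^sup>1\<close>.
\<close>

lemma pareto_layer_cake:
  fixes \<gamma> :: "real \<Rightarrow> 'b::{banach, second_countable_topology}"
  assumes \<alpha>: "0 < \<alpha>"
    and \<gamma> [measurable]: "\<gamma> \<in> borel_measurable borel"
    and int: "set_integrable lborel {0<..} (\<lambda>r. (r powr - \<alpha>) *\<^sub>R \<gamma> r)"
  shows "set_integrable lborel {0<..} (\<lambda>r. (\<alpha> / r powr (\<alpha> + 1)) *\<^sub>R (LINT s:{0<..<r}|lborel. \<gamma> s))"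
    and "(LINT r:{0<..}|lborel. (\<alpha> / r powr (\<alpha> + 1)) *\<^sub>R (LINT s:{0<..<r}|lborel. \<gamma> s)) =
         (LINT r:{0<..}|lborel. (r powr - \<alpha>) *\<^sub>R \<gamma> r)"
proof -
  define d where "d = (\<lambda>r. indicator {0<..} r * (\<alpha> / r powr (\<alpha> + 1)))"
  define m where "m = density lborel (\<lambda>r. ennreal (d r))"
  have d [measurable]: "d \<in> borel_measurable borel" unfolding d_def by measurable
  have d0: "0 \<le> d r" for r using \<alpha> by (simp add: d_def)
  have sets_m [measurable_cong, simp]: "sets m = sets borel" by (simp add: m_def)
  have space_m [simp]: "space m = UNIV" by (simp add: m_def)
  have sf: "sigma_finite_measure m"
    unfolding m_def
    by (subst sigma_finite_measure.sigma_finite_iff_density_finite[OF sigma_finite_lborel]) auto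
  have tail: "emeasure m {\<omega> \<in> space m. r < \<omega>} = ennreal (r powr - \<alpha>)" if r: "0 < r" for r
  proof -
    have "emeasure m {\<omega> \<in> space m. r < \<omega>} = (\<integral>\<^sup>+x. ennreal (d x) * indicator {r<..} x \<partial>lborel)"
      unfolding m_def by (subst emeasure_density) (auto simp: greaterThan_def)
    also have "\<dots> = (\<integral>\<^sup>+x. ennreal (\<alpha> / x powr (\<alpha> + 1)) * indicator {r..} x \<partial>lborel)"
      by (rule nn_integral_cong_AE, use AE_lborel_singleton[of r] in eventually_elim)
         (use r in \<open>auto simp: d_def indicator_def\<close>)
    also have "\<dots> = ennreal (0 - (- (r powr - \<alpha>)))"
    proof (rule nn_integral_FTC_atLeast)
      show "((\<lambda>x. - (x powr - \<alpha>)) has_real_derivative \<alpha> / x powr (\<alpha> + 1)) (at x)" if "r \<le> x" for x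
      proof -
        have "x powr (- \<alpha> - 1) = 1 / x powr (\<alpha> + 1)"
          using powr_minus_divide[of x "\<alpha> + 1"] by (simp only: minus_add_distrib diff_conv_add_uminus)
        then show ?thesis
          using that r by (auto intro!: derivative_eq_intros)
      qed
      have "((\<lambda>x. - (x powr - \<alpha>)) \<longlongrightarrow> - 0) at_top"
        using \<alpha> by (intro tendsto_minus tendsto_neg_powr filterlim_ident) auto
      then show "((\<lambda>x. - (x powr - \<alpha>)) \<longlongrightarrow> 0) at_top" by simp
    qed (use \<alpha> in auto)
    finally show ?thesis by simp
  qed
  have tail': "measure m {\<omega> \<in> space m. r < \<omega>} = r powr - \<alpha>" if "0 < r" for r
    using tail[OF that] by (simp add: measure_def)
  have cong: "indicator {0<..} r *\<^sub>R (measure m {\<omega> \<in> space m. r < \<omega>} *\<^sub>R \<gamma> r) =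
      indicator {0<..} r *\<^sub>R ((r powr - \<alpha>) *\<^sub>R \<gamma> r)" for r :: real
    using tail' by (auto simp: indicator_def)
  have int': "set_integrable lborel {0<..} (\<lambda>r. measure m {\<omega> \<in> space m. r < \<omega>} *\<^sub>R \<gamma> r)"
    using int unfolding set_integrable_def cong .
  have id: "(\<lambda>x. x) \<in> borel_measurable m" by measurable
  have finm: "emeasure m {\<omega> \<in> space m. r < \<omega>} < \<infinity>" if "0 < r" for r
    using tail[OF that] by simp
  have lc: "integrable m (\<lambda>x. LINT s:{0<..<x}|lborel. \<gamma> s)"
     "(LINT x|m. (LINT s:{0<..<x}|lborel. \<gamma> s)) =
       (LINT r:{0<..}|lborel. measure m {\<omega> \<in> space m. r < \<omega>} *\<^sub>R \<gamma> r)"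
    by (rule layer_cake(1)[OF sf id \<gamma> finm int'], assumption,
        rule layer_cake(2)[OF sf id \<gamma> finm int'], assumption)
  have G_meas: "(\<lambda>r. LINT s:{0<..<r}|lborel. \<gamma> s) \<in> borel_measurable borel"
    using borel_measurable_integrable[OF lc(1)] by simp
  have dd: "d r *\<^sub>R (LINT s:{0<..<r}|lborel. \<gamma> s) =
     indicator {0<..} r *\<^sub>R ((\<alpha> / r powr (\<alpha> + 1)) *\<^sub>R (LINT s:{0<..<r}|lborel. \<gamma> s))" for r
    by (auto simp: d_def)
  show "set_integrable lborel {0<..} (\<lambda>r. (\<alpha> / r powr (\<alpha> + 1)) *\<^sub>R (LINT s:{0<..<r}|lborel. \<gamma> s))"
    using lc(1) unfolding set_integrable_def m_def
    by (subst (asm) integrable_density) (auto simp: dd d0 intro: G_meas)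
  show "(LINT r:{0<..}|lborel. (\<alpha> / r powr (\<alpha> + 1)) *\<^sub>R (LINT s:{0<..<r}|lborel. \<gamma> s)) =
         (LINT r:{0<..}|lborel. (r powr - \<alpha>) *\<^sub>R \<gamma> r)"
  proof -
    have "(LINT x|m. (LINT s:{0<..<x}|lborel. \<gamma> s)) =
        (LINT r:{0<..}|lborel. (\<alpha> / r powr (\<alpha> + 1)) *\<^sub>R (LINT s:{0<..<r}|lborel. \<gamma> s))"
      unfolding m_def set_lebesgue_integral_def[of _ "{0<..}"] dd[symmetric]
      by (rule integral_density) (auto simp: d0 intro: G_meas)
    moreover have "(LINT x|m. (LINT s:{0<..<x}|lborel. \<gamma> s)) =
         (LINT r:{0<..}|lborel. (r powr - \<alpha>) *\<^sub>R \<gamma> r)"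
      using lc(2) unfolding set_lebesgue_integral_def[of _ "{0<..}"] cong by simp
    ultimately show ?thesis by simp
  qed
qed

lemma set_integral_cutoff:
  fixes \<gamma> :: "real \<Rightarrow> 'b::{banach, second_countable_topology}"
  assumes [measurable]: "\<gamma> \<in> borel_measurable borel"
  shows "(LINT s:{0<..<x}|lborel. indicator {..K} s *\<^sub>R \<gamma> s) = (LINT s:{0<..<min x K}|lborel. \<gamma> s)"
  unfolding set_lebesgue_integral_def
proof (intro integral_cong_AE)
  show "AE s in lborel. indicator {0<..<x} s *\<^sub>R indicator {..K} s *\<^sub>R \<gamma> s = indicator {0<..<min x K} s *\<^sub>R \<gamma> s"
    using AE_lborel_singleton[of K] by eventually_elim (auto simp: indicator_def)
qed measurable

lemma tendsto_of_approximations: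
  fixes a :: "nat \<Rightarrow> 'a::metric_space"
  assumes b: "\<And>k. (\<lambda>n. b k n) \<longlonglongrightarrow> \<beta> k" and \<beta>: "\<beta> \<longlonglongrightarrow> l"
    and e: "\<And>k::nat. \<forall>\<^sub>F n in sequentially. dist (a n) (b k n) \<le> e k" and e0: "e \<longlonglongrightarrow> (0::real)"
  shows "a \<longlonglongrightarrow> l"
proof (rule tendstoI)
  fix \<epsilon> :: real assume \<epsilon>: "0 < \<epsilon>"
  have "\<forall>\<^sub>F k in sequentially. dist (\<beta> k) l < \<epsilon> / 3 \<and> e k < \<epsilon> / 3"
    using tendstoD[OF \<beta>, of "\<epsilon> / 3"] order_tendstoD(2)[OF e0, of "\<epsilon> / 3"] \<epsilon>
    by (intro eventually_conj) auto
  then obtain k where k: "dist (\<beta> k) l < \<epsilon> / 3" "e k < \<epsilon> / 3"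
    by (auto simp: eventually_sequentially)
  have "\<forall>\<^sub>F n in sequentially. dist (b k n) (\<beta> k) < \<epsilon> / 3"
    using tendstoD[OF b[of k], of "\<epsilon> / 3"] \<epsilon> by simp
  with e[of k] show "\<forall>\<^sub>F n in sequentially. dist (a n) l < \<epsilon>"
  proof (eventually_elim)
    case (elim n)
    have "dist (a n) l \<le> dist (a n) (b k n) + (dist (b k n) (\<beta> k) + dist (\<beta> k) l)"
      using dist_triangle[of "a n" l "b k n"] dist_triangle[of "b k n" l "\<beta> k"] by linarith
    then show ?case using elim k by simp
  qed
qed

lemma set_integrable_powr_Ioc:
  fixes q K :: real assumes "-1 < q" "0 \<le> K"
  shows "set_integrable lborel {0<..K} (\<lambda>r. r powr q)"
proof -
  have "(\<lambda>r. r powr q) integrable_on {0<..K}"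
    using assms by (intro integrable_on_powr_from_0')
  then have "(\<lambda>r. r powr q) absolutely_integrable_on {0<..K}"
    by (intro nonnegative_absolutely_integrable_1) auto
  then show ?thesis
    unfolding set_integrable_def by (subst (asm) integrable_completion) auto
qed

lemma set_integrable_powr_Ici:
  fixes q K :: real assumes "q < -1" "0 < K"
  shows "set_integrable lborel {K..} (\<lambda>r. r powr q)"
proof -
  have "(\<lambda>r. r powr q) integrable_on {K..}"
    using has_integral_powr_to_inf[of q K] assms unfolding integrable_on_def by auto
  then have "(\<lambda>r. r powr q) absolutely_integrable_on {K..}"
    by (intro nonnegative_absolutely_integrable_1) auto
  then show ?thesis
    unfolding set_integrable_def by (subst (asm) integrable_completion) auto
qed

text \<open>
  The shape, up to a constant, of the domination of rescaled tails that Potter's bounds give.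
\<close>

definition potter_envelope :: "real \<Rightarrow> real \<Rightarrow> real \<Rightarrow> real" where
  "potter_envelope \<alpha> \<delta> r = (if r \<le> 1 then r powr - (\<alpha> + \<delta>) else r powr - (\<alpha> - \<delta>))"

text \<open>
  Integrability against the envelope only needs power bounds near zero and at infinity.
\<close>

lemma set_integrable_envelope:
  fixes w :: "real \<Rightarrow> real"
  assumes w [measurable]: "w \<in> borel_measurable borel"
    and "-1 < p - (\<alpha> + \<delta>)" "\<And>r. 0 < r \<Longrightarrow> r \<le> 1 \<Longrightarrow> \<bar>w r\<bar> \<le> D * r powr p"
    and "q - (\<alpha> - \<delta>) < -1" "\<And>r. 1 < r \<Longrightarrow> \<bar>w r\<bar> \<le> D * r powr q"
  shows "set_integrable lborel {0<..} (\<lambda>r. potter_envelope \<alpha> \<delta> r * w r)"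
proof -
  have m [measurable]: "potter_envelope \<alpha> \<delta> \<in> borel_measurable borel"
    unfolding potter_envelope_def by measurable
  have 1: "set_integrable lborel {0<..1} (\<lambda>r. potter_envelope \<alpha> \<delta> r * w r)"
  proof (rule set_integrable_bound)
    show "set_integrable lborel {0<..1} (\<lambda>r. D * r powr (p - (\<alpha> + \<delta>)))"
      using assms by (intro set_integrable_mult_right set_integrable_powr_Ioc) auto
    show "AE x in lborel. x \<in> {0<..1} \<longrightarrow> norm (potter_envelope \<alpha> \<delta> x * w x) \<le> norm (D * x powr (p - (\<alpha> + \<delta>)))"
    proof (intro AE_I2 impI)
      fix x :: real assume x: "x \<in> {0<..1}"
      have "norm (potter_envelope \<alpha> \<delta> x * w x) = x powr - (\<alpha> + \<delta>) * \<bar>w x\<bar>"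
        using x by (simp add: potter_envelope_def abs_mult)
      also have "\<dots> \<le> x powr - (\<alpha> + \<delta>) * (D * x powr p)"
        using x assms by (intro mult_left_mono) auto
      also have "\<dots> = D * (x powr p * x powr - (\<alpha> + \<delta>))" by simp
      also have "x powr p * x powr - (\<alpha> + \<delta>) = x powr (p - (\<alpha> + \<delta>))"
        by (simp only: powr_add[symmetric] diff_conv_add_uminus)
      finally show "norm (potter_envelope \<alpha> \<delta> x * w x) \<le> norm (D * x powr (p - (\<alpha> + \<delta>)))" by simp
    qed
  qed (simp add: set_borel_measurable_def)
  have 2: "set_integrable lborel {1<..} (\<lambda>r. potter_envelope \<alpha> \<delta> r * w r)"
  proof (rule set_integrable_bound)
    have "set_integrable lborel {1<..} (\<lambda>r. r powr (q - (\<alpha> - \<delta>)))"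
      by (rule set_integrable_subset[OF set_integrable_powr_Ici[of _ 1]]) (use assms in auto)
    then show "set_integrable lborel {1<..} (\<lambda>r. D * r powr (q - (\<alpha> - \<delta>)))"
      by (intro set_integrable_mult_right)
    show "AE x in lborel. x \<in> {1<..} \<longrightarrow> norm (potter_envelope \<alpha> \<delta> x * w x) \<le> norm (D * x powr (q - (\<alpha> - \<delta>)))"
    proof (intro AE_I2 impI)
      fix x :: real assume x: "x \<in> {1<..}"
      have "norm (potter_envelope \<alpha> \<delta> x * w x) = x powr - (\<alpha> - \<delta>) * \<bar>w x\<bar>"
        using x by (simp add: potter_envelope_def abs_mult)
      also have "\<dots> \<le> x powr - (\<alpha> - \<delta>) * (D * x powr q)"
        using x assms by (intro mult_left_mono) auto
      also have "\<dots> = D * (x powr q * x powr - (\<alpha> - \<delta>))" by simp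
      also have "x powr q * x powr - (\<alpha> - \<delta>) = x powr (q - (\<alpha> - \<delta>))"
        by (simp only: powr_add[symmetric] diff_conv_add_uminus)
      finally show "norm (potter_envelope \<alpha> \<delta> x * w x) \<le> norm (D * x powr (q - (\<alpha> - \<delta>)))" by simp
    qed
  qed (simp add: set_borel_measurable_def)
  have "{0<..} = {0<..1} \<union> ({1<..} :: real set)" by auto
  then show ?thesis using set_integrable_Un[OF 1 2] by simp
qed

text \<open>
  The pointwise limit of the rescaled tails comes with the domination that is needed to
  integrate it, for exponents arbitrarily close to \<open>\<alpha>\<close> on both sides.
\<close>

definition pareto_tails :: "'a measure \<Rightarrow> (nat \<Rightarrow> 'a \<Rightarrow> real) \<Rightarrow> real \<Rightarrow> real \<Rightarrow> bool" where
  "pareto_tails M Z \<alpha> c \<longleftrightarrow>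
     (\<forall>r>0. (\<lambda>n. real n * measure M {\<omega> \<in> space M. r < Z n \<omega>}) \<longlonglongrightarrow> c * r powr - \<alpha>) \<and>
     (\<forall>\<delta>. 0 < \<delta> \<longrightarrow> \<delta> < \<alpha> \<longrightarrow> (\<exists>C. \<forall>\<^sub>F n in sequentially. \<forall>r>0.
        real n * measure M {\<omega> \<in> space M. r < Z n \<omega>} \<le> C * potter_envelope \<alpha> \<delta> r))"

text \<open>
  Dominated convergence under the layer-cake integral. The limit is rewritten with the density
  \<open>\<alpha> / r\<^sup>\<alpha>\<^sup>+\<^sup>1\<close> because stable exponents are given in that form.
\<close>

lemma pareto_tails_integral:
  fixes \<gamma> :: "real \<Rightarrow> 'b::{banach, second_countable_topology}"
  assumes "prob_space M" and Z [measurable]: "\<And>n. Z n \<in> borel_measurable M"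
    and \<gamma> [measurable]: "\<gamma> \<in> borel_measurable borel"
    and \<alpha>: "0 < \<alpha>" and tails: "pareto_tails M Z \<alpha> c"
    and \<delta>: "0 < \<delta>" "\<delta> < \<alpha>"
    and int: "set_integrable lborel {0<..} (\<lambda>r. potter_envelope \<alpha> \<delta> r * norm (\<gamma> r))"
  shows "\<forall>\<^sub>F n in sequentially. integrable M (\<lambda>\<omega>. LINT r:{0<..<Z n \<omega>}|lborel. \<gamma> r)"
    and "(\<lambda>n. real n *\<^sub>R (LINT \<omega>|M. (LINT r:{0<..<Z n \<omega>}|lborel. \<gamma> r))) \<longlonglongrightarrow>
      c *\<^sub>R (LINT r:{0<..}|lborel. (\<alpha> / r powr (\<alpha> + 1)) *\<^sub>R (LINT s:{0<..<r}|lborel. \<gamma> s))"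
proof -
  interpret prob_space M by fact
  define T where "T = (\<lambda>n r. measure M {\<omega> \<in> space M. r < Z n \<omega>})"
  have T_mono: "T n r \<le> T n s" if "s \<le> r" for n r s
    unfolding T_def using that by (intro finite_measure_mono) auto
  have T_meas [measurable]: "T n \<in> borel_measurable borel" for n
  proof -
    have "mono (\<lambda>r. - T n r)" using T_mono by (auto intro!: monoI)
    then have "(\<lambda>r. - (- T n r)) \<in> borel_measurable borel"
      by (intro borel_measurable_uminus borel_measurable_mono)
    then show ?thesis by simp
  qed
  have T_nonneg: "0 \<le> T n r" for n r by (simp add: T_def)
  have lim: "(\<lambda>n. real n * T n r) \<longlonglongrightarrow> c * r powr - \<alpha>" if "0 < r" for r
    using tails that unfolding pareto_tails_def T_def by simp
  obtain C where C: "\<forall>\<^sub>F n in sequentially. \<forall>r>0. real n * T n r \<le> C * potter_envelope \<alpha> \<delta> r"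
    using tails \<delta> unfolding pareto_tails_def T_def by blast
  then obtain N where N: "\<And>n r. N \<le> n \<Longrightarrow> 0 < r \<Longrightarrow> real n * T n r \<le> C * potter_envelope \<alpha> \<delta> r"
    unfolding eventually_sequentially by blast
  define w where "w = (\<lambda>r. indicator {0<..} r *\<^sub>R (C * (potter_envelope \<alpha> \<delta> r * norm (\<gamma> r))))"
  have w_int: "integrable lborel w"
    using set_integrable_mult_right[OF int, of C] unfolding set_integrable_def w_def by blast
  have dom: "norm (indicator {0<..} r *\<^sub>R ((real n * T n r) *\<^sub>R \<gamma> r)) \<le> w r" if n: "N \<le> n" for n r
  proof (cases "0 < r")
    case True
    have "norm (indicator {0<..} r *\<^sub>R ((real n * T n r) *\<^sub>R \<gamma> r)) = real n * T n r * norm (\<gamma> r)"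
      using True T_nonneg[of n r] by simp
    also have "\<dots> \<le> C * potter_envelope \<alpha> \<delta> r * norm (\<gamma> r)"
      by (intro mult_right_mono N n True) simp
    finally show ?thesis using True by (simp add: w_def mult_ac)
  qed (simp add: w_def)
  have int_n: "integrable lborel (\<lambda>r. indicator {0<..} r *\<^sub>R ((real n * T n r) *\<^sub>R \<gamma> r))" if n: "N \<le> n" for n
    by (rule Bochner_Integration.integrable_bound[OF w_int]) (use dom[OF n] in \<open>auto intro!: AE_I2 order_trans[OF _ abs_ge_self]\<close>)
  have int_n': "set_integrable lborel {0<..} (\<lambda>r. T n r *\<^sub>R \<gamma> r)" if n: "N \<le> n" "0 < n" for n
  proof -
    have "integrable lborel (\<lambda>r. (1 / real n) *\<^sub>R (indicator {0<..} r *\<^sub>R ((real n * T n r) *\<^sub>R \<gamma> r)))"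
      by (intro integrable_scaleR_right int_n n)
    then show ?thesis using n unfolding set_integrable_def by (simp add: mult_ac)
  qed
  have fin: "emeasure M A < \<infinity>" for A
    using emeasure_finite[of A] by (simp add: less_top[symmetric])
  have lc: "integrable M (\<lambda>\<omega>. LINT r:{0<..<Z n \<omega>}|lborel. \<gamma> r)"
    "real n *\<^sub>R (LINT \<omega>|M. (LINT r:{0<..<Z n \<omega>}|lborel. \<gamma> r)) =
        (LINT r|lborel. indicator {0<..} r *\<^sub>R ((real n * T n r) *\<^sub>R \<gamma> r))" if n: "N \<le> n" "0 < n" for n
  proof -
    show "integrable M (\<lambda>\<omega>. LINT r:{0<..<Z n \<omega>}|lborel. \<gamma> r)"
      by (rule layer_cake(1)[OF sigma_finite_measure_axioms Z \<gamma> fin])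
        (use int_n'[OF n] in \<open>simp add: T_def\<close>)
    have "(LINT \<omega>|M. (LINT r:{0<..<Z n \<omega>}|lborel. \<gamma> r)) = (LINT r:{0<..}|lborel. T n r *\<^sub>R \<gamma> r)"
      unfolding T_def
      by (rule layer_cake(2)[OF sigma_finite_measure_axioms Z \<gamma> fin])
        (use int_n'[OF n] in \<open>simp add: T_def\<close>)
    also have "real n *\<^sub>R \<dots> = (LINT r|lborel. real n *\<^sub>R (indicator {0<..} r *\<^sub>R (T n r *\<^sub>R \<gamma> r)))"
      unfolding set_lebesgue_integral_def by (rule integral_scaleR_right[symmetric])
    also have "\<dots> = (LINT r|lborel. indicator {0<..} r *\<^sub>R ((real n * T n r) *\<^sub>R \<gamma> r))"
      by (simp add: mult_ac)
    finally show "real n *\<^sub>R (LINT \<omega>|M. (LINT r:{0<..<Z n \<omega>}|lborel. \<gamma> r)) =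
        (LINT r|lborel. indicator {0<..} r *\<^sub>R ((real n * T n r) *\<^sub>R \<gamma> r))" .
  qed
  show "\<forall>\<^sub>F n in sequentially. integrable M (\<lambda>\<omega>. LINT r:{0<..<Z n \<omega>}|lborel. \<gamma> r)"
    using eventually_ge_at_top[of N] eventually_gt_at_top[of 0] by eventually_elim (rule lc(1))
  define l where "l = (\<lambda>r. indicator {0<..} r *\<^sub>R ((c * r powr - \<alpha>) *\<^sub>R \<gamma> r))"
  have l_meas [measurable]: "l \<in> borel_measurable lborel" unfolding l_def by measurable
  have AE_lim: "AE r in lborel. (\<lambda>n. indicator {0<..} r *\<^sub>R ((real (n + N) * T (n + N) r) *\<^sub>R \<gamma> r)) \<longlonglongrightarrow> l r"
  proof (intro AE_I2)
    fix r
    show "(\<lambda>n. indicator {0<..} r *\<^sub>R ((real (n + N) * T (n + N) r) *\<^sub>R \<gamma> r)) \<longlonglongrightarrow> l r"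
    proof (cases "0 < r")
      case True
      have "(\<lambda>n. real (n + N) * T (n + N) r) \<longlonglongrightarrow> c * r powr - \<alpha>"
        using LIMSEQ_ignore_initial_segment[OF lim[OF True], of N] .
      then show ?thesis unfolding l_def by (intro tendsto_scaleR tendsto_const)
    qed (simp add: l_def)
  qed
  have DC: "integrable lborel l"
    "(\<lambda>n. LINT r|lborel. indicator {0<..} r *\<^sub>R ((real (n + N) * T (n + N) r) *\<^sub>R \<gamma> r)) \<longlonglongrightarrow> (LINT r|lborel. l r)"
  proof -
    have m: "(\<lambda>r. indicator {0<..} r *\<^sub>R ((real (n + N) * T (n + N) r) *\<^sub>R \<gamma> r)) \<in> borel_measurable lborel" for n
      by measurable
    have b: "AE r in lborel. norm (indicator {0<..} r *\<^sub>R ((real (n + N) * T (n + N) r) *\<^sub>R \<gamma> r)) \<le> w r" for n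
      by (intro AE_I2 dom) simp
    show "integrable lborel l"
      by (rule integrable_dominated_convergence[OF l_meas m w_int AE_lim b])
    show "(\<lambda>n. LINT r|lborel. indicator {0<..} r *\<^sub>R ((real (n + N) * T (n + N) r) *\<^sub>R \<gamma> r)) \<longlonglongrightarrow> (LINT r|lborel. l r)"
      by (rule integral_dominated_convergence[OF l_meas m w_int AE_lim b])
  qed
  have "(\<lambda>n. LINT r|lborel. indicator {0<..} r *\<^sub>R ((real n * T n r) *\<^sub>R \<gamma> r)) \<longlonglongrightarrow> (LINT r|lborel. l r)"
    by (rule LIMSEQ_offset[OF DC(2)])
  moreover have "\<forall>\<^sub>F n in sequentially. (LINT r|lborel. indicator {0<..} r *\<^sub>R ((real n * T n r) *\<^sub>R \<gamma> r)) =
      real n *\<^sub>R (LINT \<omega>|M. (LINT r:{0<..<Z n \<omega>}|lborel. \<gamma> r))"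
    using eventually_ge_at_top[of N] eventually_gt_at_top[of 0] by eventually_elim (rule lc(2)[symmetric])
  ultimately have lim_l: "(\<lambda>n. real n *\<^sub>R (LINT \<omega>|M. (LINT r:{0<..<Z n \<omega>}|lborel. \<gamma> r))) \<longlonglongrightarrow> (LINT r|lborel. l r)"
    by (rule Lim_transform_eventually)
  have "(LINT r|lborel. l r) =
      c *\<^sub>R (LINT r:{0<..}|lborel. (\<alpha> / r powr (\<alpha> + 1)) *\<^sub>R (LINT s:{0<..<r}|lborel. \<gamma> s))"
  proof (cases "c = 0")
    case False
    have l_eq: "l r = c *\<^sub>R (indicator {0<..} r *\<^sub>R ((r powr - \<alpha>) *\<^sub>R \<gamma> r))" for r
      by (simp add: l_def mult_ac)
    have "set_integrable lborel {0<..} (\<lambda>r. (r powr - \<alpha>) *\<^sub>R \<gamma> r)"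
      unfolding set_integrable_def using integrable_scaleR_right[OF DC(1), of "1 / c"] False
      by (simp add: l_eq)
    note plc = pareto_layer_cake(2)[OF \<alpha> \<gamma> this]
    show ?thesis unfolding plc unfolding l_eq set_lebesgue_integral_def by (rule integral_scaleR_right)
  qed (simp add: l_def)
  with lim_l show "(\<lambda>n. real n *\<^sub>R (LINT \<omega>|M. (LINT r:{0<..<Z n \<omega>}|lborel. \<gamma> r))) \<longlonglongrightarrow>
      c *\<^sub>R (LINT r:{0<..}|lborel. (\<alpha> / r powr (\<alpha> + 1)) *\<^sub>R (LINT s:{0<..<r}|lborel. \<gamma> s))" by simp
qed

lemma set_integrable_envelope_cutoff:
  fixes w :: "real \<Rightarrow> real"
  assumes w: "w \<in> borel_measurable borel" and D: "0 \<le> D"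
    and p: "-1 < p - (\<alpha> + \<delta>)" "\<And>r. 0 < r \<Longrightarrow> r \<le> 1 \<Longrightarrow> \<bar>w r\<bar> \<le> D * r powr p"
    and bd: "\<And>r. 0 < r \<Longrightarrow> \<bar>w r\<bar> \<le> D" and cut: "\<And>r. K < r \<Longrightarrow> w r = 0"
  shows "set_integrable lborel {0<..} (\<lambda>r. potter_envelope \<alpha> \<delta> r * w r)"
proof -
  define e where "e = \<bar>\<alpha> - \<delta> - 2\<bar>"
  define D' where "D' = D * (max 1 K) powr e"
  have "1 \<le> (max 1 K) powr e" by (rule ge_one_powr_ge_zero) (auto simp: e_def)
  then have "D * 1 \<le> D'" unfolding D'_def using D by (intro mult_left_mono) auto
  then have D': "D \<le> D'" by simp
  show ?thesis
  proof (rule set_integrable_envelope[where p = p and q = "\<alpha> - \<delta> - 2" and D = D', OF w p(1)])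
    show "\<bar>w r\<bar> \<le> D' * r powr p" if "0 < r" "r \<le> 1" for r
      using p(2)[OF that] D' by (meson mult_right_mono order_trans powr_ge_zero)
    show "\<bar>w r\<bar> \<le> D' * r powr (\<alpha> - \<delta> - 2)" if r: "1 < r" for r
    proof (cases "r \<le> K")
      case True
      have "1 = r powr e * r powr - e" using r by (simp add: powr_minus)
      also have "\<dots> \<le> (max 1 K) powr e * r powr (\<alpha> - \<delta> - 2)"
        using r True by (intro mult_mono powr_mono2 powr_mono) (auto simp: e_def)
      finally have "D * 1 \<le> D' * r powr (\<alpha> - \<delta> - 2)"
        unfolding D'_def mult.assoc by (intro mult_left_mono D)
      then show ?thesis using bd[of r] r by linarith
    qed (use cut[of r] D D' in auto)
  qed auto
qed

text \<open>
  For \<open>\<alpha> \<le> 1\<close> and a primitive that is bounded but oscillates, \<open>\<gamma>(r) r\<^sup>-\<^sup>\<alpha>\<close> is not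
  integrable at infinity. The primitive is therefore stopped at a level \<open>K\<close>; the error is at most
  \<open>2 D\<close> times the tail at \<open>K\<close>, uniformly in \<open>n\<close>.
\<close>

lemma pareto_tails_integral_bounded:
  fixes \<gamma> :: "real \<Rightarrow> 'b::{banach, second_countable_topology}"
  assumes "prob_space M" and Z [measurable]: "\<And>n. Z n \<in> borel_measurable M"
    and \<gamma> [measurable]: "\<gamma> \<in> borel_measurable borel"
    and \<alpha>: "0 < \<alpha>" and tails: "pareto_tails M Z \<alpha> c"
    and p: "-1 < p - \<alpha>" and \<gamma>_small: "\<And>r. 0 < r \<Longrightarrow> r \<le> 1 \<Longrightarrow> norm (\<gamma> r) \<le> D * r powr p"
    and \<gamma>_bounded: "\<And>r. 0 < r \<Longrightarrow> norm (\<gamma> r) \<le> D"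
    and G_meas [measurable]: "(\<lambda>x. LINT r:{0<..<x}|lborel. \<gamma> r) \<in> borel_measurable borel"
    and G_bounded: "\<And>x. 0 < x \<Longrightarrow> norm (LINT r:{0<..<x}|lborel. \<gamma> r) \<le> D"
  shows "(\<lambda>n. real n *\<^sub>R (LINT \<omega>|M. (LINT r:{0<..<Z n \<omega>}|lborel. \<gamma> r))) \<longlonglongrightarrow>
      c *\<^sub>R (LINT r:{0<..}|lborel. (\<alpha> / r powr (\<alpha> + 1)) *\<^sub>R (LINT s:{0<..<r}|lborel. \<gamma> s))"
proof -
  interpret prob_space M by fact
  define G where "G = (\<lambda>x. LINT r:{0<..<x}|lborel. \<gamma> r)"
  have G_m [measurable]: "G \<in> borel_measurable borel" unfolding G_def by fact
  define \<gamma>' where "\<gamma>' = (\<lambda>K r. indicator {..real K} r *\<^sub>R \<gamma> r)"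
  have \<gamma>'_m [measurable]: "\<gamma>' K \<in> borel_measurable borel" for K unfolding \<gamma>'_def by measurable
  define G' where "G' = (\<lambda>K x. LINT r:{0<..<x}|lborel. \<gamma>' K r)"
  have D: "0 \<le> D" using norm_ge_zero order_trans \<gamma>_bounded[of 1] by (metis zero_less_one)
  define \<delta> where "\<delta> = min (\<alpha> / 2) ((p - \<alpha> + 1) / 2)"
  have \<delta>: "0 < \<delta>" "\<delta> < \<alpha>" "-1 < p - (\<alpha> + \<delta>)" using \<alpha> p by (auto simp: \<delta>_def min_def field_simps)
  have G'_eq: "G' K x = G (min x (real K))" for K x
    unfolding G'_def G_def \<gamma>'_def by (rule set_integral_cutoff) measurable
  have G0: "G x = 0" if "x \<le> 0" for x
    using that by (simp add: G_def set_lebesgue_integral_def)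
  have G_bd: "norm (G x) \<le> D" for x
    using G_bounded[of x] G0[of x] D by (cases "0 < x") (auto simp: G_def)
  have int': "set_integrable lborel {0<..} (\<lambda>r. potter_envelope \<alpha> \<delta> r * norm (\<gamma>' K r))" for K
    by (rule set_integrable_envelope_cutoff[where p = p and D = D and K = "real K"])
       (use \<delta> D \<gamma>_small \<gamma>_bounded in \<open>auto simp: \<gamma>'_def indicator_def\<close>)
  define \<beta> where "\<beta> = (\<lambda>K. c *\<^sub>R (LINT r:{0<..}|lborel. (\<alpha> / r powr (\<alpha> + 1)) *\<^sub>R G' K r))"
  have lim_K: "(\<lambda>n. real n *\<^sub>R (LINT \<omega>|M. G' K (Z n \<omega>))) \<longlonglongrightarrow> \<beta> K" for K
    unfolding \<beta>_def G'_def
    by (rule pareto_tails_integral(2)[OF \<open>prob_space M\<close> Z \<gamma>'_m \<alpha> tails \<delta>(1,2) int'])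
  have near: "\<forall>\<^sub>F n in sequentially. dist (real n *\<^sub>R (LINT \<omega>|M. G (Z n \<omega>))) (real n *\<^sub>R (LINT \<omega>|M. G' (Suc K) (Z n \<omega>)))
      \<le> 2 * D * (\<bar>c\<bar> + 1) * (real (Suc K)) powr - \<alpha>" for K
  proof -
    let ?K = "real (Suc K)"
    have "(\<lambda>n. real n * measure M {\<omega> \<in> space M. ?K < Z n \<omega>}) \<longlonglongrightarrow> c * ?K powr - \<alpha>"
      using tails unfolding pareto_tails_def by simp
    moreover have "c * ?K powr - \<alpha> < (\<bar>c\<bar> + 1) * ?K powr - \<alpha>"
      by (intro mult_strict_right_mono) auto
    ultimately have "\<forall>\<^sub>F n in sequentially. real n * measure M {\<omega> \<in> space M. ?K < Z n \<omega>} < (\<bar>c\<bar> + 1) * ?K powr - \<alpha>"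
      by (rule order_tendstoD(2))
    then show ?thesis
    proof eventually_elim
      case (elim n)
      let ?A = "{\<omega> \<in> space M. ?K < Z n \<omega>}"
      have i1: "integrable M (\<lambda>\<omega>. G (Z n \<omega>))" "integrable M (\<lambda>\<omega>. G' (Suc K) (Z n \<omega>))"
        unfolding G'_eq by (auto intro!: integrable_const_bound[of _ D] AE_I2 G_bd)
      have "norm ((LINT \<omega>|M. G (Z n \<omega>)) - (LINT \<omega>|M. G' (Suc K) (Z n \<omega>)))
          = norm (LINT \<omega>|M. G (Z n \<omega>) - G' (Suc K) (Z n \<omega>))"
        by (simp add: i1)
      also have "\<dots> \<le> (LINT \<omega>|M. norm (G (Z n \<omega>) - G' (Suc K) (Z n \<omega>)))"
        by (rule integral_norm_bound)
      also have "\<dots> \<le> (LINT \<omega>|M. 2 * D * indicator ?A \<omega>)"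
      proof (rule integral_mono)
        fix \<omega> assume "\<omega> \<in> space M"
        then show "norm (G (Z n \<omega>) - G' (Suc K) (Z n \<omega>)) \<le> 2 * D * indicator ?A \<omega>"
          using norm_triangle_ineq4[of "G (Z n \<omega>)" "G (min (Z n \<omega>) ?K)"] G_bd[of "Z n \<omega>"] G_bd[of "min (Z n \<omega>) ?K"]
          by (auto simp: G'_eq indicator_def min_def)
      qed (auto intro!: i1 integrable_norm Bochner_Integration.integrable_diff simp: less_top[symmetric])
      also have "\<dots> = 2 * D * measure M ?A" by simp
      finally have "norm ((LINT \<omega>|M. G (Z n \<omega>)) - (LINT \<omega>|M. G' (Suc K) (Z n \<omega>))) \<le> 2 * D * measure M ?A" .
      then have "real n * norm ((LINT \<omega>|M. G (Z n \<omega>)) - (LINT \<omega>|M. G' (Suc K) (Z n \<omega>))) \<le> real n * (2 * D * measure M ?A)"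
        by (intro mult_left_mono) auto
      also have "\<dots> = 2 * D * (real n * measure M ?A)" by simp
      also have "\<dots> \<le> 2 * D * ((\<bar>c\<bar> + 1) * ?K powr - \<alpha>)"
        using elim D by (intro mult_left_mono) auto
      also have "\<dots> = 2 * D * (\<bar>c\<bar> + 1) * ?K powr - \<alpha>" by simp
      finally show ?case
        unfolding dist_norm scaleR_diff_right[symmetric] norm_scaleR by (simp only: abs_of_nat)
    qed
  qed
  have e0: "(\<lambda>K. 2 * D * (\<bar>c\<bar> + 1) * (real (Suc K)) powr - \<alpha>) \<longlonglongrightarrow> 0"
  proof -
    have "(\<lambda>K. (real (Suc K)) powr - \<alpha>) \<longlonglongrightarrow> 0"
      using \<alpha> by (intro tendsto_neg_powr filterlim_compose[OF filterlim_real_sequentially filterlim_Suc]) auto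
    from tendsto_mult_right_zero[OF this] show ?thesis by simp
  qed
  have \<beta>_lim: "(\<lambda>K. \<beta> (Suc K)) \<longlonglongrightarrow> c *\<^sub>R (LINT r:{0<..}|lborel. (\<alpha> / r powr (\<alpha> + 1)) *\<^sub>R G r)"
  proof -
    have pint: "set_integrable lborel {0<..} (\<lambda>r. (\<alpha> / r powr (\<alpha> + 1)) *\<^sub>R G' 1 r)"
      unfolding G'_def
    proof (rule pareto_layer_cake(1)[OF \<alpha> \<gamma>'_m])
      have "set_integrable lborel {0<..1} (\<lambda>r. D * r powr (p - \<alpha>))"
        using p by (intro set_integrable_mult_right set_integrable_powr_Ioc) auto
      then show "set_integrable lborel {0<..} (\<lambda>r. r powr - \<alpha> *\<^sub>R \<gamma>' 1 r)"
        unfolding set_integrable_def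
      proof (rule Bochner_Integration.integrable_bound)
        show "AE r in lborel. norm (indicator {0<..} r *\<^sub>R r powr - \<alpha> *\<^sub>R \<gamma>' 1 r) \<le> norm (indicator {0<..1} r *\<^sub>R (D * r powr (p - \<alpha>)))"
        proof (intro AE_I2)
          fix r :: real
          have "norm (r powr - \<alpha> *\<^sub>R \<gamma> r) \<le> D * r powr (p - \<alpha>)" if r: "0 < r" "r \<le> 1"
          proof -
            have "norm (r powr - \<alpha> *\<^sub>R \<gamma> r) \<le> r powr - \<alpha> * (D * r powr p)"
              using \<gamma>_small[OF r] by (simp add: mult_left_mono)
            also have "\<dots> = D * (r powr p * r powr - \<alpha>)" by simp
            also have "r powr p * r powr - \<alpha> = r powr (p - \<alpha>)"
              by (simp only: powr_add[symmetric] diff_conv_add_uminus)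
            finally show ?thesis .
          qed
          then show "norm (indicator {0<..} r *\<^sub>R r powr - \<alpha> *\<^sub>R \<gamma>' 1 r) \<le> norm (indicator {0<..1} r *\<^sub>R (D * r powr (p - \<alpha>)))"
            by (auto simp: \<gamma>'_def indicator_def)
        qed
      qed measurable
    qed
    \<comment> \<open>Up to \<open>1\<close> all stopped primitives agree with the one stopped at \<open>1\<close>; beyond \<open>1\<close> boundedness is enough.\<close>
    define w where "w = (\<lambda>r. norm (indicator {0<..} r *\<^sub>R (\<alpha> / r powr (\<alpha> + 1)) *\<^sub>R G' 1 r)
        + indicator {1..} r *\<^sub>R (\<alpha> * D * r powr (- \<alpha> - 1)))"
    have w: "integrable lborel w"
    proof -
      have "set_integrable lborel {1..} (\<lambda>r. \<alpha> * D * r powr (- \<alpha> - 1))"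
        using \<alpha> by (intro set_integrable_mult_right set_integrable_powr_Ici) auto
      then show ?thesis unfolding w_def
        by (intro Bochner_Integration.integrable_add integrable_norm pint[unfolded set_integrable_def])
           (simp add: set_integrable_def)
    qed
    have bound: "norm (indicator {0<..} r *\<^sub>R ((\<alpha> / r powr (\<alpha> + 1)) *\<^sub>R G' (Suc K) r)) \<le> w r" for r K
    proof (cases "r \<le> 1")
      case True
      then have "G' (Suc K) r = G' 1 r" by (simp add: G'_eq min_def)
      then show ?thesis using \<alpha> D by (simp add: w_def)
    next
      case False
      have "r powr (- \<alpha> - 1) = 1 / r powr (\<alpha> + 1)"
        using powr_minus_divide[of r "\<alpha> + 1"] by (simp only: minus_add_distrib diff_conv_add_uminus)
      moreover have "norm ((\<alpha> / r powr (\<alpha> + 1)) *\<^sub>R G' (Suc K) r) \<le> (\<alpha> / r powr (\<alpha> + 1)) * D"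
        using \<alpha> G_bd unfolding G'_eq norm_scaleR by (intro mult_mono) auto
      ultimately show ?thesis using False by (simp add: w_def mult_ac add_increasing)
    qed
    have lim: "(\<lambda>K. indicator {0<..} r *\<^sub>R ((\<alpha> / r powr (\<alpha> + 1)) *\<^sub>R G' (Suc K) r)) \<longlonglongrightarrow>
        indicator {0<..} r *\<^sub>R ((\<alpha> / r powr (\<alpha> + 1)) *\<^sub>R G r)" for r
    proof (rule tendsto_eventually)
      show "\<forall>\<^sub>F K in sequentially. indicator {0<..} r *\<^sub>R (\<alpha> / r powr (\<alpha> + 1)) *\<^sub>R G' (Suc K) r =
          indicator {0<..} r *\<^sub>R (\<alpha> / r powr (\<alpha> + 1)) *\<^sub>R G r"
        using eventually_ge_at_top[of "nat \<lceil>r\<rceil>"]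
      proof eventually_elim
        case (elim K)
        then have "r \<le> real (Suc K)" by linarith
        then show ?case by (simp add: G'_eq min_def)
      qed
    qed
    show ?thesis
      unfolding \<beta>_def set_lebesgue_integral_def[of _ "{0<..}"]
      by (intro tendsto_scaleR tendsto_const integral_dominated_convergence[where w = w])
         (use lim bound w in \<open>auto simp: G'_eq[abs_def]\<close>)
  qed
  have "(\<lambda>n. real n *\<^sub>R (LINT \<omega>|M. G (Z n \<omega>))) \<longlonglongrightarrow> c *\<^sub>R (LINT r:{0<..}|lborel. (\<alpha> / r powr (\<alpha> + 1)) *\<^sub>R G r)"
    by (rule tendsto_of_approximations[OF lim_K \<beta>_lim near e0])
  then show ?thesis by (simp add: G_def)
qed

section \<open>Characteristic functions of arrays with Pareto tails\<close>

text \<open>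
  The exponent contributed by jumps in the positive direction; negative jumps contribute its
  value at \<open>- t\<close>.
\<close>

definition levy_exponent :: "real \<Rightarrow> real \<Rightarrow> complex" where
  "levy_exponent \<alpha> t = (CLINT r:{0<..}|lborel. stable_kernel \<alpha> t 1 r / of_real (r powr (\<alpha> + 1)))"

lemma set_integral_vector_derivative:
  fixes F f :: "real \<Rightarrow> 'a::euclidean_space"
  assumes F: "\<And>x. (F has_vector_derivative f x) (at x)" and f: "continuous_on UNIV f"
  shows "(LINT s:{0<..<x}|lborel. f s) = (if 0 < x then F x - F 0 else 0)"
proof (cases "0 < x")
  case True
  have "(LBINT s=ereal 0..ereal x. f s) = F x - F 0"
    by (intro interval_integral_FTC_finite has_vector_derivative_at_within[OF F]
        continuous_on_subset[OF f]) auto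
  then show ?thesis using True interval_integral_Ioo[of "ereal 0" "ereal x" f] by simp
qed (simp add: set_lebesgue_integral_def)

lemma set_integral_iexp:
  "(CLINT s:{0<..<x}|lborel. \<i> * of_real t * iexp (t * s)) = (if 0 < x then iexp (t * x) - 1 else 0)"
  by (subst set_integral_vector_derivative[where F = "\<lambda>x. iexp (t * x)"])
     (auto intro!: derivative_eq_intros continuous_intros has_vector_derivative_real_field simp: mult_ac)

lemma set_integral_iexp_compensated:
  "(CLINT s:{0<..<x}|lborel. \<i> * of_real t * (iexp (t * s) - 1)) =
     (if 0 < x then iexp (t * x) - 1 - \<i> * of_real (t * x) else 0)"
  by (subst set_integral_vector_derivative[where F = "\<lambda>x. iexp (t * x) - \<i> * of_real (t * x)"])
     (auto intro!: derivative_eq_intros continuous_intros has_vector_derivative_real_field simp: algebra_simps)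

lemma set_integral_cos:
  "(CLINT s:{0<..<x}|lborel. of_real (- t * sin (t * s))) = (if 0 < x then of_real (cos (t * x) - 1) else (0 :: complex))"
  by (subst set_integral_vector_derivative[where F = "\<lambda>x. of_real (cos (t * x))"])
     (auto intro!: derivative_eq_intros continuous_intros simp flip: has_real_derivative_iff_has_vector_derivative)

lemma norm_iexp_minus_1: "norm (iexp x - 1) \<le> \<bar>x\<bar>"
  using iexp_approx1[of x 0] by simp

lemma norm_iexp_minus_1': "norm (iexp x - 1) \<le> 2"
  using norm_triangle_ineq4[of "iexp x" 1] by simp

lemma norm_iexp_minus_1_minus: "norm (iexp x - 1 - \<i> * of_real x) \<le> x\<^sup>2 / 2"
  using iexp_approx1[of x 1] by (simp add: power2_eq_square diff_diff_eq numeral_2_eq_2)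

lemma set_integral_scaleR_pareto:
  fixes g :: "real \<Rightarrow> complex"
  shows "(LINT r:{0<..}|lborel. (\<alpha> / r powr (\<alpha> + 1)) *\<^sub>R g r) =
    of_real \<alpha> * (CLINT r:{0<..}|lborel. g r / of_real (r powr (\<alpha> + 1)))"
proof -
  have "(LINT r:{0<..}|lborel. (\<alpha> / r powr (\<alpha> + 1)) *\<^sub>R g r) =
      (LINT r:{0<..}|lborel. of_real \<alpha> * (g r / of_real (r powr (\<alpha> + 1))))"
    by (intro arg_cong[where f = "set_lebesgue_integral lborel {0<..}"] ext)
       (simp add: scaleR_conv_of_real)
  then show ?thesis by (simp only: set_integral_mult_right)
qed

lemma set_integral_cong_simp:
  assumes "\<And>x. x \<in> A \<Longrightarrow> f x = g x"
  shows "(LINT x:A|M. f x) = (LINT x:A|M. g x)"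
  unfolding set_lebesgue_integral_def
  using assms by (intro Bochner_Integration.integral_cong) (auto simp: indicator_def)

text \<open>
  For \<open>\<alpha> = 1\<close> the exponents at \<open>t\<close> and \<open>- t\<close> are added, and the centring terms cancel
  only after each integral is known to exist.
\<close>

lemma set_integrable_stable_kernel_1:
  "set_integrable lborel {0<..} (\<lambda>r. stable_kernel 1 t 1 r / of_real (r powr (1 + 1)))"
proof -
  have m: "(\<lambda>r. stable_kernel 1 t 1 r / of_real (r powr (1 + 1))) \<in> borel_measurable borel"
    unfolding stable_kernel_def by measurable
  have 1: "set_integrable lborel {0<..1} (\<lambda>r. stable_kernel 1 t 1 r / of_real (r powr (1 + 1)))"
  proof (rule set_integrable_bound)
    show "set_integrable lborel {0<..1} (\<lambda>r. t\<^sup>2 / 2 * r powr 0)"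
      by (intro set_integrable_mult_right set_integrable_powr_Ioc) auto
    show "AE r in lborel. r \<in> {0<..1} \<longrightarrow> norm (stable_kernel 1 t 1 r / of_real (r powr (1 + 1))) \<le> norm (t\<^sup>2 / 2 * r powr 0)"
    proof (intro AE_I2 impI)
      fix r :: real assume r: "r \<in> {0<..1}"
      have "norm (stable_kernel 1 t 1 r) \<le> (t * r)\<^sup>2 / 2"
        using norm_iexp_minus_1_minus[of "t * r"] r by (simp add: stable_kernel_def)
      then show "norm (stable_kernel 1 t 1 r / of_real (r powr (1 + 1))) \<le> norm (t\<^sup>2 / 2 * r powr 0)"
        using r by (simp add: norm_divide norm_power powr_numeral[of r "num.Bit0 num.One", simplified] power_mult_distrib field_simps)
    qed
  qed (use m in \<open>simp add: set_borel_measurable_def\<close>)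
  have 2: "set_integrable lborel {1<..} (\<lambda>r. stable_kernel 1 t 1 r / of_real (r powr (1 + 1)))"
  proof (rule set_integrable_bound)
    have "set_integrable lborel {1<..} (\<lambda>r :: real. r powr -2)"
      by (rule set_integrable_subset[OF set_integrable_powr_Ici[of _ 1]]) auto
    then show "set_integrable lborel {1<..} (\<lambda>r :: real. 2 * r powr -2)"
      by (intro set_integrable_mult_right)
    show "AE r in lborel. r \<in> {1<..} \<longrightarrow> norm (stable_kernel 1 t 1 r / of_real (r powr (1 + 1))) \<le> norm (2 * r powr -2)"
    proof (intro AE_I2 impI)
      fix r :: real assume r: "r \<in> {1<..}"
      have "norm (stable_kernel 1 t 1 r) \<le> 2"
        using norm_iexp_minus_1'[of "t * r"] r by (simp add: stable_kernel_def)
      then show "norm (stable_kernel 1 t 1 r / of_real (r powr (1 + 1))) \<le> norm (2 * r powr -2)"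
        using r by (simp add: norm_divide norm_power powr_minus_divide divide_right_mono)
    qed
  qed (use m in \<open>simp add: set_borel_measurable_def\<close>)
  have "{0<..} = {0<..1} \<union> ({1<..} :: real set)" by auto
  then show ?thesis using set_integrable_Un[OF 1 2] by simp
qed

text \<open>
  The positive and the negative part of \<open>Z n\<close> are integrated separately. For \<open>\<alpha> < 1\<close> the
  integrand is \<open>iexp - 1\<close>; for \<open>\<alpha> > 1\<close> centring allows \<open>iexp - 1\<close> to be compensated by its
  linear part, which makes the tail integral converge absolutely at zero and infinity; for
  \<open>\<alpha> = 1\<close> symmetry leaves only the cosine.
\<close>

lemma char_pareto_tails:
  assumes "prob_space M" and Z [measurable]: "\<And>n. Z n \<in> borel_measurable M"
    and \<alpha>: "0 < \<alpha>" "\<alpha> < 2"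
    and tails: "pareto_tails M Z \<alpha> cp" "pareto_tails M (\<lambda>n \<omega>. - Z n \<omega>) \<alpha> cm"
    and symm: "\<And>n. \<alpha> = 1 \<Longrightarrow> distr M borel (\<lambda>\<omega>. - Z n \<omega>) = distr M borel (Z n)"
    and cp_cm: "\<alpha> = 1 \<Longrightarrow> cp = cm"
    and centred: "\<And>n. 1 < \<alpha> \<Longrightarrow> integrable M (Z n)" "\<And>n. 1 < \<alpha> \<Longrightarrow> (LINT \<omega>|M. Z n \<omega>) = 0"
  shows "(\<lambda>n. real n *\<^sub>R ((CLINT \<omega>|M. iexp (t * Z n \<omega>)) - 1)) \<longlonglongrightarrow>
    of_real (cp * \<alpha>) * levy_exponent \<alpha> t + of_real (cm * \<alpha>) * levy_exponent \<alpha> (- t)"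
proof -
  interpret prob_space M by fact
  have Z' [measurable]: "(\<lambda>\<omega>. - Z n \<omega>) \<in> borel_measurable M" for n by measurable
  define D where "D = 2 + \<bar>t\<bar> + t\<^sup>2"
  have D: "2 \<le> D" "\<bar>t\<bar> \<le> D" "t\<^sup>2 \<le> D" by (auto simp: D_def)
  have iexp_int: "integrable M (\<lambda>\<omega>. iexp (u * Z n \<omega>))" for u n
    by (auto intro!: integrable_const_bound[of _ 1])
  consider "\<alpha> < 1" | "\<alpha> = 1" | "1 < \<alpha>" by linarith
  then show ?thesis
  proof cases
    case 1
    define G where "G = (\<lambda>u x. CLINT s:{0<..<x}|lborel. \<i> * of_real u * iexp (u * s))"
    have G: "G u x = (if 0 < x then iexp (u * x) - 1 else 0)" for u x
      unfolding G_def by (rule set_integral_iexp)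
    have one: "(\<lambda>n. real n *\<^sub>R (LINT \<omega>|M. G u (Y n \<omega>))) \<longlonglongrightarrow> of_real (c * \<alpha>) * levy_exponent \<alpha> u"
      if Y [measurable]: "\<And>n. Y n \<in> borel_measurable M" and "pareto_tails M Y \<alpha> c" and u: "\<bar>u\<bar> = \<bar>t\<bar>" for u Y c
    proof -
      have "(\<lambda>n. real n *\<^sub>R (LINT \<omega>|M. G u (Y n \<omega>))) \<longlonglongrightarrow>
          c *\<^sub>R (LINT r:{0<..}|lborel. (\<alpha> / r powr (\<alpha> + 1)) *\<^sub>R G u r)"
        unfolding G_def
        apply (rule pareto_tails_integral_bounded[where D = D and p = 0, OF \<open>prob_space M\<close> Y _ \<alpha>(1) that(2)])
        subgoal by measurable
        subgoal using 1 by simp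
        subgoal using u D by (simp add: norm_mult)
        subgoal using u D by (simp add: norm_mult)
        subgoal unfolding set_integral_iexp by measurable
        subgoal for x unfolding set_integral_iexp using order_trans[OF norm_iexp_minus_1'[of "u * x"] D(1)] by simp
        done
      also have "(LINT r:{0<..}|lborel. (\<alpha> / r powr (\<alpha> + 1)) *\<^sub>R G u r) = of_real \<alpha> * levy_exponent \<alpha> u"
        unfolding set_integral_scaleR_pareto levy_exponent_def
        by (intro arg_cong[where f = "\<lambda>x. of_real \<alpha> * x"] set_integral_cong_simp)
           (use 1 in \<open>auto simp: G stable_kernel_def\<close>)
      finally show ?thesis by (simp add: scaleR_conv_of_real mult_ac)
    qed
    have "(\<lambda>n. real n *\<^sub>R (LINT \<omega>|M. G t (Z n \<omega>)) + real n *\<^sub>R (LINT \<omega>|M. G (- t) (- Z n \<omega>))) \<longlonglongrightarrow>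
        of_real (cp * \<alpha>) * levy_exponent \<alpha> t + of_real (cm * \<alpha>) * levy_exponent \<alpha> (- t)"
      by (intro tendsto_add one Z Z' tails) auto
    moreover have "real n *\<^sub>R (LINT \<omega>|M. G t (Z n \<omega>)) + real n *\<^sub>R (LINT \<omega>|M. G (- t) (- Z n \<omega>)) =
        real n *\<^sub>R ((CLINT \<omega>|M. iexp (t * Z n \<omega>)) - 1)" for n
    proof -
      have i: "integrable M (\<lambda>\<omega>. G t (Z n \<omega>))" "integrable M (\<lambda>\<omega>. G (- t) (- Z n \<omega>))"
        unfolding G using norm_iexp_minus_1'
        by (auto intro!: integrable_const_bound[of _ 2] AE_I2 simp del: of_real_mult)
      have "(LINT \<omega>|M. G t (Z n \<omega>)) + (LINT \<omega>|M. G (- t) (- Z n \<omega>)) = (LINT \<omega>|M. iexp (t * Z n \<omega>) - 1)"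
        by (subst Bochner_Integration.integral_add[OF i, symmetric])
           (auto intro!: Bochner_Integration.integral_cong simp: G)
      also have "\<dots> = (CLINT \<omega>|M. iexp (t * Z n \<omega>)) - 1"
        using iexp_int[of t n] by (simp add: prob_space)
      finally show ?thesis by (simp add: scaleR_add_right[symmetric])
    qed
    ultimately show ?thesis by simp
  next
    case 2
    define G where "G = (\<lambda>x. CLINT s:{0<..<x}|lborel. of_real (- t * sin (t * s)))"
    have G: "G x = (if 0 < x then of_real (cos (t * x) - 1) else 0)" for x
      unfolding G_def by (rule set_integral_cos)
    have abs_sin: "\<bar>sin x\<bar> \<le> \<bar>x\<bar>" for x :: real by (rule abs_sin_x_le_abs_x)
    have one: "(\<lambda>n. real n *\<^sub>R (LINT \<omega>|M. G (Y n \<omega>))) \<longlonglongrightarrow>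
        of_real c * (CLINT r:{0<..}|lborel. of_real (cos (t * r) - 1) / of_real (r powr (1 + 1)))"
      if Y [measurable]: "\<And>n. Y n \<in> borel_measurable M" and "pareto_tails M Y \<alpha> c" for Y c
    proof -
      have "(\<lambda>n. real n *\<^sub>R (LINT \<omega>|M. G (Y n \<omega>))) \<longlonglongrightarrow>
          c *\<^sub>R (LINT r:{0<..}|lborel. (\<alpha> / r powr (\<alpha> + 1)) *\<^sub>R G r)"
        unfolding G_def
        apply (rule pareto_tails_integral_bounded[where D = D and p = 1, OF \<open>prob_space M\<close> Y _ \<alpha>(1) that(2)])
        subgoal by measurable
        subgoal using 2 by simp
        subgoal premises prems for r
        proof -
          have "\<bar>t\<bar> * \<bar>sin (t * r)\<bar> \<le> \<bar>t\<bar> * \<bar>t * r\<bar>" by (intro mult_left_mono abs_sin) simp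
          also have "\<dots> = t\<^sup>2 * r" using prems by (simp add: power2_eq_square abs_mult)
          also have "\<dots> \<le> D * r" using D prems by (intro mult_right_mono) auto
          finally show ?thesis using prems by (simp add: norm_mult del: of_real_mult of_real_minus) (simp add: abs_mult)
        qed
        subgoal premises prems for r
        proof -
          have "\<bar>t\<bar> * \<bar>sin (t * r)\<bar> \<le> \<bar>t\<bar> * 1" by (intro mult_left_mono) auto
          then show ?thesis using D by (simp add: norm_mult del: of_real_mult of_real_minus) (simp add: abs_mult)
        qed
        subgoal unfolding set_integral_cos by measurable
        subgoal for x
        proof -
          have "\<bar>cos (t * x) - 1\<bar> \<le> D"
            using D(1) cos_ge_minus_one[of "t * x"] cos_le_one[of "t * x"] by linarith
          then show ?thesis unfolding set_integral_cos by (simp only: norm_of_real if_True split: if_split) (use D in auto)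
        qed
        done
      also have "(LINT r:{0<..}|lborel. (\<alpha> / r powr (\<alpha> + 1)) *\<^sub>R G r) =
          (CLINT r:{0<..}|lborel. of_real (cos (t * r) - 1) / of_real (r powr (1 + 1)))"
        unfolding set_integral_scaleR_pareto unfolding 2
        by (simp only: of_real_1 mult_1_left) (intro set_integral_cong_simp, auto simp: G)
      finally show ?thesis by (simp add: scaleR_conv_of_real mult_ac)
    qed
    define J where "J = (CLINT r:{0<..}|lborel. of_real (cos (t * r) - 1) / of_real (r powr (1 + 1)))"
    have "(\<lambda>n. real n *\<^sub>R (LINT \<omega>|M. G (Z n \<omega>)) + real n *\<^sub>R (LINT \<omega>|M. G (- Z n \<omega>))) \<longlonglongrightarrow>
        of_real cp * J + of_real cm * J"
      unfolding J_def by (intro tendsto_add one Z Z' tails)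
    moreover have "real n *\<^sub>R (LINT \<omega>|M. G (Z n \<omega>)) + real n *\<^sub>R (LINT \<omega>|M. G (- Z n \<omega>)) =
        real n *\<^sub>R ((CLINT \<omega>|M. iexp (t * Z n \<omega>)) - 1)" for n
    proof -
      have Gb: "norm (G x) \<le> 2" for x
        using cos_ge_minus_one[of "t * x"] cos_le_one[of "t * x"] unfolding G
        by (auto simp del: of_real_diff)
      have [measurable]: "G \<in> borel_measurable borel" unfolding G[abs_def] by measurable
      have i: "integrable M (\<lambda>\<omega>. G (Z n \<omega>))" "integrable M (\<lambda>\<omega>. G (- Z n \<omega>))"
        by (auto intro!: integrable_const_bound[of _ 2] AE_I2 Gb)
      have "(CLINT x|distr M borel (\<lambda>\<omega>. - Z n \<omega>). iexp (t * x)) = (CLINT x|distr M borel (Z n). iexp (t * x))"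
        by (simp add: symm[OF 2])
      then have sym_iexp: "(CLINT \<omega>|M. iexp (t * - Z n \<omega>)) = (CLINT \<omega>|M. iexp (t * Z n \<omega>))"
        by (subst (asm) (1 2) integral_distr) auto
      have "(CLINT \<omega>|M. iexp (t * Z n \<omega>)) = ((CLINT \<omega>|M. iexp (t * Z n \<omega>)) + (CLINT \<omega>|M. iexp (t * - Z n \<omega>))) / 2"
        unfolding sym_iexp by simp
      also have "\<dots> = (CLINT \<omega>|M. iexp (t * Z n \<omega>) + iexp (t * - Z n \<omega>)) / 2"
        using iexp_int[of t n] iexp_int[of "- t" n] by simp
      also have "\<dots> = (CLINT \<omega>|M. of_real (cos (t * Z n \<omega>)))"
      proof -
        have "iexp x + iexp (- x) = 2 * complex_of_real (cos x)" for x
          by (simp add: cos_of_real[symmetric] cos_exp_eq del: cos_of_real)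
        from this[of "t * Z n \<omega>" for \<omega>] show ?thesis by simp
      qed
      finally have E: "(CLINT \<omega>|M. iexp (t * Z n \<omega>)) = (CLINT \<omega>|M. of_real (cos (t * Z n \<omega>)))" .
      have "(LINT \<omega>|M. G (Z n \<omega>)) + (LINT \<omega>|M. G (- Z n \<omega>)) = (CLINT \<omega>|M. of_real (cos (t * Z n \<omega>)) - 1)"
        by (subst Bochner_Integration.integral_add[OF i, symmetric])
           (auto intro!: Bochner_Integration.integral_cong simp: G not_less)
      also have "\<dots> = (CLINT \<omega>|M. of_real (cos (t * Z n \<omega>))) - 1"
      proof -
        have "integrable M (\<lambda>\<omega>. complex_of_real (cos (t * Z n \<omega>)))"
          by (auto intro!: integrable_const_bound[of _ 1])
        then show ?thesis by (simp add: prob_space)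
      qed
      finally show ?thesis unfolding E by (simp add: scaleR_add_right[symmetric])
    qed
    moreover have "of_real cp * J + of_real cm * J =
      of_real (cp * \<alpha>) * levy_exponent \<alpha> t + of_real (cm * \<alpha>) * levy_exponent \<alpha> (- t)"
    proof -
      have "levy_exponent 1 t + levy_exponent 1 (- t) =
        (CLINT r:{0<..}|lborel. stable_kernel 1 t 1 r / of_real (r powr (1 + 1)) + stable_kernel 1 (- t) 1 r / of_real (r powr (1 + 1)))"
        unfolding levy_exponent_def
        by (rule set_integral_add(2)[symmetric] set_integrable_stable_kernel_1)+
      also have "\<dots> = (CLINT r:{0<..}|lborel. 2 * (of_real (cos (t * r) - 1) / of_real (r powr (1 + 1))))"
      proof (rule set_integral_cong_simp)
        fix r :: real
        have "iexp x + iexp (- x) = 2 * complex_of_real (cos x)" for x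
          by (simp add: cos_of_real[symmetric] cos_exp_eq del: cos_of_real)
        from this[of "t * r"] have "stable_kernel 1 t 1 r + stable_kernel 1 (- t) 1 r = 2 * of_real (cos (t * r) - 1)"
          by (simp add: stable_kernel_def algebra_simps)
        then show "stable_kernel 1 t 1 r / of_real (r powr (1 + 1)) + stable_kernel 1 (- t) 1 r / of_real (r powr (1 + 1)) =
            2 * (of_real (cos (t * r) - 1) / of_real (r powr (1 + 1)))"
          by (simp only: add_divide_distrib[symmetric] times_divide_eq_right)
      qed
      also have "\<dots> = 2 * J" unfolding J_def by (rule set_integral_mult_right)
      finally show ?thesis using cp_cm[OF 2] unfolding 2 by (simp add: distrib_left[symmetric])
    qed
    ultimately show ?thesis by simp
  next
    case 3
    define G where "G = (\<lambda>u x. CLINT s:{0<..<x}|lborel. \<i> * of_real u * (iexp (u * s) - 1))"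
    have G: "G u x = (if 0 < x then iexp (u * x) - 1 - \<i> * of_real (u * x) else 0)" for u x
      unfolding G_def by (rule set_integral_iexp_compensated)
    define \<delta> where "\<delta> = min ((2 - \<alpha>) / 2) ((\<alpha> - 1) / 2)"
    have \<delta>: "0 < \<delta>" "\<delta> < \<alpha>" "\<alpha> + \<delta> < 2" "1 < \<alpha> - \<delta>" using 3 \<alpha> by (auto simp: \<delta>_def min_def field_simps)
    have int: "set_integrable lborel {0<..} (\<lambda>r. potter_envelope \<alpha> \<delta> r * norm (\<i> * of_real u * (iexp (u * r) - 1)))"
      if u: "\<bar>u\<bar> = \<bar>t\<bar>" for u
    proof (rule set_integrable_envelope[where p = 1 and q = 0 and D = "2 * D"])
      fix r :: real assume "0 < r"
      then have "\<bar>u\<bar> * norm (iexp (u * r) - 1) \<le> \<bar>t\<bar> * (\<bar>t\<bar> * r)"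
        using norm_iexp_minus_1[of "u * r"] u by (intro mult_mono) (auto simp: abs_mult)
      also have "\<dots> = t\<^sup>2 * r" by (simp add: power2_eq_square)
      also have "\<dots> \<le> (2 * D) * r" using D \<open>0 < r\<close> by (intro mult_right_mono) auto
      finally show "\<bar>norm (\<i> * of_real u * (iexp (u * r) - 1))\<bar> \<le> 2 * D * r powr 1"
        using \<open>0 < r\<close> by (simp add: norm_mult)
    next
      fix r :: real assume "1 < r"
      have "\<bar>u\<bar> * norm (iexp (u * r) - 1) \<le> D * 2"
        using norm_iexp_minus_1'[of "u * r"] u D by (intro mult_mono) auto
      then show "\<bar>norm (\<i> * of_real u * (iexp (u * r) - 1))\<bar> \<le> 2 * D * r powr 0"
        using \<open>1 < r\<close> by (simp add: norm_mult)
    qed (use \<delta> in auto)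
    have mg: "(\<lambda>s. \<i> * of_real u * (iexp (u * s) - 1)) \<in> borel_measurable borel" for u by measurable
    have one: "(\<lambda>n. real n *\<^sub>R (LINT \<omega>|M. G u (Y n \<omega>))) \<longlonglongrightarrow> of_real (c * \<alpha>) * levy_exponent \<alpha> u"
      if Y [measurable]: "\<And>n. Y n \<in> borel_measurable M" and "pareto_tails M Y \<alpha> c" and u: "\<bar>u\<bar> = \<bar>t\<bar>" for u Y c
    proof -
      have "(\<lambda>n. real n *\<^sub>R (LINT \<omega>|M. G u (Y n \<omega>))) \<longlonglongrightarrow>
          c *\<^sub>R (LINT r:{0<..}|lborel. (\<alpha> / r powr (\<alpha> + 1)) *\<^sub>R G u r)"
        unfolding G_def
        by (rule pareto_tails_integral(2)[OF \<open>prob_space M\<close> Y mg \<alpha>(1) that(2) \<delta>(1,2) int[OF u]])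
      also have "(LINT r:{0<..}|lborel. (\<alpha> / r powr (\<alpha> + 1)) *\<^sub>R G u r) = of_real \<alpha> * levy_exponent \<alpha> u"
        unfolding set_integral_scaleR_pareto levy_exponent_def
        by (intro arg_cong[where f = "\<lambda>x. of_real \<alpha> * x"] set_integral_cong_simp)
           (use 3 in \<open>auto simp: G stable_kernel_def\<close>)
      finally show ?thesis by (simp add: scaleR_conv_of_real mult_ac)
    qed
    have "(\<lambda>n. real n *\<^sub>R (LINT \<omega>|M. G t (Z n \<omega>)) + real n *\<^sub>R (LINT \<omega>|M. G (- t) (- Z n \<omega>))) \<longlonglongrightarrow>
        of_real (cp * \<alpha>) * levy_exponent \<alpha> t + of_real (cm * \<alpha>) * levy_exponent \<alpha> (- t)"
      by (intro tendsto_add one Z Z' tails) auto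
    moreover have "\<forall>\<^sub>F n in sequentially. real n *\<^sub>R (LINT \<omega>|M. G t (Z n \<omega>)) + real n *\<^sub>R (LINT \<omega>|M. G (- t) (- Z n \<omega>)) =
        real n *\<^sub>R ((CLINT \<omega>|M. iexp (t * Z n \<omega>)) - 1)"
      using pareto_tails_integral(1)[OF \<open>prob_space M\<close> Z mg \<alpha>(1) tails(1) \<delta>(1,2) int[OF refl]]
        pareto_tails_integral(1)[OF \<open>prob_space M\<close> Z' mg \<alpha>(1) tails(2) \<delta>(1,2) int[OF abs_minus_cancel]]
    proof eventually_elim
      case (elim n)
      then have i: "integrable M (\<lambda>\<omega>. G t (Z n \<omega>))" "integrable M (\<lambda>\<omega>. G (- t) (- Z n \<omega>))"
        unfolding G_def by simp_all
      have iZ: "integrable M (\<lambda>\<omega>. \<i> * complex_of_real (t * Z n \<omega>))"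
        by (intro integrable_mult_right integrable_of_real centred(1) 3)
      have "(LINT \<omega>|M. G t (Z n \<omega>)) + (LINT \<omega>|M. G (- t) (- Z n \<omega>)) = (LINT \<omega>|M. iexp (t * Z n \<omega>) - 1 - \<i> * of_real (t * Z n \<omega>))"
        by (subst Bochner_Integration.integral_add[OF i, symmetric])
           (auto intro!: Bochner_Integration.integral_cong simp: G)
      also have "\<dots> = (LINT \<omega>|M. iexp (t * Z n \<omega>) - 1) - (LINT \<omega>|M. \<i> * of_real (t * Z n \<omega>))"
        using iexp_int[of t n] by (intro Bochner_Integration.integral_diff iZ) auto
      also have "(LINT \<omega>|M. \<i> * complex_of_real (t * Z n \<omega>)) = \<i> * of_real (t * (LINT \<omega>|M. Z n \<omega>))"
        using centred(1)[OF 3, of n] by simp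
      also have "(LINT \<omega>|M. iexp (t * Z n \<omega>) - 1) = (CLINT \<omega>|M. iexp (t * Z n \<omega>)) - 1"
        using iexp_int[of t n] by (simp add: prob_space)
      finally show ?case using centred(2)[OF 3, of n] by (simp add: scaleR_add_right[symmetric])
    qed
    ultimately show ?thesis by (rule Lim_transform_eventually)
  qed
qed

section \<open>Covariances of stationary and associated sequences\<close>

text \<open>
  Truncated variables are bounded. Products of bounded variables are integrable, which makes
  covariance bilinear on them.
\<close>

definition bounded_rv :: "'a measure \<Rightarrow> ('a \<Rightarrow> real) \<Rightarrow> bool" where
  "bounded_rv M U \<longleftrightarrow> U \<in> borel_measurable M \<and> (\<exists>C. \<forall>\<omega>\<in>space M. \<bar>U \<omega>\<bar> \<le> C)"

lemma bounded_rvI: "U \<in> borel_measurable M \<Longrightarrow> (\<And>\<omega>. \<omega> \<in> space M \<Longrightarrow> \<bar>U \<omega>\<bar> \<le> C) \<Longrightarrow> bounded_rv M U"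
  by (auto simp: bounded_rv_def)

lemma bounded_rv_add: 
  assumes "bounded_rv M U" "bounded_rv M V" shows "bounded_rv M (\<lambda>\<omega>. U \<omega> + V \<omega>)"
proof -
  obtain C D where "\<And>\<omega>. \<omega>\<in>space M \<Longrightarrow> \<bar>U \<omega>\<bar> \<le> C" "\<And>\<omega>. \<omega>\<in>space M \<Longrightarrow> \<bar>V \<omega>\<bar> \<le> D"
    using assms by (auto simp: bounded_rv_def)
  then show ?thesis using assms
    by (intro bounded_rvI[where C = "C + D"]) (auto simp: bounded_rv_def intro: order_trans[OF abs_triangle_ineq] add_mono)
qed

lemma bounded_rv_mult: 
  assumes "bounded_rv M U" "bounded_rv M V" shows "bounded_rv M (\<lambda>\<omega>. U \<omega> * V \<omega>)"
proof -
  obtain C D where CD: "\<And>\<omega>. \<omega>\<in>space M \<Longrightarrow> \<bar>U \<omega>\<bar> \<le> C" "\<And>\<omega>. \<omega>\<in>space M \<Longrightarrow> \<bar>V \<omega>\<bar> \<le> D"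
    using assms by (auto simp: bounded_rv_def)
  show ?thesis
  proof (rule bounded_rvI)
    fix \<omega> assume w: "\<omega> \<in> space M"
    have "0 \<le> C" using CD(1)[OF w] by linarith
    then show "\<bar>U \<omega> * V \<omega>\<bar> \<le> C * D" unfolding abs_mult using CD[OF w] by (intro mult_mono) auto
  qed (use assms in \<open>auto simp: bounded_rv_def\<close>)
qed

lemma bounded_rv_const: "bounded_rv M (\<lambda>_. c)"
  by (rule bounded_rvI) auto

lemma bounded_rv_cmult: "bounded_rv M U \<Longrightarrow> bounded_rv M (\<lambda>\<omega>. c * U \<omega>)"
  by (intro bounded_rv_mult bounded_rv_const)

lemma bounded_rv_diff: "bounded_rv M U \<Longrightarrow> bounded_rv M V \<Longrightarrow> bounded_rv M (\<lambda>\<omega>. U \<omega> - V \<omega>)"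
  using bounded_rv_add[OF _ bounded_rv_cmult[of M V "-1"]] by simp

lemma bounded_rv_sum: "(\<And>i. i \<in> I \<Longrightarrow> bounded_rv M (U i)) \<Longrightarrow> bounded_rv M (\<lambda>\<omega>. \<Sum>i\<in>I. U i \<omega>)"
  by (induction I rule: infinite_finite_induct) (auto intro: bounded_rv_const bounded_rv_add)

context prob_space
begin

lemma bounded_rv_integrable: "bounded_rv M U \<Longrightarrow> integrable M U"
  by (auto simp: bounded_rv_def intro!: integrable_const_bound AE_I2)

lemma covariance_eq:
  assumes "integrable M U" "integrable M V" "integrable M (\<lambda>\<omega>. U \<omega> * V \<omega>)"
  shows "covariance M U V = expectation (\<lambda>\<omega>. U \<omega> * V \<omega>) - expectation U * expectation V"
proof -
  have "covariance M U V = expectation (\<lambda>\<omega>. U \<omega> * V \<omega> - expectation U * V \<omega> - U \<omega> * expectation V + expectation U * expectation V)"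
    unfolding covariance_def by (intro Bochner_Integration.integral_cong) (auto simp: algebra_simps)
  also have "\<dots> = expectation (\<lambda>\<omega>. U \<omega> * V \<omega>) - expectation U * expectation V"
    using assms by (simp add: prob_space)
  finally show ?thesis .
qed

lemma covariance_bounded:
  "bounded_rv M U \<Longrightarrow> bounded_rv M V \<Longrightarrow>
    covariance M U V = expectation (\<lambda>\<omega>. U \<omega> * V \<omega>) - expectation U * expectation V"
  by (intro covariance_eq bounded_rv_integrable bounded_rv_mult)

lemma covariance_commute: "covariance M U V = covariance M V U"
  by (simp add: covariance_def mult.commute)

lemma covariance_add_left:
  assumes "bounded_rv M U" "bounded_rv M V" "bounded_rv M W"
  shows "covariance M (\<lambda>\<omega>. U \<omega> + V \<omega>) W = covariance M U W + covariance M V W"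
  using assms bounded_rv_integrable[OF assms(1)] bounded_rv_integrable[OF assms(2)]
    bounded_rv_integrable[OF bounded_rv_mult[OF assms(1,3)]] bounded_rv_integrable[OF bounded_rv_mult[OF assms(2,3)]]
  by (simp add: covariance_bounded bounded_rv_add algebra_simps)

lemma covariance_cmult_left:
  assumes "bounded_rv M U" "bounded_rv M V"
  shows "covariance M (\<lambda>\<omega>. c * U \<omega>) V = c * covariance M U V"
  using assms by (simp add: covariance_bounded bounded_rv_cmult mult.assoc right_diff_distrib)

lemma covariance_diff_left:
  assumes "bounded_rv M U" "bounded_rv M V" "bounded_rv M W"
  shows "covariance M (\<lambda>\<omega>. U \<omega> - V \<omega>) W = covariance M U W - covariance M V W"
  using covariance_add_left[OF assms(1) bounded_rv_cmult[OF assms(2), of "-1"] assms(3)]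
    covariance_cmult_left[OF assms(2,3), of "-1"] by simp

lemma covariance_sum_left:
  assumes "\<And>i. i \<in> I \<Longrightarrow> bounded_rv M (U i)" "bounded_rv M V"
  shows "covariance M (\<lambda>\<omega>. \<Sum>i\<in>I. U i \<omega>) V = (\<Sum>i\<in>I. covariance M (U i) V)"
  using assms
proof (induction I rule: infinite_finite_induct)
  case (insert i I)
  then show ?case
    by (simp add: covariance_add_left bounded_rv_sum)
qed (auto simp: covariance_def)

lemma covariance_add_right:
  assumes "bounded_rv M U" "bounded_rv M V" "bounded_rv M W"
  shows "covariance M W (\<lambda>\<omega>. U \<omega> + V \<omega>) = covariance M W U + covariance M W V"
  using covariance_add_left[OF assms] by (simp add: covariance_commute[of W])

lemma covariance_cmult_right:
  assumes "bounded_rv M U" "bounded_rv M V"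
  shows "covariance M V (\<lambda>\<omega>. c * U \<omega>) = c * covariance M V U"
  using covariance_cmult_left[OF assms] by (simp add: covariance_commute[of V])

lemma covariance_diff_right:
  assumes "bounded_rv M U" "bounded_rv M V" "bounded_rv M W"
  shows "covariance M W (\<lambda>\<omega>. U \<omega> - V \<omega>) = covariance M W U - covariance M W V"
  using covariance_diff_left[OF assms] by (simp add: covariance_commute[of W])

lemma covariance_sum_right:
  assumes "\<And>i. i \<in> I \<Longrightarrow> bounded_rv M (U i)" "bounded_rv M V"
  shows "covariance M V (\<lambda>\<omega>. \<Sum>i\<in>I. U i \<omega>) = (\<Sum>i\<in>I. covariance M V (U i))"
  using covariance_sum_left[OF assms] by (simp add: covariance_commute[of V])

end

lemma lipschitz_mono_add:
  fixes \<phi> :: "real \<Rightarrow> real"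
  assumes "\<And>a b. \<bar>\<phi> a - \<phi> b\<bar> \<le> \<tau> * \<bar>a - b\<bar>"
  shows "mono (\<lambda>u. \<tau> * u + \<phi> u)" "mono (\<lambda>u. \<tau> * u - \<phi> u)"
proof -
  have "\<tau> * x + \<phi> x \<le> \<tau> * y + \<phi> y \<and> \<tau> * x - \<phi> x \<le> \<tau> * y - \<phi> y" if "x \<le> y" for x y
  proof -
    have "\<bar>\<phi> x - \<phi> y\<bar> \<le> \<tau> * (y - x)" using assms[of x y] abs_of_nonpos[of "x - y"] that by simp
    then show ?thesis unfolding right_diff_distrib by linarith
  qed
  then show "mono (\<lambda>u. \<tau> * u + \<phi> u)" "mono (\<lambda>u. \<tau> * u - \<phi> u)" by (auto intro!: monoI)
qed

locale stationary_sequence = prob_space M for M :: "'a measure" +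
  fixes X :: "nat \<Rightarrow> 'a \<Rightarrow> real"
  assumes X_meas: "1 \<le> j \<Longrightarrow> X j \<in> borel_measurable M"
    and stationary: "strictly_stationary M X"
begin

lemma joint_measurable:
  "I \<subseteq> {1..} \<Longrightarrow> (\<lambda>\<omega>. \<lambda>i\<in>I. X i \<omega>) \<in> measurable M (\<Pi>\<^sub>M i\<in>I. borel)"
  using X_meas by (intro measurable_restrict) auto

lemma expectation_shift:
  fixes g :: "(nat \<Rightarrow> real) \<Rightarrow> 'b::{banach, second_countable_topology}"
  assumes g: "g \<in> borel_measurable (\<Pi>\<^sub>M i\<in>{1..N}. borel)"
  shows "(LINT \<omega>|M. g (\<lambda>i\<in>{1..N}. X (i + k) \<omega>)) = (LINT \<omega>|M. g (\<lambda>i\<in>{1..N}. X i \<omega>))"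
proof -
  have "(LINT x|joint_law M (\<lambda>i. X (i + k)) {1..N}. g x) = (LINT x|joint_law M X {1..N}. g x)"
    using stationary unfolding strictly_stationary_def by simp
  then show ?thesis
    unfolding joint_law_def
    by (subst (asm) (1 2) integral_distr) (use X_meas g in \<open>auto intro!: measurable_restrict\<close>)
qed

lemma expectation_shift1:
  fixes g :: "real \<Rightarrow> 'b::{banach, second_countable_topology}"
  assumes [measurable]: "g \<in> borel_measurable borel" and j: "1 \<le> j"
  shows "(LINT \<omega>|M. g (X j \<omega>)) = (LINT \<omega>|M. g (X 1 \<omega>))"
  using expectation_shift[of "\<lambda>x. g (x 1)" 1 "j - 1"] j by simp

lemma expectation_shift2:
  fixes g :: "real \<Rightarrow> real \<Rightarrow> 'b::{banach, second_countable_topology}"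
  assumes [measurable]: "(\<lambda>(x, y). g x y) \<in> borel_measurable (borel \<Otimes>\<^sub>M borel)" and j: "1 \<le> j"
  shows "(LINT \<omega>|M. g (X j \<omega>) (X (j + d) \<omega>)) = (LINT \<omega>|M. g (X 1 \<omega>) (X (1 + d) \<omega>))"
proof -
  have "(\<lambda>x. (x 1, x (1 + d))) \<in> measurable (\<Pi>\<^sub>M i\<in>{1..1 + d}. borel) (borel \<Otimes>\<^sub>M (borel :: real measure))"
    by (intro measurable_Pair measurable_component_singleton) auto
  from measurable_compose[OF this assms(1)]
  have "(\<lambda>x. g (x 1) (x (1 + d))) \<in> borel_measurable (\<Pi>\<^sub>M i\<in>{1..1 + d}. borel)" by simp
  from expectation_shift[OF this, of "j - 1"] show ?thesis using j by (simp add: add.commute)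
qed

lemma covariance_shift:
  assumes [measurable]: "u \<in> borel_measurable borel" "v \<in> borel_measurable borel"
    and bd: "\<And>x. \<bar>u x\<bar> \<le> C" "\<And>x. \<bar>v x\<bar> \<le> C" and j: "1 \<le> j"
  shows "covariance M (\<lambda>\<omega>. u (X j \<omega>)) (\<lambda>\<omega>. v (X (j + d) \<omega>)) =
     covariance M (\<lambda>\<omega>. u (X 1 \<omega>)) (\<lambda>\<omega>. v (X (1 + d) \<omega>))"
proof -
  have m: "(\<lambda>\<omega>. u (X j \<omega>)) \<in> borel_measurable M" "(\<lambda>\<omega>. v (X j \<omega>)) \<in> borel_measurable M" if "1 \<le> j" for j
    using X_meas[OF that] by measurable
  have b: "bounded_rv M (\<lambda>\<omega>. u (X j \<omega>))" "bounded_rv M (\<lambda>\<omega>. v (X j \<omega>))" if "1 \<le> j" for j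
    by (rule bounded_rvI[OF _ bd(1)] bounded_rvI[OF _ bd(2)], rule m, rule that)+
  have "(\<lambda>(x, y). u x * v y) \<in> borel_measurable (borel \<Otimes>\<^sub>M borel)" by measurable
  note e = expectation_shift2[OF this j, of d]
  show ?thesis
    using j by (simp add: covariance_bounded b e expectation_shift1[of u j] expectation_shift1[of v "j + d"]
        expectation_shift1[of v "Suc d"])
qed

lemma sum_shift:
  fixes g :: "real \<Rightarrow> 'b::{banach, second_countable_topology}"
  assumes [measurable]: "g \<in> borel_measurable borel" "h \<in> borel_measurable borel"
  shows "(LINT \<omega>|M. g (\<Sum>i\<in>{k+1..k+N}. h (X i \<omega>))) = (LINT \<omega>|M. g (\<Sum>i\<in>{1..N}. h (X i \<omega>)))"
proof -
  have "(\<lambda>x. g (\<Sum>i\<in>{1..N}. h (x i))) \<in> borel_measurable (\<Pi>\<^sub>M i\<in>{1..N}. borel)"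
  proof -
    have "(\<lambda>x. \<Sum>i\<in>{1..N}. h (x i)) \<in> borel_measurable (\<Pi>\<^sub>M i\<in>{1..N}. borel)"
      by (intro borel_measurable_sum) measurable
    then show ?thesis by measurable
  qed
  from expectation_shift[OF this, of k]
  have "(LINT \<omega>|M. g (\<Sum>i\<in>{1..N}. h (X (i + k) \<omega>))) = (LINT \<omega>|M. g (\<Sum>i\<in>{1..N}. h (X i \<omega>)))"
    by simp
  moreover have "(\<Sum>i\<in>{k+1..k+N}. h (X i \<omega>)) = (\<Sum>i\<in>{1..N}. h (X (i + k) \<omega>))" for \<omega>
    using sum.shift_bounds_cl_nat_ivl[of "\<lambda>i. h (X i \<omega>)" 1 k N] by (simp add: add.commute)
  ultimately show ?thesis by simp
qed

end

locale associated_sequence = stationary_sequence +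
  assumes association: "associated_family M X {1..}"
begin

text \<open>
  Association in the form used below: the two functions of the random vector are nondecreasing
  functions of two sums of nondecreasing functions of the coordinates.
\<close>

lemma covariance_nondecreasing_sums:
  fixes h h' p q :: "real \<Rightarrow> real"
  assumes I: "finite I" "I \<subseteq> {1..}" and J: "finite J" "J \<subseteq> {1..}"
    and h: "mono h" "mono h'" and pq: "mono p" "mono q"
    and bd: "bounded_rv M (\<lambda>\<omega>. p (\<Sum>i\<in>I. h (X i \<omega>)))" "bounded_rv M (\<lambda>\<omega>. q (\<Sum>i\<in>J. h' (X i \<omega>)))"
  shows "0 \<le> covariance M (\<lambda>\<omega>. p (\<Sum>i\<in>I. h (X i \<omega>))) (\<lambda>\<omega>. q (\<Sum>i\<in>J. h' (X i \<omega>)))"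
proof -
  define K where "K = I \<union> J"
  have K: "finite K" "K \<subseteq> {1..}" "I \<subseteq> K" "J \<subseteq> K" using I J by (auto simp: K_def)
  note [measurable] = borel_measurable_mono[OF h(1)] borel_measurable_mono[OF h(2)]
    borel_measurable_mono[OF pq(1)] borel_measurable_mono[OF pq(2)]
  define f where "f = (\<lambda>x :: nat \<Rightarrow> real. p (\<Sum>i\<in>I. h (x i)))"
  define g where "g = (\<lambda>x :: nat \<Rightarrow> real. q (\<Sum>i\<in>J. h' (x i)))"
  have comp: "(\<lambda>x. x i) \<in> borel_measurable (\<Pi>\<^sub>M i\<in>K. borel)" if "i \<in> K" for i
    using that by measurable
  have sm: "(\<lambda>x. \<Sum>i\<in>I. h (x i)) \<in> borel_measurable (\<Pi>\<^sub>M i\<in>K. borel)"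
    "(\<lambda>x. \<Sum>i\<in>J. h' (x i)) \<in> borel_measurable (\<Pi>\<^sub>M i\<in>K. borel)"
    using K by (auto intro!: borel_measurable_sum measurable_compose[OF comp])
  have fg [measurable]: "f \<in> borel_measurable (\<Pi>\<^sub>M i\<in>K. borel)" "g \<in> borel_measurable (\<Pi>\<^sub>M i\<in>K. borel)"
    unfolding f_def g_def using sm by measurable
  have V [measurable]: "(\<lambda>\<omega>. \<lambda>i\<in>K. X i \<omega>) \<in> measurable M (\<Pi>\<^sub>M i\<in>K. borel)"
    by (rule joint_measurable[OF K(2)])
  have fV: "f (\<lambda>i\<in>K. X i \<omega>) = p (\<Sum>i\<in>I. h (X i \<omega>))" and gV: "g (\<lambda>i\<in>K. X i \<omega>) = q (\<Sum>i\<in>J. h' (X i \<omega>))" for \<omega>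
    using K by (auto simp: f_def g_def subset_iff cong: sum.cong)
  have nd: "coordinatewise_nondecreasing K (\<lambda>x. p' (\<Sum>i\<in>I'. h'' (x i)))" if m: "mono p'" "mono h''"
    for p' h'' :: "real \<Rightarrow> real" and I'
    unfolding coordinatewise_nondecreasing_def
  proof (intro ballI monoI)
    fix x :: "nat \<Rightarrow> real" and i s t assume st: "(s::real) \<le> t"
    have "(\<Sum>j\<in>I'. h'' ((x(i := s)) j)) \<le> (\<Sum>j\<in>I'. h'' ((x(i := t)) j))"
      by (intro sum_mono monoD[OF m(2)]) (use st in simp)
    then show "p' (\<Sum>j\<in>I'. h'' ((x(i := s)) j)) \<le> p' (\<Sum>j\<in>I'. h'' ((x(i := t)) j))"
      by (rule monoD[OF m(1)])
  qed
  have nd: "coordinatewise_nondecreasing K f" "coordinatewise_nondecreasing K g"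
    unfolding f_def g_def by (intro nd pq h)+
  have ex: "covariance_exists (joint_law M X K) f g"
    unfolding covariance_exists_def joint_law_def
    using bounded_rv_integrable[OF bd(1)] bounded_rv_integrable[OF bd(2)] bounded_rv_integrable[OF bounded_rv_mult[OF bd]]
    by (auto simp: integrable_distr_eq fV gV)
  have "0 \<le> covariance (joint_law M X K) f g"
    using association nd ex K unfolding associated_family_def associated_def by blast
  also have "\<dots> = covariance M (\<lambda>\<omega>. p (\<Sum>i\<in>I. h (X i \<omega>))) (\<lambda>\<omega>. q (\<Sum>i\<in>J. h' (X i \<omega>)))"
    unfolding covariance_def joint_law_def by (simp add: integral_distr fV gV)
  finally show ?thesis .
qed

lemma covariance_nondecreasing:
  fixes u v :: "real \<Rightarrow> real"
  assumes "1 \<le> i" "1 \<le> j" "mono u" "mono v" "\<And>x. \<bar>u x\<bar> \<le> C" "\<And>x. \<bar>v x\<bar> \<le> C"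
  shows "0 \<le> covariance M (\<lambda>\<omega>. u (X i \<omega>)) (\<lambda>\<omega>. v (X j \<omega>))"
proof -
  note [measurable] = borel_measurable_mono[OF assms(3)] borel_measurable_mono[OF assms(4)] X_meas[OF assms(1)] X_meas[OF assms(2)]
  have "bounded_rv M (\<lambda>\<omega>. u (X i \<omega>))" "bounded_rv M (\<lambda>\<omega>. v (X j \<omega>))"
    by (rule bounded_rvI[of _ _ C]; use assms in measurable)+
  then show ?thesis
    using covariance_nondecreasing_sums[of "{i}" "{j}" u v "\<lambda>x. x" "\<lambda>x. x"] assms by (simp add: mono_def)
qed

text \<open>
  If \<open>\<phi>\<close> is \<open>\<tau>\<close>-Lipschitz then \<open>\<tau> u + \<phi>(u)\<close> and \<open>\<tau> u - \<phi>(u)\<close> are nondecreasing.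
  Expanding the four nonnegative covariances of such combinations and adding them in pairs
  leaves \<open>\<tau>\<^sup>2 Cov(A, B) \<plusminus> Cov(\<phi>(A), \<psi>(B)) \<ge> 0\<close>.
\<close>

lemma covariance_lipschitz_sums:
  fixes \<phi> \<psi> h :: "real \<Rightarrow> real"
  assumes I: "finite I" "I \<subseteq> {1..}" and J: "finite J" "J \<subseteq> {1..}"
    and h: "mono h" "\<And>x. \<bar>h x\<bar> \<le> C" and \<tau>: "0 \<le> \<tau>"
    and lip: "\<And>a b. \<bar>\<phi> a - \<phi> b\<bar> \<le> \<tau> * \<bar>a - b\<bar>" "\<And>a b. \<bar>\<psi> a - \<psi> b\<bar> \<le> \<tau> * \<bar>a - b\<bar>"
    and bd: "\<And>x. \<bar>\<phi> x\<bar> \<le> D" "\<And>x. \<bar>\<psi> x\<bar> \<le> D"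
    and [measurable]: "\<phi> \<in> borel_measurable borel" "\<psi> \<in> borel_measurable borel"
  shows "\<bar>covariance M (\<lambda>\<omega>. \<phi> (\<Sum>i\<in>I. h (X i \<omega>))) (\<lambda>\<omega>. \<psi> (\<Sum>i\<in>J. h (X i \<omega>)))\<bar> \<le>
    \<tau>\<^sup>2 * covariance M (\<lambda>\<omega>. \<Sum>i\<in>I. h (X i \<omega>)) (\<lambda>\<omega>. \<Sum>i\<in>J. h (X i \<omega>))"
proof -
  note [measurable] = borel_measurable_mono[OF h(1)]
  define A where "A = (\<lambda>\<omega>. \<Sum>i\<in>I. h (X i \<omega>))"
  define B where "B = (\<lambda>\<omega>. \<Sum>i\<in>J. h (X i \<omega>))"
  have hX: "bounded_rv M (\<lambda>\<omega>. h (X i \<omega>))" if "1 \<le> i" for i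
    by (rule bounded_rvI[of _ _ C]) (use X_meas[OF that] h in \<open>auto intro: measurable_compose\<close>)
  have bA: "bounded_rv M A" "bounded_rv M B"
    unfolding A_def B_def using I J by (auto intro!: bounded_rv_sum hX)
  have mA [measurable]: "A \<in> borel_measurable M" "B \<in> borel_measurable M"
    using bA by (auto simp: bounded_rv_def)
  have b\<phi>: "bounded_rv M (\<lambda>\<omega>. \<phi> (A \<omega>))" "bounded_rv M (\<lambda>\<omega>. \<psi> (B \<omega>))"
    by (rule bounded_rvI[of _ _ D]; use bd in measurable)+
  have b\<tau>: "bounded_rv M (\<lambda>\<omega>. \<tau> * A \<omega>)" "bounded_rv M (\<lambda>\<omega>. \<tau> * B \<omega>)"
    by (intro bounded_rv_cmult bA)+
  note m1 = lipschitz_mono_add[OF lip(1)] and m2 = lipschitz_mono_add[OF lip(2)]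
  have pp: "0 \<le> covariance M (\<lambda>\<omega>. \<tau> * A \<omega> + \<phi> (A \<omega>)) (\<lambda>\<omega>. \<tau> * B \<omega> + \<psi> (B \<omega>))"
    unfolding A_def B_def
    by (rule covariance_nondecreasing_sums[OF I J h(1) h(1) m1(1) m2(1)])
       (use bounded_rv_add[OF b\<tau>(1) b\<phi>(1)] bounded_rv_add[OF b\<tau>(2) b\<phi>(2)] in \<open>simp_all add: A_def B_def\<close>)
  have mm: "0 \<le> covariance M (\<lambda>\<omega>. \<tau> * A \<omega> - \<phi> (A \<omega>)) (\<lambda>\<omega>. \<tau> * B \<omega> - \<psi> (B \<omega>))"
    unfolding A_def B_def
    by (rule covariance_nondecreasing_sums[OF I J h(1) h(1) m1(2) m2(2)])
       (use bounded_rv_diff[OF b\<tau>(1) b\<phi>(1)] bounded_rv_diff[OF b\<tau>(2) b\<phi>(2)] in \<open>simp_all add: A_def B_def\<close>)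
  have pm: "0 \<le> covariance M (\<lambda>\<omega>. \<tau> * A \<omega> + \<phi> (A \<omega>)) (\<lambda>\<omega>. \<tau> * B \<omega> - \<psi> (B \<omega>))"
    unfolding A_def B_def
    by (rule covariance_nondecreasing_sums[OF I J h(1) h(1) m1(1) m2(2)])
       (use bounded_rv_add[OF b\<tau>(1) b\<phi>(1)] bounded_rv_diff[OF b\<tau>(2) b\<phi>(2)] in \<open>simp_all add: A_def B_def\<close>)
  have mp: "0 \<le> covariance M (\<lambda>\<omega>. \<tau> * A \<omega> - \<phi> (A \<omega>)) (\<lambda>\<omega>. \<tau> * B \<omega> + \<psi> (B \<omega>))"
    unfolding A_def B_def
    by (rule covariance_nondecreasing_sums[OF I J h(1) h(1) m1(2) m2(1)])
       (use bounded_rv_diff[OF b\<tau>(1) b\<phi>(1)] bounded_rv_add[OF b\<tau>(2) b\<phi>(2)] in \<open>simp_all add: A_def B_def\<close>)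
  note ex = covariance_add_left covariance_add_right covariance_diff_left covariance_diff_right
    covariance_cmult_left covariance_cmult_right bounded_rv_add bounded_rv_diff bA b\<phi> b\<tau>
  have "\<bar>covariance M (\<lambda>\<omega>. \<phi> (A \<omega>)) (\<lambda>\<omega>. \<psi> (B \<omega>))\<bar> \<le> \<tau> * (\<tau> * covariance M A B)"
    using pp mm pm mp by (simp add: ex algebra_simps)
  then show ?thesis unfolding A_def B_def by (simp add: power2_eq_square mult_ac)
qed

text \<open>
  Newman's inequality, with the constant \<open>4\<close> from splitting both exponentials into sine and
  cosine.
\<close>

lemma newman_inequality:
  fixes h :: "real \<Rightarrow> real"
  assumes I: "finite I" "I \<subseteq> {1..}" and J: "finite J" "J \<subseteq> {1..}"
    and h: "mono h" "\<And>x. \<bar>h x\<bar> \<le> C"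
  defines "A \<equiv> \<lambda>\<omega>. \<Sum>i\<in>I. h (X i \<omega>)" and "B \<equiv> \<lambda>\<omega>. \<Sum>i\<in>J. h (X i \<omega>)"
  shows "norm ((CLINT \<omega>|M. iexp (t * (A \<omega> + B \<omega>))) - (CLINT \<omega>|M. iexp (t * A \<omega>)) * (CLINT \<omega>|M. iexp (t * B \<omega>)))
    \<le> 4 * t\<^sup>2 * covariance M A B"
proof -
  note [measurable] = borel_measurable_mono[OF h(1)]
  have hX: "bounded_rv M (\<lambda>\<omega>. h (X i \<omega>))" if "1 \<le> i" for i
    by (rule bounded_rvI[of _ _ C]) (use X_meas[OF that] h in \<open>auto intro: measurable_compose\<close>)
  have bA: "bounded_rv M A" "bounded_rv M B"
    unfolding A_def B_def using I J by (auto intro!: bounded_rv_sum hX)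
  have mA [measurable]: "A \<in> borel_measurable M" "B \<in> borel_measurable M"
    using bA by (auto simp: bounded_rv_def)
  define cA where "cA = (\<lambda>\<omega>. cos (t * A \<omega>))"
  define sA where "sA = (\<lambda>\<omega>. sin (t * A \<omega>))"
  define cB where "cB = (\<lambda>\<omega>. cos (t * B \<omega>))"
  define sB where "sB = (\<lambda>\<omega>. sin (t * B \<omega>))"
  have b: "bounded_rv M cA" "bounded_rv M sA" "bounded_rv M cB" "bounded_rv M sB"
    unfolding cA_def sA_def cB_def sB_def by (rule bounded_rvI[of _ _ 1]; simp)+
  have lip: "\<bar>cos (t * a) - cos (t * b)\<bar> \<le> \<bar>t\<bar> * \<bar>a - b\<bar>" "\<bar>sin (t * a) - sin (t * b)\<bar> \<le> \<bar>t\<bar> * \<bar>a - b\<bar>" for a b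
  proof -
    have "norm (iexp (t * a) - iexp (t * b)) = norm (iexp (t * b) * (iexp (t * a - t * b) - 1))"
      by (simp add: algebra_simps exp_diff)
    also have "\<dots> \<le> \<bar>t * a - t * b\<bar>"
      using iexp_approx1[of "t * a - t * b" 0] by (simp add: norm_mult)
    also have "\<dots> = \<bar>t\<bar> * \<bar>a - b\<bar>" by (simp add: abs_mult right_diff_distrib[symmetric])
    finally have *: "norm (iexp (t * a) - iexp (t * b)) \<le> \<bar>t\<bar> * \<bar>a - b\<bar>" .
    show "\<bar>cos (t * a) - cos (t * b)\<bar> \<le> \<bar>t\<bar> * \<bar>a - b\<bar>"
      using abs_Re_le_cmod[of "iexp (t * a) - iexp (t * b)"] * by (simp add: Re_exp)
    show "\<bar>sin (t * a) - sin (t * b)\<bar> \<le> \<bar>t\<bar> * \<bar>a - b\<bar>"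
      using abs_Im_le_cmod[of "iexp (t * a) - iexp (t * b)"] * by (simp add: Im_exp)
  qed
  note L = covariance_lipschitz_sums[OF I J h(1) h(2) abs_ge_zero[of t], where D = 1]
  have c1: "\<bar>covariance M cA cB\<bar> \<le> t\<^sup>2 * covariance M A B"
    unfolding cA_def cB_def A_def B_def power2_abs[of t, symmetric] by (rule L[OF lip(1) lip(1)]) auto
  have c2: "\<bar>covariance M sA sB\<bar> \<le> t\<^sup>2 * covariance M A B"
    unfolding sA_def sB_def A_def B_def power2_abs[of t, symmetric] by (rule L[OF lip(2) lip(2)]) auto
  have c3: "\<bar>covariance M cA sB\<bar> \<le> t\<^sup>2 * covariance M A B"
    unfolding cA_def sB_def A_def B_def power2_abs[of t, symmetric] by (rule L[OF lip(1) lip(2)]) auto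
  have c4: "\<bar>covariance M sA cB\<bar> \<le> t\<^sup>2 * covariance M A B"
    unfolding sA_def cB_def A_def B_def power2_abs[of t, symmetric] by (rule L[OF lip(2) lip(1)]) auto
  note i = bounded_rv_integrable[OF b(1)] bounded_rv_integrable[OF b(2)] bounded_rv_integrable[OF b(3)] bounded_rv_integrable[OF b(4)]
    bounded_rv_integrable[OF bounded_rv_mult[OF b(1,3)]] bounded_rv_integrable[OF bounded_rv_mult[OF b(2,4)]]
    bounded_rv_integrable[OF bounded_rv_mult[OF b(1,4)]] bounded_rv_integrable[OF bounded_rv_mult[OF b(2,3)]]
  have cplx: "(CLINT \<omega>|M. of_real (u \<omega>) + \<i> * of_real (v \<omega>)) = of_real (expectation u) + \<i> * of_real (expectation v)"
    if "integrable M u" "integrable M v" for u v :: "'a \<Rightarrow> real"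
    using that by simp
  have iexp_cs: "iexp x = of_real (cos x) + \<i> * of_real (sin x)" for x
    by (simp add: exp_Euler cos_of_real sin_of_real)
  have eA: "(CLINT \<omega>|M. iexp (t * A \<omega>)) = of_real (expectation cA) + \<i> * of_real (expectation sA)"
    unfolding iexp_cs cA_def[symmetric, THEN fun_cong] sA_def[symmetric, THEN fun_cong] by (rule cplx[OF i(1,2)])
  have eB: "(CLINT \<omega>|M. iexp (t * B \<omega>)) = of_real (expectation cB) + \<i> * of_real (expectation sB)"
    unfolding iexp_cs cB_def[symmetric, THEN fun_cong] sB_def[symmetric, THEN fun_cong] by (rule cplx[OF i(3,4)])
  have "(CLINT \<omega>|M. iexp (t * (A \<omega> + B \<omega>))) =
      (CLINT \<omega>|M. of_real (cA \<omega> * cB \<omega> - sA \<omega> * sB \<omega>) + \<i> * of_real (cA \<omega> * sB \<omega> + sA \<omega> * cB \<omega>))"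
    by (intro Bochner_Integration.integral_cong refl)
       (simp add: iexp_cs cA_def sA_def cB_def sB_def distrib_left cos_add sin_add add.commute del: of_real_mult of_real_add of_real_diff)
  also have "\<dots> = of_real (expectation (\<lambda>\<omega>. cA \<omega> * cB \<omega>) - expectation (\<lambda>\<omega>. sA \<omega> * sB \<omega>)) +
      \<i> * of_real (expectation (\<lambda>\<omega>. cA \<omega> * sB \<omega>) + expectation (\<lambda>\<omega>. sA \<omega> * cB \<omega>))"
    using i by (subst cplx) auto
  finally have "(CLINT \<omega>|M. iexp (t * (A \<omega> + B \<omega>))) - (CLINT \<omega>|M. iexp (t * A \<omega>)) * (CLINT \<omega>|M. iexp (t * B \<omega>)) =
      of_real (covariance M cA cB) - of_real (covariance M sA sB) + \<i> * (of_real (covariance M cA sB) + of_real (covariance M sA cB))"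
    unfolding eA eB by (simp add: covariance_bounded b algebra_simps complex_eq_iff)
  also have "norm \<dots> \<le> (\<bar>covariance M cA cB\<bar> + \<bar>covariance M sA sB\<bar>) + (\<bar>covariance M cA sB\<bar> + \<bar>covariance M sA cB\<bar>)"
    by (intro order_trans[OF norm_triangle_ineq] add_mono order_trans[OF norm_triangle_ineq4])
       (auto simp: norm_mult simp del: of_real_add intro: order_trans[OF norm_triangle_ineq])
  also have "\<dots> \<le> 4 * t\<^sup>2 * covariance M A B" using c1 c2 c3 c4 by linarith
  finally show ?thesis .
qed

definition lag_cov :: "(real \<Rightarrow> real) \<Rightarrow> nat \<Rightarrow> real" where
  "lag_cov h d = covariance M (\<lambda>\<omega>. h (X 1 \<omega>)) (\<lambda>\<omega>. h (X (1 + d) \<omega>))"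

definition cov_tail :: "(real \<Rightarrow> real) \<Rightarrow> nat \<Rightarrow> real" where
  "cov_tail h p = (\<Sum>j. lag_cov h (j + p))"

lemma bounded_rv_X:
  assumes h: "mono h" "\<And>x. \<bar>h x\<bar> \<le> C" and j: "1 \<le> j"
  shows "bounded_rv M (\<lambda>\<omega>. h (X j \<omega>))"
  using X_meas[OF j] borel_measurable_mono[OF h(1)] h(2)
  by (intro bounded_rvI[of _ _ C]) (auto intro: measurable_compose)

lemma lag_cov_nonneg:
  assumes h: "mono h" "\<And>x. \<bar>h x\<bar> \<le> C" shows "0 \<le> lag_cov h d"
  unfolding lag_cov_def by (rule covariance_nondecreasing[OF _ _ h(1) h(1) h(2) h(2)]) auto

lemma covariance_eq_lag_cov:
  assumes h: "mono h" "\<And>x. \<bar>h x\<bar> \<le> C" and ij: "1 \<le> i" "i \<le> j"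
  shows "covariance M (\<lambda>\<omega>. h (X i \<omega>)) (\<lambda>\<omega>. h (X j \<omega>)) = lag_cov h (j - i)"
  using covariance_shift[of h h C i "j - i"] borel_measurable_mono[OF h(1)] h(2) ij
  by (simp add: lag_cov_def)

text \<open>
  Bilinearity splits the difference into covariances of \<open>v - u\<close> with \<open>v\<close> and of \<open>u\<close> with
  \<open>v - u\<close>; all these functions are nondecreasing.
\<close>

lemma lag_cov_mono:
  assumes u: "mono u" "\<And>x. \<bar>u x\<bar> \<le> C" and v: "mono v" "\<And>x. \<bar>v x\<bar> \<le> C"
    and vu: "mono (\<lambda>x. v x - u x)"
  shows "lag_cov u d \<le> lag_cov v d"
proof -
  have w: "\<bar>v x - u x\<bar> \<le> 2 * C" for x using u(2)[of x] v(2)[of x] by linarith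
  have C: "C \<le> 2 * C" using u(2)[of 0] by linarith
  note b = bounded_rv_X[OF u] bounded_rv_X[OF v]
  have "0 \<le> covariance M (\<lambda>\<omega>. v (X 1 \<omega>) - u (X 1 \<omega>)) (\<lambda>\<omega>. v (X (1 + d) \<omega>))"
    by (rule covariance_nondecreasing[OF _ _ vu v(1) w order_trans[OF v(2) C]]) auto
  moreover have "0 \<le> covariance M (\<lambda>\<omega>. u (X 1 \<omega>)) (\<lambda>\<omega>. v (X (1 + d) \<omega>) - u (X (1 + d) \<omega>))"
    by (rule covariance_nondecreasing[OF _ _ u(1) vu order_trans[OF u(2) C] w]) auto
  ultimately show ?thesis
    unfolding lag_cov_def by (simp add: covariance_diff_left covariance_diff_right b)
qed

context
  fixes h :: "real \<Rightarrow> real" and C :: real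
  assumes h: "mono h" "\<And>x. \<bar>h x\<bar> \<le> C"
    and summable_lag_cov: "summable (\<lambda>j. lag_cov h (j + 1))"
begin

lemma summable_lag_cov_shift: "1 \<le> p \<Longrightarrow> summable (\<lambda>j. lag_cov h (j + p))"
  using summable_ignore_initial_segment[OF summable_lag_cov, of "p - 1"] by (simp add: add.assoc)

text \<open>
  Summing over the whole past only meets the lags \<open>p, p + 1, \<dots>\<close>, each once.
\<close>

lemma covariance_past_sum_le:
  assumes p: "1 \<le> p"
  shows "covariance M (\<lambda>\<omega>. \<Sum>i\<in>{1..N}. h (X i \<omega>)) (\<lambda>\<omega>. h (X (N + p) \<omega>)) \<le> cov_tail h p"
proof -
  have "covariance M (\<lambda>\<omega>. \<Sum>i\<in>{1..N}. h (X i \<omega>)) (\<lambda>\<omega>. h (X (N + p) \<omega>)) = (\<Sum>i\<in>{1..N}. lag_cov h (N + p - i))"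
    using p by (subst covariance_sum_left) (auto intro!: bounded_rv_X[OF h] sum.cong covariance_eq_lag_cov[OF h])
  also have "\<dots> = (\<Sum>q<N. lag_cov h (q + p))"
    by (rule sum.reindex_bij_witness[of _ "\<lambda>q. N - q" "\<lambda>i. N - i"]) auto
  also have "\<dots> \<le> cov_tail h p"
    unfolding cov_tail_def by (intro sum_le_suminf summable_lag_cov_shift p lag_cov_nonneg[OF h]) auto
  finally show ?thesis .
qed

lemma cov_tail_nonneg: "1 \<le> p \<Longrightarrow> 0 \<le> cov_tail h p"
  unfolding cov_tail_def by (intro suminf_nonneg summable_lag_cov_shift lag_cov_nonneg[OF h])

text \<open>
  Blocks are split off one at a time. The covariance of a block with all earlier blocks is at
  most \<open>\<Sum>\<^sub>p\<^sub>\<le>\<^sub>m cov_tail p\<close>, the \<open>p\<close>-th variable of the block being at distance at least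
  \<open>p\<close> from the past.
\<close>

lemma char_block_sums:
  defines "S \<equiv> \<lambda>N \<omega>. \<Sum>i\<in>{1..N}. h (X i \<omega>)"
  shows "norm ((CLINT \<omega>|M. iexp (t * S (k * m) \<omega>)) - (CLINT \<omega>|M. iexp (t * S m \<omega>)) ^ k)
    \<le> real k * (4 * t\<^sup>2 * (\<Sum>p\<in>{1..m}. cov_tail h p))"
proof (induction k)
  case 0
  show ?case by (simp add: S_def prob_space)
next
  case (Suc k)
  define e where "e = 4 * t\<^sup>2 * (\<Sum>p\<in>{1..m}. cov_tail h p)"
  define w where "w = (CLINT \<omega>|M. iexp (t * S m \<omega>))"
  note [measurable] = borel_measurable_mono[OF h(1)]
  define Y where "Y = (\<lambda>\<omega>. \<Sum>i\<in>{k * m + 1..k * m + m}. h (X i \<omega>))"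
  have w1: "norm w \<le> 1"
    unfolding w_def by (rule order_trans[OF integral_norm_bound]) (simp add: prob_space)
  have wY: "(CLINT \<omega>|M. iexp (t * Y \<omega>)) = w"
    unfolding w_def S_def Y_def
    by (rule sum_shift[of "\<lambda>x. iexp (t * x)" h "k * m" m]) measurable
  have split: "S (Suc k * m) \<omega> = S (k * m) \<omega> + Y \<omega>" for \<omega>
    unfolding S_def Y_def using sum.ub_add_nat[of 1 "k * m" "\<lambda>i. h (X i \<omega>)" m] by (simp add: add.commute)
  have "covariance M (S (k * m)) Y = (\<Sum>i\<in>{k * m + 1..k * m + m}. covariance M (S (k * m)) (\<lambda>\<omega>. h (X i \<omega>)))"
    unfolding Y_def S_def
    by (subst covariance_sum_right) (auto intro!: bounded_rv_X[OF h] bounded_rv_sum)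
  also have "\<dots> = (\<Sum>p\<in>{1..m}. covariance M (S (k * m)) (\<lambda>\<omega>. h (X (k * m + p) \<omega>)))"
    by (rule sum.reindex_bij_witness[of _ "\<lambda>p. k * m + p" "\<lambda>i. i - k * m"]) auto
  also have "\<dots> \<le> (\<Sum>p\<in>{1..m}. cov_tail h p)"
    unfolding S_def by (intro sum_mono covariance_past_sum_le) auto
  finally have cov: "4 * t\<^sup>2 * covariance M (S (k * m)) Y \<le> e"
    unfolding e_def by (intro mult_left_mono) auto
  have new: "norm ((CLINT \<omega>|M. iexp (t * (S (k * m) \<omega> + Y \<omega>))) - (CLINT \<omega>|M. iexp (t * S (k * m) \<omega>)) * (CLINT \<omega>|M. iexp (t * Y \<omega>)))
      \<le> 4 * t\<^sup>2 * covariance M (S (k * m)) Y"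
    unfolding S_def Y_def by (rule newman_inequality[OF _ _ _ _ h]) auto
  have "(CLINT \<omega>|M. iexp (t * S (Suc k * m) \<omega>)) - w ^ Suc k =
      ((CLINT \<omega>|M. iexp (t * (S (k * m) \<omega> + Y \<omega>))) - (CLINT \<omega>|M. iexp (t * S (k * m) \<omega>)) * w) +
      ((CLINT \<omega>|M. iexp (t * S (k * m) \<omega>)) - w ^ k) * w"
    by (simp only: split) (simp add: algebra_simps)
  also have "norm \<dots> \<le> e + real k * e * 1"
  proof (intro order_trans[OF norm_triangle_ineq] add_mono)
    show "norm ((CLINT \<omega>|M. iexp (t * (S (k * m) \<omega> + Y \<omega>))) - (CLINT \<omega>|M. iexp (t * S (k * m) \<omega>)) * w) \<le> e"
      using new cov unfolding wY by (rule order_trans)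
    show "norm (((CLINT \<omega>|M. iexp (t * S (k * m) \<omega>)) - w ^ k) * w) \<le> real k * e * 1"
      unfolding norm_mult using Suc.IH w1 unfolding w_def[symmetric] e_def[symmetric]
      by (intro mult_mono) (auto intro: order_trans[OF norm_ge_zero])
  qed
  finally show ?case unfolding w_def e_def by (simp add: algebra_simps)
qed

lemma second_moment_sum_le:
  "expectation (\<lambda>\<omega>. (\<Sum>i\<in>{1..N}. h (X i \<omega>))\<^sup>2) \<le>
     real N * expectation (\<lambda>\<omega>. (h (X 1 \<omega>))\<^sup>2) + 2 * real N * cov_tail h 1 +
     (real N * expectation (\<lambda>\<omega>. h (X 1 \<omega>)))\<^sup>2"
proof -
  define S where "S = (\<lambda>N \<omega>. \<Sum>i\<in>{1..N}. h (X i \<omega>))"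
  note [measurable] = borel_measurable_mono[OF h(1)]
  note b = bounded_rv_X[OF h]
  have bS: "bounded_rv M (S N)" for N unfolding S_def by (intro bounded_rv_sum b) auto
  have var: "covariance M (S N) (S N) \<le> real N * expectation (\<lambda>\<omega>. (h (X 1 \<omega>))\<^sup>2) + 2 * real N * cov_tail h 1"
  proof (induction N)
    case 0
    then show ?case by (simp add: S_def covariance_def)
  next
    case (Suc N)
    have S_Suc: "S (Suc N) = (\<lambda>\<omega>. S N \<omega> + h (X (N + 1) \<omega>))" by (simp add: S_def fun_eq_iff)
    have bh: "bounded_rv M (\<lambda>\<omega>. h (X (N + 1) \<omega>))" by (rule b) simp
    have "covariance M (S (Suc N)) (S (Suc N)) =
      covariance M (S N) (S N) + 2 * covariance M (S N) (\<lambda>\<omega>. h (X (N + 1) \<omega>)) +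
        covariance M (\<lambda>\<omega>. h (X (N + 1) \<omega>)) (\<lambda>\<omega>. h (X (N + 1) \<omega>))"
      unfolding S_Suc using covariance_commute[of "S N" "\<lambda>\<omega>. h (X (N + 1) \<omega>)"]
      by (simp add: covariance_add_left covariance_add_right bounded_rv_add bS bh del: add_Suc_right One_nat_def)
    moreover have "covariance M (S N) (\<lambda>\<omega>. h (X (N + 1) \<omega>)) \<le> cov_tail h 1"
      unfolding S_def by (rule covariance_past_sum_le) simp
    moreover have "covariance M (\<lambda>\<omega>. h (X (N + 1) \<omega>)) (\<lambda>\<omega>. h (X (N + 1) \<omega>)) \<le> expectation (\<lambda>\<omega>. (h (X 1 \<omega>))\<^sup>2)"
    proof -
      have "covariance M (\<lambda>\<omega>. h (X (N + 1) \<omega>)) (\<lambda>\<omega>. h (X (N + 1) \<omega>)) \<le> expectation (\<lambda>\<omega>. (h (X (N + 1) \<omega>))\<^sup>2)"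
        using covariance_bounded[OF bh bh] zero_le_square[of "expectation (\<lambda>\<omega>. h (X (N + 1) \<omega>))"]
        by (simp add: power2_eq_square)
      also have "\<dots> = expectation (\<lambda>\<omega>. (h (X 1 \<omega>))\<^sup>2)"
        by (rule expectation_shift1[of "\<lambda>x. (h x)\<^sup>2"]) auto
      finally show ?thesis .
    qed
    ultimately show ?case using Suc by (simp add: algebra_simps)
  qed
  have "expectation (S N) = (\<Sum>i\<in>{1..N}. expectation (\<lambda>\<omega>. h (X i \<omega>)))"
    unfolding S_def by (intro Bochner_Integration.integral_sum bounded_rv_integrable b) auto
  also have "\<dots> = (\<Sum>i\<in>{1..N}. expectation (\<lambda>\<omega>. h (X 1 \<omega>)))"
    by (intro sum.cong refl expectation_shift1) auto
  finally have ES: "expectation (S N) = real N * expectation (\<lambda>\<omega>. h (X 1 \<omega>))" by simp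
  have "expectation (\<lambda>\<omega>. (S N \<omega>)\<^sup>2) = covariance M (S N) (S N) + (expectation (S N))\<^sup>2"
    by (simp add: covariance_bounded[OF bS bS] power2_eq_square)
  with var ES show ?thesis unfolding S_def by simp
qed

end

end

section \<open>Vague convergence tested on clamped vectors\<close>

text \<open>
  A continuous extension of truncation to the extended line. Composing with it turns a continuous
  function on \<open>\<real>\<^sup>N\<close> into one on the compact space \<open>[-\<infinity>, \<infinity>]\<^sup>N\<close>.
\<close>

definition clamp_ereal :: "real \<Rightarrow> ereal \<Rightarrow> real" where
  "clamp_ereal K y = real_of_ereal (max (ereal (- K)) (min (ereal K) y))"

lemma clamp_ereal_ereal: "0 < K \<Longrightarrow> clamp_ereal K (ereal x) = truncation K x"
  by (simp add: clamp_ereal_def truncation_eq_clamp flip: ereal_min ereal_max)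

lemma clamp_ereal_continuous: "continuous_on UNIV (clamp_ereal K)"
proof -
  have "continuous_on UNIV (\<lambda>y. real_of_ereal (max (ereal (- K)) (min (ereal K) y)))"
  proof (rule continuous_on_compose2[OF continuous_on_real])
    show "continuous_on UNIV (\<lambda>y. max (ereal (- K)) (min (ereal K) y))"
      by (intro continuous_intros)
    show "range (\<lambda>y. max (ereal (- K)) (min (ereal K) y)) \<subseteq> UNIV - {\<infinity>, - \<infinity>}"
    proof -
      have "max (ereal (- K)) (min (ereal K) y) \<noteq> \<infinity> \<and> max (ereal (- K)) (min (ereal K) y) \<noteq> - \<infinity>" for y
        by (cases y) (auto simp: max_def min_def)
      then show ?thesis by auto
    qed
  qed
  then show ?thesis by (simp add: clamp_ereal_def[abs_def])
qed

lemma clamp_ereal_small: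
  assumes "0 < \<epsilon>" "\<epsilon> \<le> K" "y \<in> {ereal (- \<epsilon>)<..<ereal \<epsilon>}"
  shows "\<bar>clamp_ereal K y\<bar> \<le> \<epsilon>"
  using assms by (cases y) (auto simp: clamp_ereal_ereal truncation_def)

lemma integral_scale_measure:
  fixes f :: "'a \<Rightarrow> real"
  assumes f: "f \<in> borel_measurable m"
  shows "(LINT x|scale_measure (of_nat n) m. f x) = real n * (LINT x|m. f x)"
proof -
  have "scale_measure (of_nat n) m = density m (\<lambda>_. ennreal (real n))"
    by (rule measure_eqI) (auto simp: emeasure_density_const ennreal_of_nat_eq_real_of_nat)
  then show ?thesis using f by (simp add: integral_density)
qed

lemma set_integral_to_extended:
  fixes G :: "(nat \<Rightarrow> real) \<Rightarrow> real"
  assumes m: "sets m = sets (\<Pi>\<^sub>M i\<in>{1..N}. borel)"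
    and G [measurable]: "G \<in> borel_measurable (\<Pi>\<^sub>M i\<in>{1..N}. borel)"
    and G0: "G (\<lambda>i\<in>{1..N}. 0) = 0" and K: "0 < K"
  shows "(LINT y:topspace (extended_punctured N)|scale_measure (of_nat n) (to_extended N m).
      G (\<lambda>i\<in>{1..N}. clamp_ereal K (y i))) = real n * (LINT x|m. G (\<lambda>i\<in>{1..N}. truncation K (x i)))"
proof -
  let ?P = "\<Pi>\<^sub>M i\<in>{1..N}. (borel :: ereal measure)"
  have cm: "(\<lambda>y. \<lambda>i\<in>{1..N}. clamp_ereal K (y i)) \<in> measurable ?P (\<Pi>\<^sub>M i\<in>{1..N}. borel)"
    using borel_measurable_continuous_onI[OF clamp_ereal_continuous[of K]]
    by (intro measurable_restrict measurable_compose[OF measurable_component_singleton]) auto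
  have h [measurable]: "(\<lambda>y. G (\<lambda>i\<in>{1..N}. clamp_ereal K (y i))) \<in> borel_measurable ?P"
    using measurable_compose[OF cm G] .
  have em: "(\<lambda>x. \<lambda>i\<in>{1..N}. ereal (x i)) \<in> measurable m ?P"
    unfolding measurable_cong_sets[OF m refl] by (intro measurable_restrict) measurable
  have sp: "space (scale_measure (of_nat n) (to_extended N m)) = space ?P"
    by (simp add: to_extended_def space_scale_measure)
  have G0': "G (\<lambda>i\<in>{1..N}. clamp_ereal K 0) = 0"
    using clamp_ereal_ereal[OF K, of 0] K G0 by (simp add: truncation_def zero_ereal_def)
  have "(LINT y:topspace (extended_punctured N)|scale_measure (of_nat n) (to_extended N m).
      G (\<lambda>i\<in>{1..N}. clamp_ereal K (y i))) =
    (LINT y|scale_measure (of_nat n) (to_extended N m). G (\<lambda>i\<in>{1..N}. clamp_ereal K (y i)))"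
    unfolding set_lebesgue_integral_def
  proof (rule Bochner_Integration.integral_cong[OF refl])
    fix y assume "y \<in> space (scale_measure (of_nat n) (to_extended N m))"
    then have y: "y \<in> PiE {1..N} (\<lambda>_. UNIV)" unfolding sp by (simp add: space_PiM)
    show "indicator (topspace (extended_punctured N)) y *\<^sub>R G (\<lambda>i\<in>{1..N}. clamp_ereal K (y i)) = G (\<lambda>i\<in>{1..N}. clamp_ereal K (y i))"
    proof (cases "y = (\<lambda>i\<in>{1..N}. 0)")
      case True
      then have "(\<lambda>i\<in>{1..N}. clamp_ereal K (y i)) = (\<lambda>i\<in>{1..N}. clamp_ereal K 0)" by auto
      then show ?thesis using G0' by simp
    next
      case False
      then show ?thesis using y by (simp add: extended_punctured_def)
    qed
  qed
  also have "\<dots> = real n * (LINT y|to_extended N m. G (\<lambda>i\<in>{1..N}. clamp_ereal K (y i)))"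
    by (rule integral_scale_measure) (use h in \<open>simp add: to_extended_def\<close>)
  also have "(LINT y|to_extended N m. G (\<lambda>i\<in>{1..N}. clamp_ereal K (y i))) =
      (LINT x|m. G (\<lambda>i\<in>{1..N}. clamp_ereal K ((\<lambda>i\<in>{1..N}. ereal (x i)) i)))"
    unfolding to_extended_def by (rule integral_distr[OF em h])
  also have "\<dots> = (LINT x|m. G (\<lambda>i\<in>{1..N}. truncation K (x i)))"
    by (intro Bochner_Integration.integral_cong refl arg_cong[where f = G] restrict_ext)
       (simp add: clamp_ereal_ereal[OF K])
  finally show ?thesis .
qed

text \<open>
  A clamped test function that vanishes on a neighbourhood of the origin has compact support in
  the punctured space, because the complement of such a neighbourhood is closed in a compact
  space.
\<close>

lemma vague_limit_clamped:
  fixes G :: "(nat \<Rightarrow> real) \<Rightarrow> real" and Y :: "nat \<Rightarrow> nat \<Rightarrow> 'a \<Rightarrow> real"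
  assumes vague: "vaguely_converges (extended_punctured N)
            (\<lambda>n. scale_measure (of_nat n) (to_extended N (joint_law M (Y n) {1..N})))
            (to_extended N \<nu>)"
    and \<nu>: "sets \<nu> = sets (\<Pi>\<^sub>M i\<in>{1..N}. borel)"
    and Y: "\<And>n i. i \<in> {1..N} \<Longrightarrow> Y n i \<in> borel_measurable M"
    and K: "0 < K" and \<epsilon>: "0 < \<epsilon>"
    and G [measurable]: "G \<in> borel_measurable (\<Pi>\<^sub>M i\<in>{1..N}. borel)"
    and cont: "continuous_map (product_topology (\<lambda>_. euclideanreal) {1..N}) euclideanreal G"
    and vanish: "\<And>x. (\<And>i. i \<in> {1..N} \<Longrightarrow> \<bar>x i\<bar> \<le> \<epsilon>) \<Longrightarrow> G x = 0"
  shows "(\<lambda>n. real n * (LINT \<omega>|M. G (\<lambda>i\<in>{1..N}. truncation K (Y n i \<omega>)))) \<longlonglongrightarrow>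
    (LINT x|\<nu>. G (\<lambda>i\<in>{1..N}. truncation K (x i)))"
proof -
  let ?P = "product_topology (\<lambda>_. euclidean :: ereal topology) {1..N}"
  let ?T = "extended_punctured N"
  define h where "h = (\<lambda>y. G (\<lambda>i\<in>{1..N}. clamp_ereal K (y i)))"
  \<comment> \<open>Clamping at \<open>K\<close> leaves coordinates below \<open>K\<close> unchanged, so the vanishing is tested on a cube inside \<open>[-K, K]\<^sup>N\<close>.\<close>
  define \<epsilon>' where "\<epsilon>' = min \<epsilon> K"
  have \<epsilon>': "0 < \<epsilon>'" "\<epsilon>' \<le> K" "\<epsilon>' \<le> \<epsilon>" using \<epsilon> K by (auto simp: \<epsilon>'_def)
  have G0: "G (\<lambda>i\<in>{1..N}. 0) = 0" using \<epsilon> by (intro vanish) auto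
  have "continuous_map ?P (product_topology (\<lambda>_. euclideanreal) {1..N}) (\<lambda>y. \<lambda>i\<in>{1..N}. clamp_ereal K (y i))"
    unfolding continuous_map_componentwise
  proof (intro conjI ballI)
    fix i assume i: "i \<in> {1..N}"
    have "continuous_map ?P euclideanreal (clamp_ereal K \<circ> (\<lambda>y. y i))"
      using i clamp_ereal_continuous
      by (intro continuous_map_compose[of _ euclidean] continuous_map_product_projection) auto
    then show "continuous_map ?P euclideanreal (\<lambda>y. (\<lambda>i\<in>{1..N}. clamp_ereal K (y i)) i)"
      using i by (simp add: o_def)
  qed auto
  from continuous_map_compose[OF this cont]
  have "continuous_map ?P euclideanreal h" by (simp add: h_def o_def)
  then have cont_h: "continuous_map ?T euclideanreal h"
    unfolding extended_punctured_def by (rule continuous_map_from_subtopology)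
  define C where "C = (\<Union>i\<in>{1..N}. {y \<in> topspace ?P. y i \<in> - {ereal (- \<epsilon>')<..<ereal \<epsilon>'}})"
  have C_closed: "closedin ?P C"
  proof -
    have "closedin ?P {y \<in> topspace ?P. y i \<in> - {ereal (- \<epsilon>')<..<ereal \<epsilon>'}}" if "i \<in> {1..N}" for i
    proof (rule closedin_continuous_map_preimage)
      show "continuous_map ?P euclidean (\<lambda>y. y i)"
        by (rule continuous_map_product_projection[OF that])
    qed auto
    then show ?thesis unfolding C_def by (intro closedin_Union finite_imageI) auto
  qed
  have "compact_space ?P"
    by (simp add: compact_space_product_topology compact_space_def compactin_PiE compact_UNIV)
  then have C_compact: "compactin ?P C" by (rule closedin_compact_space[OF _ C_closed])
  have C_sub: "C \<subseteq> - {\<lambda>i\<in>{1..N}. 0}" using \<epsilon>' by (auto simp: C_def zero_ereal_def)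
  have C_compact': "compactin ?T C"
    unfolding extended_punctured_def compactin_subtopology using C_compact C_sub by blast
  have C_closed': "closedin ?T C"
    unfolding extended_punctured_def using C_closed C_sub
    by (auto simp: closedin_subtopology intro!: exI[of _ C])
  have "{x \<in> topspace ?T. h x \<noteq> 0} \<subseteq> C"
  proof safe
    fix y assume y: "y \<in> topspace ?T" "h y \<noteq> 0"
    have "\<not> (\<forall>i\<in>{1..N}. y i \<in> {ereal (- \<epsilon>')<..<ereal \<epsilon>'})"
    proof
      assume *: "\<forall>i\<in>{1..N}. y i \<in> {ereal (- \<epsilon>')<..<ereal \<epsilon>'}"
      have "h y = 0" unfolding h_def
      proof (rule vanish)
        fix i assume i: "i \<in> {1..N}"
        then have "\<bar>clamp_ereal K (y i)\<bar> \<le> \<epsilon>'" using * \<epsilon>' by (intro clamp_ereal_small) auto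
        then show "\<bar>(\<lambda>i\<in>{1..N}. clamp_ereal K (y i)) i\<bar> \<le> \<epsilon>" using i \<epsilon>' by simp
      qed
      with y show False by simp
    qed
    then show "y \<in> C" using y by (auto simp: C_def extended_punctured_def)
  qed
  then have "?T closure_of {x \<in> topspace ?T. h x \<noteq> 0} \<subseteq> C"
    by (rule closure_of_minimal[OF _ C_closed'])
  then have "compactly_supported ?T h"
    unfolding compactly_supported_def by (intro closed_compactin[OF C_compact']) auto
  then have "(\<lambda>n. LINT x:topspace ?T|scale_measure (of_nat n) (to_extended N (joint_law M (Y n) {1..N})). h x)
      \<longlonglongrightarrow> (LINT x:topspace ?T|to_extended N \<nu>. h x)"
    using vague cont_h unfolding vaguely_converges_def by blast
  moreover have "(LINT x:topspace ?T|to_extended N \<nu>. h x) = (LINT x|\<nu>. G (\<lambda>i\<in>{1..N}. truncation K (x i)))"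
    using set_integral_to_extended[OF \<nu> G G0 K, of 1] unfolding h_def
    by (simp only: of_nat_1 scale_measure_1 mult_1_left)
  moreover have "(LINT x:topspace ?T|scale_measure (of_nat n) (to_extended N (joint_law M (Y n) {1..N})). h x) =
      real n * (LINT \<omega>|M. G (\<lambda>i\<in>{1..N}. truncation K (Y n i \<omega>)))" for n
  proof -
    have tm: "(\<lambda>x. \<lambda>i\<in>{1..N}. truncation K (x i)) \<in> measurable (\<Pi>\<^sub>M i\<in>{1..N}. borel) (\<Pi>\<^sub>M i\<in>{1..N}. borel)"
      by (intro measurable_restrict) measurable
    have "(LINT x|joint_law M (Y n) {1..N}. G (\<lambda>i\<in>{1..N}. truncation K (x i))) =
        (LINT \<omega>|M. G (\<lambda>i\<in>{1..N}. truncation K ((\<lambda>i\<in>{1..N}. Y n i \<omega>) i)))"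
      unfolding joint_law_def
      by (rule integral_distr[OF _ measurable_compose[OF tm G]]) (use Y in \<open>auto intro!: measurable_restrict\<close>)
    also have "\<dots> = (LINT \<omega>|M. G (\<lambda>i\<in>{1..N}. truncation K (Y n i \<omega>)))"
      by (intro Bochner_Integration.integral_cong refl arg_cong[where f = G] restrict_ext) simp
    finally show ?thesis
      unfolding h_def by (subst set_integral_to_extended[OF _ G G0 K]) (auto simp: joint_law_def)
  qed
  ultimately show ?thesis by simp
qed

section \<open>Tails of partial sums of a heavy-tailed sequence\<close>

text \<open>
  A sum of \<open>m\<close> terms exceeds \<open>r\<close> only if some term exceeds \<open>r / m\<close>; the envelope absorbs
  this change of scale into a constant.
\<close>

lemma potter_envelope_rescale:
  assumes m: "1 \<le> m" and r: "0 < r" and \<delta>: "0 < \<delta>" "\<delta> < \<alpha>"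
  shows "potter_envelope \<alpha> \<delta> (r / m) \<le> m powr (\<alpha> + \<delta>) * potter_envelope \<alpha> \<delta> r"
proof -
  have rm: "0 < r / m" "r / m \<le> r" using m r by (auto simp: field_simps)
  have pw: "(r / m) powr - e = m powr e * r powr - e" for e
    using m r by (simp add: powr_divide powr_minus field_simps)
  have m1: "m powr (\<alpha> - \<delta>) \<le> m powr (\<alpha> + \<delta>)" using m \<delta> by (intro powr_mono) auto
  have "m powr (\<alpha> - \<delta>) * r powr - (\<alpha> - \<delta>) \<le> m powr (\<alpha> + \<delta>) * r powr - (\<alpha> - \<delta>)"
    by (intro mult_right_mono m1) auto
  moreover have "m powr (\<alpha> + \<delta>) * r powr - (\<alpha> + \<delta>) \<le> m powr (\<alpha> + \<delta>) * r powr - (\<alpha> - \<delta>)" if "1 < r"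
    using that \<delta> by (intro mult_left_mono powr_mono) auto
  ultimately show ?thesis
    unfolding potter_envelope_def using pw[of "\<alpha> + \<delta>"] pw[of "\<alpha> - \<delta>"] rm by auto
qed

lemma set_integral_indicator_Iic:
  assumes "0 < a" shows "(LINT s:{0<..<x}|lborel. indicator {..a} s :: real) = (if 0 < x then min x a else 0)"
proof -
  have "(LINT s:{0<..<x}|lborel. indicator {..a} s *\<^sub>R (1 :: real)) = (LINT s:{0<..<min x a}|lborel. 1)"
    by (rule set_integral_cutoff) simp
  also have "\<dots> = (if 0 < x then min x a else 0)"
    using assms by (subst set_integral_vector_derivative[where F = "\<lambda>x. x"]) (auto intro!: derivative_eq_intros)
  finally show ?thesis by simp
qed

lemma set_integral_indicator_Ioi:
  assumes "0 < a" shows "(LINT s:{0<..<x}|lborel. indicator {a<..} s :: real) = max (x - a) 0"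
proof -
  have "(LINT s:{0<..<x}|lborel. indicator {a<..} s :: real) = (LINT s|lborel. indicator {a<..<x} s)"
    unfolding set_lebesgue_integral_def
    using assms by (intro Bochner_Integration.integral_cong) (auto simp: indicator_def)
  then show ?thesis by (cases "a \<le> x") auto
qed

lemma set_integral_double_cutoff:
  assumes "0 < a"
  shows "(LINT s:{0<..<x}|lborel. indicator {..a} s *\<^sub>R (2 * s :: real)) = (if 0 < x then (min x a)\<^sup>2 else 0)"
proof -
  have "(LINT s:{0<..<x}|lborel. indicator {..a} s *\<^sub>R (2 * s :: real)) = (LINT s:{0<..<min x a}|lborel. 2 * s)"
    by (rule set_integral_cutoff) simp
  also have "\<dots> = (if 0 < x then (min x a)\<^sup>2 else 0)"
    using assms by (subst set_integral_vector_derivative[where F = "\<lambda>x. x\<^sup>2"])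
      (auto intro!: derivative_eq_intros continuous_intros simp flip: has_real_derivative_iff_has_vector_derivative)
  finally show ?thesis .
qed

text \<open>
  The setting for sums of a fixed number of variables: marginal tails, centring, and vague
  convergence of the finite-dimensional laws. The measure of exceedances of \<open>X 1\<close> takes the
  place of the abstract tail function.
\<close>

locale heavy_tailed_sequence =
  stationary_sequence M X + regular_tail "\<lambda>x. measure M {\<omega> \<in> space M. x < \<bar>X 1 \<omega>\<bar>}" \<alpha> B
  for M :: "'a measure" and X :: "nat \<Rightarrow> 'a \<Rightarrow> real" and \<alpha> :: real and B :: "nat \<Rightarrow> real" +
  fixes \<nu> :: "nat \<Rightarrow> (nat \<Rightarrow> real) measure"
  assumes index_lt_2: "\<alpha> < 2"
    and symmetric: "\<alpha> = 1 \<Longrightarrow> 1 \<le> N \<Longrightarrow> symmetric_vector M X N"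
    and centred: "1 < \<alpha> \<Longrightarrow> integrable M (X 1)" "1 < \<alpha> \<Longrightarrow> expectation (X 1) = 0"
    and levy: "1 \<le> N \<Longrightarrow> levy_measure N (\<nu> N)"
    and vague: "1 \<le> N \<Longrightarrow> vaguely_converges (extended_punctured N)
        (\<lambda>n. scale_measure (of_nat n) (to_extended N (joint_law M (\<lambda>i \<omega>. X i \<omega> / B n) {1..N})))
        (to_extended N (\<nu> N))"
begin

abbreviation R :: "real \<Rightarrow> real" where "R x \<equiv> measure M {\<omega> \<in> space M. x < \<bar>X 1 \<omega>\<bar>}"

lemma eventually_norming_pos: "\<forall>\<^sub>F n in sequentially. 1 \<le> n \<and> 0 < B n"
  using eventually_ge_at_top[of 1] by eventually_elim (auto intro: norming_pos)

lemma tail_X: 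
  assumes j: "1 \<le> j" shows "measure M {\<omega> \<in> space M. x < \<bar>X j \<omega>\<bar>} = R x"
proof -
  note [measurable] = X_meas[OF j] X_meas[OF order_refl]
  have "expectation (\<lambda>\<omega>. indicator {y. x < \<bar>y\<bar>} (X j \<omega>)) = expectation (\<lambda>\<omega>. indicator {y. x < \<bar>y\<bar>} (X 1 \<omega>) :: real)"
    by (rule expectation_shift1[OF _ j]) measurable
  moreover have "expectation (\<lambda>\<omega>. indicator {y. x < \<bar>y\<bar>} (X i \<omega>) :: real) = measure M {\<omega> \<in> space M. x < \<bar>X i \<omega>\<bar>}" for i
  proof -
    have "expectation (\<lambda>\<omega>. indicator {y. x < \<bar>y\<bar>} (X i \<omega>) :: real) = expectation (indicator {\<omega> \<in> space M. x < \<bar>X i \<omega>\<bar>})"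
      by (intro Bochner_Integration.integral_cong) (auto simp: indicator_def)
    then show ?thesis by (simp add: Int_absorb2 subset_eq)
  qed
  ultimately show ?thesis by simp
qed

lemma potter_bound:
  assumes \<delta>: "0 < \<delta>" "\<delta> < \<alpha>"
  obtains C where "0 < C" "\<forall>\<^sub>F n in sequentially. \<forall>r>0. real n * R (r * B n) \<le> C * potter_envelope \<alpha> \<delta> r"
proof -
  obtain C where C: "0 < C"
    "\<forall>\<^sub>F n in sequentially. \<forall>r. 0 < r \<and> r \<le> 1 \<longrightarrow> real n * R (r * B n) \<le> C * r powr - (\<alpha> + \<delta>)"
    "\<forall>\<^sub>F n in sequentially. \<forall>r\<ge>1. real n * R (r * B n) \<le> C * r powr - (\<alpha> - \<delta>)"
    using potter_scaled[OF \<delta>] by blast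
  show ?thesis
  proof (rule that[OF C(1)])
    show "\<forall>\<^sub>F n in sequentially. \<forall>r>0. real n * R (r * B n) \<le> C * potter_envelope \<alpha> \<delta> r"
      using C(2,3) by eventually_elim (simp add: potter_envelope_def)
  qed
qed

lemma pareto_tails_X: "pareto_tails M (\<lambda>n \<omega>. \<bar>X 1 \<omega>\<bar> / B n) \<alpha> 1"
proof -
  have eq: "\<forall>\<^sub>F n in sequentially. \<forall>r. measure M {\<omega> \<in> space M. r < \<bar>X 1 \<omega>\<bar> / B n} = R (r * B n)"
    using eventually_norming_pos by eventually_elim (simp add: pos_less_divide_eq)
  show ?thesis
    unfolding pareto_tails_def
  proof (intro conjI allI impI)
    fix r :: real assume r: "0 < r"
    show "(\<lambda>n. real n * measure M {\<omega> \<in> space M. r < \<bar>X 1 \<omega>\<bar> / B n}) \<longlonglongrightarrow> 1 * r powr - \<alpha>"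
      by (simp, rule Lim_transform_eventually[OF scaled_tail[OF r]]) (use eq in eventually_elim, simp)
  next
    fix \<delta> :: real assume \<delta>: "0 < \<delta>" "\<delta> < \<alpha>"
    obtain C where "\<forall>\<^sub>F n in sequentially. \<forall>r>0. real n * R (r * B n) \<le> C * potter_envelope \<alpha> \<delta> r"
      using potter_bound[OF \<delta>] by blast
    then show "\<exists>C. \<forall>\<^sub>F n in sequentially. \<forall>r>0.
        real n * measure M {\<omega> \<in> space M. r < \<bar>X 1 \<omega>\<bar> / B n} \<le> C * potter_envelope \<alpha> \<delta> r"
      using eq by (intro exI[of _ C], eventually_elim) simp
  qed
qed

lemma measure_exceeds_le:
  "measure M {\<omega> \<in> space M. \<exists>i\<in>{1..m}. x < \<bar>X i \<omega>\<bar>} \<le> real m * R x"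
proof -
  have "measure M {\<omega> \<in> space M. \<exists>i\<in>{1..m}. x < \<bar>X i \<omega>\<bar>} = measure M (\<Union>i\<in>{1..m}. {\<omega> \<in> space M. x < \<bar>X i \<omega>\<bar>})"
    by (rule arg_cong[where f = "measure M"]) auto
  also have "\<dots> \<le> (\<Sum>i\<in>{1..m}. measure M {\<omega> \<in> space M. x < \<bar>X i \<omega>\<bar>})"
  proof (rule measure_UNION_le)
    fix i assume "i \<in> {1..m}"
    then have [measurable]: "X i \<in> borel_measurable M" by (intro X_meas) auto
    show "{\<omega> \<in> space M. x < \<bar>X i \<omega>\<bar>} \<in> sets M" by measurable
  qed auto
  also have "\<dots> = (\<Sum>i\<in>{1..m}. R x)" by (intro sum.cong refl tail_X) auto
  also have "\<dots> = real m * R x" by simp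
  finally show ?thesis .
qed

lemma exceeds_sets: "{\<omega> \<in> space M. \<exists>i\<in>{1..m}. x < \<bar>X i \<omega>\<bar>} \<in> sets M"
proof -
  have "{\<omega> \<in> space M. \<exists>i\<in>{1..m}. x < \<bar>X i \<omega>\<bar>} = (\<Union>i\<in>{1..m}. {\<omega> \<in> space M. x < \<bar>X i \<omega>\<bar>})" by auto
  also have "\<dots> \<in> sets M"
  proof (intro sets.finite_UN)
    fix i assume "i \<in> {1..m}"
    then have [measurable]: "X i \<in> borel_measurable M" by (intro X_meas) auto
    show "{\<omega> \<in> space M. x < \<bar>X i \<omega>\<bar>} \<in> sets M" by measurable
  qed auto
  finally show ?thesis .
qed

lemma sum_X_measurable [measurable]: "(\<lambda>\<omega>. \<Sum>i\<in>{1..m}. X i \<omega>) \<in> borel_measurable M"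
  by (intro borel_measurable_sum X_meas) auto

lemma partial_sum_tail_le:
  assumes m: "1 \<le> m" and \<theta>: "\<bar>\<theta>\<bar> = 1"
  shows "measure M {\<omega> \<in> space M. x < \<theta> * (\<Sum>i\<in>{1..m}. X i \<omega>)} \<le> real m * R (x / real m)"
proof -
  have "{\<omega> \<in> space M. x < \<theta> * (\<Sum>i\<in>{1..m}. X i \<omega>)} \<subseteq> {\<omega> \<in> space M. \<exists>i\<in>{1..m}. x / real m < \<bar>X i \<omega>\<bar>}"
  proof safe
    fix \<omega> assume x: "x < \<theta> * (\<Sum>i\<in>{1..m}. X i \<omega>)"
    show "\<exists>i\<in>{1..m}. x / real m < \<bar>X i \<omega>\<bar>"
    proof (rule ccontr)
      assume "\<not> ?thesis"
      then have "\<And>i. i \<in> {1..m} \<Longrightarrow> \<bar>X i \<omega>\<bar> \<le> x / real m" by force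
      then have "(\<Sum>i\<in>{1..m}. \<bar>X i \<omega>\<bar>) \<le> real (card {1..m}) * (x / real m)" by (rule sum_bounded_above)
      moreover have "\<theta> * (\<Sum>i\<in>{1..m}. X i \<omega>) \<le> \<bar>\<theta> * (\<Sum>i\<in>{1..m}. X i \<omega>)\<bar>" by (rule abs_ge_self)
      moreover have "\<dots> \<le> (\<Sum>i\<in>{1..m}. \<bar>X i \<omega>\<bar>)" using \<theta> by (simp add: abs_mult sum_abs)
      ultimately show False using x m by simp
    qed
  qed
  then show ?thesis
    using measure_exceeds_le[of m "x / real m"] exceeds_sets finite_measure_mono by (meson order_trans)
qed

text \<open>
  A continuous ramp between \<open>a\<close> and \<open>b\<close>, applied to the sum of the clamped coordinates, is a
  legitimate test function. Clamping at \<open>K\<close> is noticed only if some variable exceeds \<open>K B n\<close>,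
  which contributes at most \<open>m K\<^sup>-\<^sup>\<alpha>\<close> in the limit.
\<close>

lemma partial_sum_tail_sandwich:
  assumes m: "1 \<le> m" and \<theta>: "\<bar>\<theta>\<bar> = 1" and ab: "0 < a" "a < b" and \<eta>: "0 < \<eta>"
  defines "Q \<equiv> \<lambda>x. measure M {\<omega> \<in> space M. x < \<theta> * (\<Sum>i\<in>{1..m}. X i \<omega>)}"
  shows "\<exists>l. \<forall>\<^sub>F n in sequentially. real n * Q (b * B n) \<le> l + \<eta> \<and> l - \<eta> \<le> real n * Q (a * B n)"
proof -
  have "((\<lambda>K::real. K powr - \<alpha>) \<longlongrightarrow> 0) at_top"
    using index_pos by (intro tendsto_neg_powr filterlim_ident) auto
  from tendsto_mult_right_zero[OF this, of "real m"]
  have "\<forall>\<^sub>F K in at_top. real m * K powr - \<alpha> < \<eta> / 2"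
    by (rule order_tendstoD(2)) (use \<eta> in simp)
  then have "\<forall>\<^sub>F K in at_top. real m * K powr - \<alpha> < \<eta> / 2 \<and> 0 < K"
    using eventually_gt_at_top[of 0] by (rule eventually_conj)
  then obtain K where K: "real m * K powr - \<alpha> < \<eta> / 2" "0 < K"
    unfolding eventually_at_top_linorder by blast
  define G where "G = (\<lambda>x. min 1 (max 0 ((\<theta> * (\<Sum>i\<in>{1..m}. x i) - a) / (b - a))))"
  have G_meas [measurable]: "G \<in> borel_measurable (\<Pi>\<^sub>M i\<in>{1..m}. borel)"
  proof -
    have "(\<lambda>x. \<Sum>i\<in>{1..m}. x i) \<in> borel_measurable (\<Pi>\<^sub>M i\<in>{1..m}. (borel :: real measure))"
      by (intro borel_measurable_sum measurable_component_singleton)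
    then show ?thesis unfolding G_def by measurable
  qed
  have G_cont: "continuous_map (product_topology (\<lambda>_. euclideanreal) {1..m}) euclideanreal G"
    unfolding G_def using ab
    by (intro continuous_map_real_min continuous_map_real_max continuous_map_const[THEN iffD2]
        continuous_map_real_divide continuous_map_diff continuous_map_real_mult
        continuous_map_sum continuous_map_product_projection) auto
  have G01: "0 \<le> G x" "G x \<le> 1" for x by (auto simp: G_def)
  have G_1: "G x = 1" if "b < \<theta> * (\<Sum>i\<in>{1..m}. x i)" for x
    using that ab by (simp add: G_def)
  have G_0: "G x = 0" if "\<theta> * (\<Sum>i\<in>{1..m}. x i) \<le> a" for x
  proof -
    have "(\<theta> * (\<Sum>i\<in>{1..m}. x i) - a) / (b - a) \<le> 0" using that ab by (intro divide_nonpos_pos) auto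
    then show ?thesis by (simp add: G_def)
  qed
  have G_vanish: "G x = 0" if "\<And>i. i \<in> {1..m} \<Longrightarrow> \<bar>x i\<bar> \<le> a / real m" for x
  proof (rule G_0)
    have "\<theta> * (\<Sum>i\<in>{1..m}. x i) \<le> \<bar>\<theta> * (\<Sum>i\<in>{1..m}. x i)\<bar>" by (rule abs_ge_self)
    also have "\<dots> \<le> (\<Sum>i\<in>{1..m}. \<bar>x i\<bar>)" using \<theta> by (simp add: abs_mult sum_abs)
    also have "\<dots> \<le> real (card {1..m}) * (a / real m)" by (rule sum_bounded_above) (rule that)
    also have "\<dots> = a" using m by simp
    finally show "\<theta> * (\<Sum>i\<in>{1..m}. x i) \<le> a" .
  qed
  have \<nu>_sets: "sets (\<nu> m) = sets (\<Pi>\<^sub>M i\<in>{1..m}. borel)"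
    using levy[OF m] by (simp add: levy_measure_def)
  have Xm: "(\<lambda>\<omega>. X i \<omega> / B n) \<in> borel_measurable M" if "i \<in> {1..m}" for n i
    using X_meas[of i] that by auto
  define g where "g = (\<lambda>n \<omega>. G (\<lambda>i\<in>{1..m}. truncation K (X i \<omega> / B n)))"
  obtain l where l: "(\<lambda>n. real n * expectation (g n)) \<longlonglongrightarrow> l"
    unfolding g_def
    using vague_limit_clamped[OF vague[OF m] \<nu>_sets Xm K(2) _ G_meas G_cont G_vanish, of "a / real m"] ab m by auto
  have g_meas [measurable]: "g n \<in> borel_measurable M" for n
  proof -
    have "(\<lambda>\<omega>. \<lambda>i\<in>{1..m}. truncation K (X i \<omega> / B n)) \<in> measurable M (\<Pi>\<^sub>M i\<in>{1..m}. borel)"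
      using Xm by (intro measurable_restrict) (auto intro: measurable_compose[OF _ truncation_measurable])
    from measurable_compose[OF this G_meas] show ?thesis by (simp add: g_def)
  qed
  have g_int: "integrable M (g n)" for n
  proof (rule integrable_const_bound)
    show "AE \<omega> in M. norm (g n \<omega>) \<le> 1" using G01 by (auto simp: g_def)
  qed (rule g_meas)
  have ev1: "\<forall>\<^sub>F n in sequentially. \<bar>real n * expectation (g n) - l\<bar> < \<eta> / 2"
    using tendstoD[OF l, of "\<eta> / 2"] \<eta> by (simp add: dist_real_def)
  have ev2: "\<forall>\<^sub>F n in sequentially. real m * (real n * R (K * B n)) < \<eta> / 2"
    by (rule order_tendstoD(2)[OF tendsto_mult[OF tendsto_const scaled_tail[OF K(2)]] K(1)])
  show ?thesis
    using ev1 ev2 eventually_norming_pos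
  proof (intro exI[of _ l], eventually_elim)
    case (elim n)
    then have Bn: "0 < B n" and near_l: "\<bar>real n * expectation (g n) - l\<bar> < \<eta> / 2" by blast+
    define E where "E = {\<omega> \<in> space M. \<exists>i\<in>{1..m}. K * B n < \<bar>X i \<omega>\<bar>}"
    have E_sets [measurable]: "E \<in> sets M" unfolding E_def by (rule exceeds_sets)
    have E_le: "real n * measure M E \<le> \<eta> / 2"
    proof -
      have "real n * measure M E \<le> real n * (real m * R (K * B n))"
        unfolding E_def by (intro mult_left_mono measure_exceeds_le) auto
      also have "\<dots> < \<eta> / 2" using elim by (simp add: mult_ac)
      finally show ?thesis by simp
    qed
    have off_E: "g n \<omega> = G (\<lambda>i\<in>{1..m}. X i \<omega> / B n)" if "\<omega> \<in> space M" "\<omega> \<notin> E" for \<omega>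
      unfolding g_def
    proof (intro arg_cong[where f = G] restrict_ext truncation_id)
      fix i assume "i \<in> {1..m}"
      then have "\<bar>X i \<omega>\<bar> \<le> K * B n" using that by (auto simp: E_def not_less)
      then show "\<bar>X i \<omega> / B n\<bar> \<le> K" using Bn by (simp add: abs_divide pos_divide_le_eq)
    qed
    have sum_div: "(\<Sum>i\<in>{1..m}. (\<lambda>i\<in>{1..m}. X i \<omega> / B n) i) = (\<Sum>i\<in>{1..m}. X i \<omega>) / B n" for \<omega>
      by (simp add: sum_divide_distrib)
    have Q_sets: "{\<omega> \<in> space M. x < \<theta> * (\<Sum>i\<in>{1..m}. X i \<omega>)} \<in> sets M" for x
      by measurable
    have ind_int: "integrable M (indicator A :: 'a \<Rightarrow> real)" if "A \<in> sets M" for A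
      using that by (simp add: less_top[symmetric])
    have ind: "expectation (indicator A) = measure M A" if "A \<in> sets M" for A
      using sets.sets_into_space[OF that] by (simp add: Int_absorb2)
    have "Q (b * B n) = expectation (indicator {\<omega> \<in> space M. b * B n < \<theta> * (\<Sum>i\<in>{1..m}. X i \<omega>)})"
      unfolding Q_def by (rule ind[OF Q_sets, symmetric])
    also have "\<dots> \<le> expectation (\<lambda>\<omega>. g n \<omega> + indicator E \<omega>)"
    proof (rule integral_mono)
      fix \<omega> assume \<omega>: "\<omega> \<in> space M"
      show "indicator {\<omega> \<in> space M. b * B n < \<theta> * (\<Sum>i\<in>{1..m}. X i \<omega>)} \<omega> \<le> g n \<omega> + indicator E \<omega>"
      proof (cases "\<omega> \<in> E")
        case False
        have "g n \<omega> = 1" if "b * B n < \<theta> * (\<Sum>i\<in>{1..m}. X i \<omega>)"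
          unfolding off_E[OF \<omega> False]
          by (rule G_1, unfold sum_div) (use that Bn in \<open>simp add: pos_less_divide_eq\<close>)
        then show ?thesis using G01 by (auto simp: indicator_def g_def)
      qed (use G01 in \<open>auto simp: indicator_def g_def intro: add_increasing\<close>)
    qed (intro ind_int Q_sets E_sets g_int Bochner_Integration.integrable_add)+
    also have "\<dots> = expectation (g n) + measure M E"
      by (subst Bochner_Integration.integral_add[OF g_int ind_int[OF E_sets]]) (simp only: ind[OF E_sets])
    finally have "real n * Q (b * B n) \<le> real n * (expectation (g n) + measure M E)"
      by (intro mult_left_mono) auto
    then have up: "real n * Q (b * B n) \<le> l + \<eta>"
      using near_l E_le unfolding distrib_left abs_less_iff by linarith
    have "expectation (g n) \<le> expectation (\<lambda>\<omega>. indicator {\<omega> \<in> space M. a * B n < \<theta> * (\<Sum>i\<in>{1..m}. X i \<omega>)} \<omega> + indicator E \<omega>)"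
    proof (rule integral_mono)
      fix \<omega> assume \<omega>: "\<omega> \<in> space M"
      show "g n \<omega> \<le> indicator {\<omega> \<in> space M. a * B n < \<theta> * (\<Sum>i\<in>{1..m}. X i \<omega>)} \<omega> + indicator E \<omega>"
      proof (cases "\<omega> \<in> E")
        case False
        have "g n \<omega> = 0" if "\<theta> * (\<Sum>i\<in>{1..m}. X i \<omega>) \<le> a * B n"
          unfolding off_E[OF \<omega> False]
          by (rule G_0, unfold sum_div) (use that Bn in \<open>simp add: pos_divide_le_eq\<close>)
        then show ?thesis using G01 \<omega> False by (auto simp: indicator_def g_def not_less)
      qed (use G01(2)[of "\<lambda>i\<in>{1..m}. truncation K (X i \<omega> / B n)"] in \<open>auto simp: indicator_def g_def\<close>)
    qed (intro ind_int Q_sets E_sets g_int Bochner_Integration.integrable_add)+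
    also have "\<dots> = Q (a * B n) + measure M E"
      unfolding Q_def
      by (subst Bochner_Integration.integral_add[OF ind_int[OF Q_sets] ind_int[OF E_sets]])
         (simp only: ind[OF E_sets] ind[OF Q_sets])
    finally have "real n * expectation (g n) \<le> real n * (Q (a * B n) + measure M E)"
      by (intro mult_left_mono) auto
    then have "l - \<eta> \<le> real n * Q (a * B n)"
      using near_l E_le unfolding distrib_left abs_less_iff by linarith
    with up show ?case by simp
  qed
qed

text \<open>
  The sandwich yields the limit, and Potter's bounds for a single variable at \<open>r / m\<close> yield
  the domination. The sign \<open>\<theta>\<close> treats both tails at once.
\<close>

lemma partial_sum_pareto_tails:
  assumes m: "1 \<le> m" and \<theta>: "\<bar>\<theta>\<bar> = 1"
  obtains c where "0 \<le> c" "pareto_tails M (\<lambda>n \<omega>. \<theta> * ((\<Sum>i\<in>{1..m}. X i \<omega>) / B n)) \<alpha> c"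
proof -
  define Q where "Q = (\<lambda>x. measure M {\<omega> \<in> space M. x < \<theta> * (\<Sum>i\<in>{1..m}. X i \<omega>)})"
  have Q_sets: "{\<omega> \<in> space M. x < \<theta> * (\<Sum>i\<in>{1..m}. X i \<omega>)} \<in> sets M" for x
    by measurable
  have Q_mono: "Q y \<le> Q x" if "x \<le> y" for x y
    unfolding Q_def by (rule finite_measure_mono[OF _ Q_sets]) (use that in auto)
  have Q_nonneg: "0 \<le> Q x" for x by (simp add: Q_def)
  have eq: "\<forall>\<^sub>F n in sequentially. \<forall>r. measure M {\<omega> \<in> space M. r < \<theta> * ((\<Sum>i\<in>{1..m}. X i \<omega>) / B n)} = Q (r * B n)"
    using eventually_norming_pos
    by eventually_elim (simp add: Q_def pos_less_divide_eq)
  have env: "\<exists>C. \<forall>\<^sub>F n in sequentially. \<forall>r>0. real n * Q (r * B n) \<le> C * potter_envelope \<alpha> \<delta> r"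
    if \<delta>: "0 < \<delta>" "\<delta> < \<alpha>" for \<delta>
  proof -
    obtain C where C: "0 < C" "\<forall>\<^sub>F n in sequentially. \<forall>r>0. real n * R (r * B n) \<le> C * potter_envelope \<alpha> \<delta> r"
      using potter_bound[OF \<delta>] by blast
    have "\<forall>\<^sub>F n in sequentially. \<forall>r>0. real n * Q (r * B n) \<le> (real m * C * real m powr (\<alpha> + \<delta>)) * potter_envelope \<alpha> \<delta> r"
      using C(2)
    proof eventually_elim
      case (elim n)
      show ?case
      proof safe
        fix r :: real assume r: "0 < r"
        have "real n * Q (r * B n) \<le> real n * (real m * R (r * B n / real m))"
          unfolding Q_def by (intro mult_left_mono partial_sum_tail_le[OF m \<theta>]) auto
        also have "\<dots> = real m * (real n * R (r / real m * B n))" by simp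
        also have "\<dots> \<le> real m * (C * potter_envelope \<alpha> \<delta> (r / real m))"
          using elim[rule_format, of "r / real m"] r m by (intro mult_left_mono) simp_all
        also have "\<dots> \<le> real m * (C * (real m powr (\<alpha> + \<delta>) * potter_envelope \<alpha> \<delta> r))"
          using m r \<delta> C by (intro mult_left_mono potter_envelope_rescale) auto
        finally show "real n * Q (r * B n) \<le> (real m * C * real m powr (\<alpha> + \<delta>)) * potter_envelope \<alpha> \<delta> r"
          by (simp add: mult_ac)
      qed
    qed
    then show ?thesis by blast
  qed
  obtain C where "\<forall>\<^sub>F n in sequentially. \<forall>r>0. real n * Q (r * B n) \<le> C * potter_envelope \<alpha> (\<alpha> / 2) r"
    using env[of "\<alpha> / 2"] index_pos by auto
  then have bd: "\<forall>\<^sub>F n in sequentially. real n * Q (B n) \<le> C * potter_envelope \<alpha> (\<alpha> / 2) 1"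
    by eventually_elim (metis mult_1 zero_less_one)
  have sw: "\<exists>l. \<forall>\<^sub>F n in sequentially. real n * Q (b * B n) \<le> l + \<eta> \<and> l - \<eta> \<le> real n * Q (a * B n)"
    if "0 < a" "a < b" "0 < \<eta>" for a b \<eta>
    unfolding Q_def by (rule partial_sum_tail_sandwich[OF m \<theta> that])
  have "\<exists>c\<ge>0. \<forall>r>0. (\<lambda>n. real n * Q (r * B n)) \<longlonglongrightarrow> c * r powr - \<alpha>"
  proof (rule tail_limit_exists[of Q])
    show "Q y \<le> Q x" if "x \<le> y" for x y by (rule Q_mono[OF that])
    show "0 \<le> Q x" for x by (rule Q_nonneg)
    show "\<forall>\<^sub>F n in sequentially. real n * Q (B n) \<le> C * potter_envelope \<alpha> (\<alpha> / 2) 1" by (rule bd)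
    show "\<exists>l. \<forall>\<^sub>F n in sequentially. real n * Q (b * B n) \<le> l + \<eta> \<and> l - \<eta> \<le> real n * Q (a * B n)"
      if "0 < a" "a < b" "0 < \<eta>" for a b \<eta> by (rule sw[OF that])
  qed blast
  then obtain c where c: "0 \<le> c" "\<And>r. 0 < r \<Longrightarrow> (\<lambda>n. real n * Q (r * B n)) \<longlonglongrightarrow> c * r powr - \<alpha>" by blast
  show ?thesis
  proof (rule that[OF c(1)])
    show "pareto_tails M (\<lambda>n \<omega>. \<theta> * ((\<Sum>i\<in>{1..m}. X i \<omega>) / B n)) \<alpha> c"
      unfolding pareto_tails_def
    proof (intro conjI allI impI)
      fix r :: real assume r: "0 < r"
      show "(\<lambda>n. real n * measure M {\<omega> \<in> space M. r < \<theta> * ((\<Sum>i\<in>{1..m}. X i \<omega>) / B n)}) \<longlonglongrightarrow> c * r powr - \<alpha>"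
        by (rule Lim_transform_eventually[OF c(2)[OF r]]) (use eq in eventually_elim, simp)
    next
      fix \<delta> :: real assume \<delta>: "0 < \<delta>" "\<delta> < \<alpha>"
      obtain C where "\<forall>\<^sub>F n in sequentially. \<forall>r>0. real n * Q (r * B n) \<le> C * potter_envelope \<alpha> \<delta> r"
        using env[OF \<delta>] by blast
      then show "\<exists>C. \<forall>\<^sub>F n in sequentially. \<forall>r>0.
          real n * measure M {\<omega> \<in> space M. r < \<theta> * ((\<Sum>i\<in>{1..m}. X i \<omega>) / B n)} \<le> C * potter_envelope \<alpha> \<delta> r"
        using eq by (intro exI[of _ C], eventually_elim) simp
    qed
  qed
qed

section \<open>Truncated moments and limiting covariances\<close>

lemma X1_measurable [measurable]: "X 1 \<in> borel_measurable M" "X (Suc 0) \<in> borel_measurable M"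
  using X_meas[of 1] by auto

lemma symmetric_expectation:
  fixes g :: "(nat \<Rightarrow> real) \<Rightarrow> 'b::{banach, second_countable_topology}"
  assumes "\<alpha> = 1" "1 \<le> N" and g: "g \<in> borel_measurable (\<Pi>\<^sub>M i\<in>{1..N}. borel)"
  shows "(LINT \<omega>|M. g (\<lambda>i\<in>{1..N}. - X i \<omega>)) = (LINT \<omega>|M. g (\<lambda>i\<in>{1..N}. X i \<omega>))"
proof -
  have "(LINT x|joint_law M (\<lambda>i \<omega>. - X i \<omega>) {1..N}. g x) = (LINT x|joint_law M X {1..N}. g x)"
    using symmetric[OF assms(1,2)] unfolding symmetric_vector_def by simp
  then show ?thesis
    unfolding joint_law_def
    by (subst (asm) (1 2) integral_distr) (use X_meas g in \<open>auto intro!: measurable_restrict borel_measurable_uminus\<close>)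
qed

text \<open>
  The limit of the rescaled second moments of the truncated variables; for \<open>r > 0\<close> the integrand
  is the square of the truncation at \<open>a\<close>.
\<close>

definition truncated_variance :: "real \<Rightarrow> real" where
  "truncated_variance a = (LINT r:{0<..}|lborel. (\<alpha> / r powr (\<alpha> + 1)) *\<^sub>R (if 0 < r then (min r a)\<^sup>2 else 0))"

lemma truncated_second_moment:
  assumes a: "0 < a"
  shows "(\<lambda>n. real n * expectation (\<lambda>\<omega>. (truncation a (X 1 \<omega> / B n))\<^sup>2)) \<longlonglongrightarrow> truncated_variance a"
proof -
  define \<gamma> where "\<gamma> = (\<lambda>r. indicator {..a} r *\<^sub>R (2 * r :: real))"
  have \<gamma>_m: "\<gamma> \<in> borel_measurable borel" unfolding \<gamma>_def by measurable
  define \<delta> where "\<delta> = min (\<alpha> / 2) ((2 - \<alpha>) / 2)"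
  have \<delta>: "0 < \<delta>" "\<delta> < \<alpha>" "-1 < 1 - (\<alpha> + \<delta>)" using index_pos index_lt_2 by (auto simp: \<delta>_def min_def field_simps)
  have int: "set_integrable lborel {0<..} (\<lambda>r. potter_envelope \<alpha> \<delta> r * norm (\<gamma> r))"
    by (rule set_integrable_envelope_cutoff[where p = 1 and D = "2 + 2 * a" and K = a])
       (use \<delta> a in \<open>auto simp: \<gamma>_def indicator_def intro: mult_right_mono\<close>)
  have "(\<lambda>n. real n *\<^sub>R (LINT \<omega>|M. (LINT r:{0<..<\<bar>X 1 \<omega>\<bar> / B n}|lborel. \<gamma> r))) \<longlonglongrightarrow>
      1 *\<^sub>R (LINT r:{0<..}|lborel. (\<alpha> / r powr (\<alpha> + 1)) *\<^sub>R (LINT s:{0<..<r}|lborel. \<gamma> s))"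
    by (rule pareto_tails_integral(2)[OF prob_space_axioms _ \<gamma>_m index_pos pareto_tails_X \<delta>(1,2) int]) measurable
  then have lim: "(\<lambda>n. real n * (LINT \<omega>|M. (if 0 < \<bar>X 1 \<omega>\<bar> / B n then (min (\<bar>X 1 \<omega>\<bar> / B n) a)\<^sup>2 else 0))) \<longlonglongrightarrow> truncated_variance a"
    unfolding \<gamma>_def set_integral_double_cutoff[OF a] truncated_variance_def by simp
  show ?thesis
  proof (rule Lim_transform_eventually[OF lim])
    show "\<forall>\<^sub>F n in sequentially. real n * (LINT \<omega>|M. (if 0 < \<bar>X 1 \<omega>\<bar> / B n then (min (\<bar>X 1 \<omega>\<bar> / B n) a)\<^sup>2 else 0)) =
        real n * expectation (\<lambda>\<omega>. (truncation a (X 1 \<omega> / B n))\<^sup>2)"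
      using eventually_norming_pos
    proof eventually_elim
      case (elim n)
      have "(if 0 < \<bar>X 1 \<omega>\<bar> / B n then (min (\<bar>X 1 \<omega>\<bar> / B n) a)\<^sup>2 else 0) = (truncation a (X 1 \<omega> / B n))\<^sup>2" for \<omega>
      proof -
        have "(truncation a (X 1 \<omega> / B n))\<^sup>2 = (min a \<bar>X 1 \<omega> / B n\<bar>)\<^sup>2"
          using abs_truncation[OF a, of "X 1 \<omega> / B n"] by (metis power2_abs)
        then show ?thesis
          using elim a by (cases "X 1 \<omega> = 0") (auto simp: abs_divide min.commute zero_less_divide_iff)
      qed
      then show ?case by simp
    qed
  qed
qed

lemma truncated_variance_small: "(\<lambda>k. truncated_variance (1 / real (Suc k))) \<longlonglongrightarrow> 0"
proof -
  define w where "w = (\<lambda>r. indicator {0<..} r *\<^sub>R ((\<alpha> / r powr (\<alpha> + 1)) *\<^sub>R (if 0 < r then (min r 1)\<^sup>2 else 0 :: real)))"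
  have "set_integrable lborel {0<..} (\<lambda>r. (\<alpha> / r powr (\<alpha> + 1)) *\<^sub>R (LINT s:{0<..<r}|lborel. indicator {..1} s *\<^sub>R (2 * s :: real)))"
  proof (rule pareto_layer_cake(1)[OF index_pos])
    have "set_integrable lborel {0<..1} (\<lambda>r. 2 * r powr (1 - \<alpha>))"
      using index_lt_2 by (intro set_integrable_mult_right set_integrable_powr_Ioc) auto
    moreover have "indicator {0<..} r *\<^sub>R (r powr - \<alpha> *\<^sub>R indicator {..1} r *\<^sub>R (2 * r)) = indicator {0<..1} r *\<^sub>R (2 * r powr (1 - \<alpha>))" for r :: real
      using powr_add[of r 1 "- \<alpha>"] by (auto simp: indicator_def)
    ultimately show "set_integrable lborel {0<..} (\<lambda>r. r powr - \<alpha> *\<^sub>R indicator {..1} r *\<^sub>R (2 * r))"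
      unfolding set_integrable_def by (simp only:)
  qed measurable
  then have w: "integrable lborel w"
    unfolding set_integral_double_cutoff[OF zero_less_one] set_integrable_def w_def by simp
  have "(\<lambda>k. LINT r|lborel. indicator {0<..} r *\<^sub>R ((\<alpha> / r powr (\<alpha> + 1)) *\<^sub>R (if 0 < r then (min r (1 / real (Suc k)))\<^sup>2 else 0)))
      \<longlonglongrightarrow> (LINT r|(lborel :: real measure). 0 :: real)"
  proof (rule integral_dominated_convergence[where w = w])
    show "integrable lborel w" by (rule w)
    show "AE r in lborel. (\<lambda>k. indicator {0<..} r *\<^sub>R ((\<alpha> / r powr (\<alpha> + 1)) *\<^sub>R (if 0 < r then (min r (1 / real (Suc k)))\<^sup>2 else 0))) \<longlonglongrightarrow> 0"
    proof (intro AE_I2)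
      fix r :: real
      have "(\<lambda>k. min r (1 / real (Suc k))) \<longlonglongrightarrow> min r 0"
        by (intro tendsto_min tendsto_const LIMSEQ_Suc[OF lim_1_over_n])
      from tendsto_mult[OF tendsto_const tendsto_power[OF this, of 2]]
      have "(\<lambda>k. (\<alpha> / r powr (\<alpha> + 1)) * (min r (1 / real (Suc k)))\<^sup>2) \<longlonglongrightarrow> (\<alpha> / r powr (\<alpha> + 1)) * (min r 0)\<^sup>2" .
      then show "(\<lambda>k. indicator {0<..} r *\<^sub>R ((\<alpha> / r powr (\<alpha> + 1)) *\<^sub>R (if 0 < r then (min r (1 / real (Suc k)))\<^sup>2 else 0))) \<longlonglongrightarrow> 0"
        by (cases "0 < r") simp_all
    qed
    show "AE r in lborel. norm (indicator {0<..} r *\<^sub>R ((\<alpha> / r powr (\<alpha> + 1)) *\<^sub>R (if 0 < r then (min r (1 / real (Suc k)))\<^sup>2 else 0))) \<le> w r" for k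
      using index_pos by (intro AE_I2) (auto simp: w_def indicator_def intro!: mult_left_mono divide_right_mono power_mono min.mono)
  qed measurable
  then show ?thesis
    unfolding truncated_variance_def set_lebesgue_integral_def by (simp only: Bochner_Integration.integral_zero)
qed

text \<open>
  The three ranges of \<open>\<alpha>\<close> have different reasons: for \<open>\<alpha> < 1\<close> truncated absolute moments are
  of order \<open>1 / n\<close>; for \<open>\<alpha> = 1\<close> symmetry makes the mean vanish; for \<open>\<alpha> > 1\<close> centring
  turns the truncated mean into the mean of the excess over the level.
\<close>

lemma truncated_mean_bounded:
  assumes a: "0 < a"
  obtains C where "\<forall>\<^sub>F n in sequentially. \<bar>real n * expectation (\<lambda>\<omega>. truncation a (X 1 \<omega> / B n))\<bar> \<le> C"
proof -
  note goal = that
  have Zm: "(\<lambda>\<omega>. \<bar>X 1 \<omega>\<bar> / B n) \<in> borel_measurable M" for n by measurable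
  have tr_int: "integrable M (\<lambda>\<omega>. truncation a (X 1 \<omega> / B n))" for n
    using abs_truncation_le[OF a] by (intro integrable_const_bound[of _ a]) auto
  have bounded: thesis if lim: "(\<lambda>n. real n * expectation (g n)) \<longlonglongrightarrow> l"
    and le: "\<forall>\<^sub>F n in sequentially. \<bar>expectation (\<lambda>\<omega>. truncation a (X 1 \<omega> / B n))\<bar> \<le> expectation (g n)" for g l
  proof -
    have "\<forall>\<^sub>F n in sequentially. real n * expectation (g n) < l + 1"
      by (rule order_tendstoD(2)[OF lim]) simp
    with le have "\<forall>\<^sub>F n in sequentially. \<bar>real n * expectation (\<lambda>\<omega>. truncation a (X 1 \<omega> / B n))\<bar> \<le> l + 1"
    proof eventually_elim
      case (elim n)
      have "\<bar>real n * expectation (\<lambda>\<omega>. truncation a (X 1 \<omega> / B n))\<bar> \<le> real n * expectation (g n)"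
        using elim by (simp add: abs_mult mult_left_mono)
      then show ?case using elim by linarith
    qed
    then show thesis by (rule goal)
  qed
  consider "\<alpha> < 1" | "\<alpha> = 1" | "1 < \<alpha>" by linarith
  then show thesis
  proof cases
    case 1
    define \<delta> where "\<delta> = min (\<alpha> / 2) ((1 - \<alpha>) / 2)"
    have \<delta>: "0 < \<delta>" "\<delta> < \<alpha>" "-1 < 0 - (\<alpha> + \<delta>)" using index_pos 1 by (auto simp: \<delta>_def min_def field_simps)
    have int: "set_integrable lborel {0<..} (\<lambda>r. potter_envelope \<alpha> \<delta> r * norm (indicator {..a} r :: real))"
      by (rule set_integrable_envelope_cutoff[where p = 0 and D = 1 and K = a])
         (use \<delta> in \<open>auto simp: indicator_def\<close>)
    have \<gamma>m: "(indicator {..a} :: real \<Rightarrow> real) \<in> borel_measurable borel" by measurable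
    note lim = pareto_tails_integral[OF prob_space_axioms Zm \<gamma>m index_pos pareto_tails_X \<delta>(1,2) int,
        unfolded set_integral_indicator_Iic[OF a] real_scaleR_def]
    show ?thesis
    proof (rule bounded[OF lim(2)])
      show "\<forall>\<^sub>F n in sequentially. \<bar>expectation (\<lambda>\<omega>. truncation a (X 1 \<omega> / B n))\<bar> \<le>
          expectation (\<lambda>\<omega>. if 0 < \<bar>X 1 \<omega>\<bar> / B n then min (\<bar>X 1 \<omega>\<bar> / B n) a else 0)"
        using lim(1) eventually_norming_pos
      proof eventually_elim
        case (elim n)
        have "\<bar>expectation (\<lambda>\<omega>. truncation a (X 1 \<omega> / B n))\<bar> \<le> expectation (\<lambda>\<omega>. \<bar>truncation a (X 1 \<omega> / B n)\<bar>)"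
          by (rule integral_abs_bound)
        also have "\<dots> = expectation (\<lambda>\<omega>. if 0 < \<bar>X 1 \<omega>\<bar> / B n then min (\<bar>X 1 \<omega>\<bar> / B n) a else 0)"
          unfolding abs_truncation[OF a] using elim a
          by (intro Bochner_Integration.integral_cong) (auto simp: abs_divide min.commute zero_less_divide_iff)
        finally show ?case .
      qed
    qed
  next
    case 2
    have "expectation (\<lambda>\<omega>. truncation a (X 1 \<omega> / B n)) = 0" for n
    proof -
      have "(\<lambda>x. truncation a (x 1 / B n)) \<in> borel_measurable (\<Pi>\<^sub>M i\<in>{1..1::nat}. borel)"
        by measurable
      from symmetric_expectation[OF 2 order_refl this]
      have "expectation (\<lambda>\<omega>. truncation a (- (X 1 \<omega> / B n))) = expectation (\<lambda>\<omega>. truncation a (X 1 \<omega> / B n))"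
        by simp
      then show ?thesis by (simp add: truncation_minus[OF a])
    qed
    then show ?thesis by (intro goal[of 0]) simp
  next
    case 3
    define \<delta> where "\<delta> = min ((2 - \<alpha>) / 2) ((\<alpha> - 1) / 2)"
    have \<delta>: "0 < \<delta>" "\<delta> < \<alpha>" "\<alpha> + \<delta> < 2" "1 < \<alpha> - \<delta>" using 3 index_lt_2 by (auto simp: \<delta>_def min_def field_simps)
    have \<gamma>m: "(indicator {a<..} :: real \<Rightarrow> real) \<in> borel_measurable borel" by measurable
    have int: "set_integrable lborel {0<..} (\<lambda>r. potter_envelope \<alpha> \<delta> r * norm (indicator {a<..} r :: real))"
    proof (rule set_integrable_envelope[where p = 1 and q = 0 and D = "max 1 (1 / a)"])
      fix r :: real assume r: "0 < r" "r \<le> 1"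
      show "\<bar>norm (indicator {a<..} r :: real)\<bar> \<le> max 1 (1 / a) * r powr 1"
      proof (cases "a < r")
        case True
        have "1 \<le> 1 / a * r" using True a by (simp add: field_simps)
        also have "\<dots> \<le> max 1 (1 / a) * r" using r by (intro mult_right_mono) auto
        finally show ?thesis using True r by simp
      qed simp
    qed (use \<delta> in \<open>auto simp: indicator_def\<close>)
    note lim = pareto_tails_integral[OF prob_space_axioms Zm \<gamma>m index_pos pareto_tails_X \<delta>(1,2) int,
        unfolded set_integral_indicator_Ioi[OF a] real_scaleR_def]
    show ?thesis
    proof (rule bounded[OF lim(2)])
      show "\<forall>\<^sub>F n in sequentially. \<bar>expectation (\<lambda>\<omega>. truncation a (X 1 \<omega> / B n))\<bar> \<le>
          expectation (\<lambda>\<omega>. max (\<bar>X 1 \<omega>\<bar> / B n - a) 0)"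
        using lim(1) eventually_norming_pos
      proof eventually_elim
        case (elim n)
        have iX: "integrable M (\<lambda>\<omega>. X 1 \<omega> / B n)" using centred(1)[OF 3] by simp
        have "expectation (\<lambda>\<omega>. truncation a (X 1 \<omega> / B n)) = expectation (\<lambda>\<omega>. truncation a (X 1 \<omega> / B n) - X 1 \<omega> / B n)"
          using centred(2)[OF 3] by (subst Bochner_Integration.integral_diff[OF tr_int iX]) simp
        then have "\<bar>expectation (\<lambda>\<omega>. truncation a (X 1 \<omega> / B n))\<bar> \<le> expectation (\<lambda>\<omega>. \<bar>truncation a (X 1 \<omega> / B n) - X 1 \<omega> / B n\<bar>)"
          by (simp only: integral_abs_bound)
        also have "\<dots> = expectation (\<lambda>\<omega>. max (\<bar>X 1 \<omega>\<bar> / B n - a) 0)"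
        proof (intro Bochner_Integration.integral_cong refl)
          fix \<omega>
          have "\<bar>truncation a z - z\<bar> = max (\<bar>z\<bar> - a) 0" for z using a by (auto simp: truncation_def)
          then show "\<bar>truncation a (X 1 \<omega> / B n) - X 1 \<omega> / B n\<bar> = max (\<bar>X 1 \<omega>\<bar> / B n - a) 0"
            using elim by (simp add: abs_divide)
        qed
        finally show ?case .
      qed
    qed
  qed
qed

lemma integral_pair_levy_measure:
  fixes f :: "real \<Rightarrow> real \<Rightarrow> real"
  assumes m: "sets m = sets (\<Pi>\<^sub>M i\<in>{1..j}. borel)" and j: "1 \<le> j"
    and f: "(\<lambda>(x, y). f x y) \<in> borel_measurable borel" and f0: "f 0 0 = 0"
  shows "(LINT (x, y)|pair_levy_measure j m. f x y) = (LINT x|m. f (x 1) (x j))"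
proof -
  have pm: "(\<lambda>x. (x 1, x j)) \<in> measurable m borel"
    unfolding borel_prod[symmetric] measurable_cong_sets[OF m refl]
    by (intro measurable_Pair measurable_component_singleton) (use j in auto)
  have "(LINT z|pair_levy_measure j m. (\<lambda>(x, y). f x y) z) =
      (LINT z|distr m borel (\<lambda>x. (x 1, x j)). indicator (- {(0, 0)}) z *\<^sub>R (\<lambda>(x, y). f x y) z)"
    unfolding pair_levy_measure_def by (subst integral_restrict_space) auto
  also have "\<dots> = (LINT z|distr m borel (\<lambda>x. (x 1, x j)). (\<lambda>(x, y). f x y) z)"
    by (intro Bochner_Integration.integral_cong refl) (auto simp: indicator_def f0)
  also have "\<dots> = (LINT x|m. f (x 1) (x j))"
    by (subst integral_distr[OF pm f]) simp
  finally show ?thesis by simp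
qed

lemma truncation_continuous: "0 < a \<Longrightarrow> continuous_on S (truncation a)"
proof -
  assume "0 < a"
  then have "truncation a = (\<lambda>x. max (- a) (min a x))" by (auto simp: truncation_eq_clamp)
  then show "continuous_on S (truncation a)" by (simp add: continuous_intros)
qed

lemma truncation_truncation: "0 < a \<Longrightarrow> a \<le> b \<Longrightarrow> truncation a (truncation b x) = truncation a x"
  by (auto simp: truncation_def)

text \<open>
  The product \<open>f\<^sub>1(x) f\<^sub>1(y)\<close> does not vanish near the origin. Subtracting
  \<open>f\<^sub>\<epsilon>(x) f\<^sub>\<epsilon>(y)\<close> gives an admissible test function, and the subtracted part is controlled by
  \<open>truncated_variance \<epsilon>\<close>, which is small. The product of the means is of order
  \<open>1 / n\<^sup>2\<close> and does not survive multiplication by \<open>n\<close>.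
\<close>

lemma pair_covariance_limit:
  assumes j: "2 \<le> j"
  shows "(\<lambda>n. real n * covariance M (\<lambda>\<omega>. truncation 1 (X 1 \<omega> / B n)) (\<lambda>\<omega>. truncation 1 (X j \<omega> / B n))) \<longlonglongrightarrow>
    (LINT (x, y)|pair_levy_measure j (\<nu> j). truncation 1 x * truncation 1 y)"
proof -
  have j1: "1 \<le> j" using j by simp
  note [measurable] = X_meas[OF j1]
  define \<nu>' where "\<nu>' = \<nu> j"
  have \<nu>_sets: "sets \<nu>' = sets (\<Pi>\<^sub>M i\<in>{1..j}. borel)" and \<nu>_levy: "(\<integral>\<^sup>+ x. ennreal (min 1 (\<Sum>i\<in>{1..j}. (x i)\<^sup>2)) \<partial>\<nu>') < \<infinity>"
    using levy[OF j1] by (auto simp: levy_measure_def \<nu>'_def)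
  have comp: "(\<lambda>x. x i) \<in> borel_measurable \<nu>'" if "i \<in> {1..j}" for i
    unfolding measurable_cong_sets[OF \<nu>_sets refl] using that by measurable
  have comp1 [measurable]: "(\<lambda>x. x 1) \<in> borel_measurable \<nu>'" "(\<lambda>x. x (Suc 0)) \<in> borel_measurable \<nu>'" "(\<lambda>x. x j) \<in> borel_measurable \<nu>'"
    using comp j by auto
  define \<epsilon> where "\<epsilon> = (\<lambda>k. 1 / real (Suc k))"
  have \<epsilon>: "0 < \<epsilon> k" "\<epsilon> k \<le> 1" for k by (auto simp: \<epsilon>_def)
  define P where "P = (\<lambda>e x y. truncation e x * truncation e y)"
  define s where "s = (\<lambda>x. min 1 (\<Sum>i\<in>{1..j}. (x i)\<^sup>2) :: real)"
  have s_meas [measurable]: "s \<in> borel_measurable \<nu>'"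
    unfolding s_def by (intro borel_measurable_min borel_measurable_const borel_measurable_sum borel_measurable_power comp)
  have s0: "0 \<le> s x" for x by (auto simp: s_def intro: sum_nonneg)
  have s_int: "integrable \<nu>' s"
    by (rule integrableI_nonneg[OF s_meas]) (use s0 \<nu>_levy in \<open>auto simp: s_def\<close>)
  have P_le: "\<bar>P e (x 1) (x j)\<bar> \<le> s x" if e: "0 < e" "e \<le> 1" for e x
  proof -
    have "\<bar>P e (x 1) (x j)\<bar> \<le> \<bar>truncation 1 (x 1)\<bar> * \<bar>truncation 1 (x j)\<bar>"
      unfolding P_def abs_mult using e by (intro mult_mono) (auto simp: abs_truncation)
    also have "\<dots> \<le> ((truncation 1 (x 1))\<^sup>2 + (truncation 1 (x j))\<^sup>2) / 2"
      using sum_squares_bound[of "\<bar>truncation 1 (x 1)\<bar>" "\<bar>truncation 1 (x j)\<bar>"] by simp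
    also have "\<dots> \<le> s x"
    proof -
      have t: "(truncation 1 (x i))\<^sup>2 \<le> s x" if i: "i \<in> {1..j}" for i
      proof -
        have "(truncation 1 (x i))\<^sup>2 \<le> 1\<^sup>2" using abs_truncation_le[of 1 "x i"] by (intro abs_le_square_iff[THEN iffD1]) auto
        moreover have "(truncation 1 (x i))\<^sup>2 \<le> (x i)\<^sup>2" using abs_truncation_le_abs[of 1 "x i"] by (intro abs_le_square_iff[THEN iffD1]) auto
        moreover have "(x i)\<^sup>2 \<le> (\<Sum>i\<in>{1..j}. (x i)\<^sup>2)" using i by (intro member_le_sum) auto
        ultimately show ?thesis by (simp add: s_def)
      qed
      show ?thesis using t[of 1] t[of j] j by simp
    qed
    finally show ?thesis .
  qed
  have P_meas [measurable]: "(\<lambda>x. P e (x 1) (x j)) \<in> borel_measurable \<nu>'" for e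
    unfolding P_def by measurable
  have P_int: "integrable \<nu>' (\<lambda>x. P e (x 1) (x j))" if "0 < e" "e \<le> 1" for e
    by (rule Bochner_Integration.integrable_bound[OF s_int P_meas]) (use P_le[OF that] s0 in auto)
  define I where "I = (LINT x|\<nu>'. P 1 (x 1) (x j))"
  have target: "(LINT (x, y)|pair_levy_measure j (\<nu> j). truncation 1 x * truncation 1 y) = I"
    unfolding I_def P_def \<nu>'_def[symmetric]
  proof (rule integral_pair_levy_measure[OF \<nu>_sets j1])
    show "(\<lambda>(x, y). truncation 1 x * truncation 1 y) \<in> borel_measurable borel"
      unfolding borel_prod[symmetric] by measurable
  qed (simp add: truncation_def)
  define \<beta> where "\<beta> = (\<lambda>k. LINT x|\<nu>'. P 1 (x 1) (x j) - P (\<epsilon> k) (x 1) (x j))"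
  have \<beta>: "\<beta> \<longlonglongrightarrow> I"
  proof -
    have lim0: "(\<lambda>k. LINT x|\<nu>'. P (\<epsilon> k) (x 1) (x j)) \<longlonglongrightarrow> (LINT x|\<nu>'. 0)"
    proof (rule integral_dominated_convergence[OF _ _ s_int])
      show "AE x in \<nu>'. (\<lambda>k. P (\<epsilon> k) (x 1) (x j)) \<longlonglongrightarrow> 0"
      proof (intro AE_I2)
        fix x :: "nat \<Rightarrow> real"
        have e0: "\<epsilon> \<longlonglongrightarrow> 0" unfolding \<epsilon>_def by (rule LIMSEQ_Suc[OF lim_1_over_n])
        have "(\<lambda>k. truncation (\<epsilon> k) y) \<longlonglongrightarrow> 0" for y
          by (rule Lim_null_comparison[OF _ e0]) (use abs_truncation_le[OF \<epsilon>(1)] in simp)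
        from tendsto_mult[OF this this] show "(\<lambda>k. P (\<epsilon> k) (x 1) (x j)) \<longlonglongrightarrow> 0" by (simp add: P_def)
      qed
      show "AE x in \<nu>'. norm (P (\<epsilon> k) (x 1) (x j)) \<le> s x" for k using P_le[OF \<epsilon>] by auto
    qed measurable
    have eq: "\<beta> = (\<lambda>k. I - (LINT x|\<nu>'. P (\<epsilon> k) (x 1) (x j)))"
      unfolding \<beta>_def I_def by (intro ext Bochner_Integration.integral_diff P_int \<epsilon>) auto
    show ?thesis
      using tendsto_diff[OF tendsto_const[of I] lim0] unfolding eq by simp
  qed
  define f where "f = (\<lambda>e n i \<omega>. truncation e (X i \<omega> / B n))"
  have f_meas [measurable]: "f e n 1 \<in> borel_measurable M" "f e n (Suc 0) \<in> borel_measurable M" "f e n j \<in> borel_measurable M" for e n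
    unfolding f_def by measurable
  have f_bd: "bounded_rv M (f e n 1)" "bounded_rv M (f e n j)" if "0 < e" for e n
  proof -
    show "bounded_rv M (f e n 1)"
      by (rule bounded_rvI[OF f_meas(1), where C = e]) (simp add: f_def abs_truncation_le[OF that])
    show "bounded_rv M (f e n j)"
      by (rule bounded_rvI[OF f_meas(3), where C = e]) (simp add: f_def abs_truncation_le[OF that])
  qed
  define b where "b = (\<lambda>k n. real n * expectation (\<lambda>\<omega>. f 1 n 1 \<omega> * f 1 n j \<omega> - f (\<epsilon> k) n 1 \<omega> * f (\<epsilon> k) n j \<omega>))"
  have b_lim: "b k \<longlonglongrightarrow> \<beta> k" for k
  proof -
    define G where "G = (\<lambda>x. P 1 (x 1) (x j) - P (\<epsilon> k) (x 1) (x j))"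
    have "(\<lambda>n. real n * (LINT \<omega>|M. G (\<lambda>i\<in>{1..j}. truncation 1 (X i \<omega> / B n)))) \<longlonglongrightarrow> (LINT x|\<nu> j. G (\<lambda>i\<in>{1..j}. truncation 1 (x i)))"
    proof (rule vague_limit_clamped[OF vague[OF j1]])
      have "G \<in> borel_measurable \<nu>'"
        unfolding G_def by (intro borel_measurable_diff P_meas)
      then show "G \<in> borel_measurable (\<Pi>\<^sub>M i\<in>{1..j}. borel)"
        unfolding measurable_cong_sets[OF \<nu>_sets refl] .
      have cp: "continuous_map (product_topology (\<lambda>_. euclideanreal) {1..j}) euclideanreal (\<lambda>x. truncation e (x i))"
        if "0 < e" "i \<in> {1..j}" for e i
      proof -
        have "continuous_map (product_topology (\<lambda>_. euclideanreal) {1..j}) euclideanreal (truncation e \<circ> (\<lambda>x. x i))"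
          using truncation_continuous[OF that(1)] that(2)
          by (intro continuous_map_compose[of _ euclidean] continuous_map_product_projection) auto
        then show ?thesis by (simp add: o_def)
      qed
      show "continuous_map (product_topology (\<lambda>_. euclideanreal) {1..j}) euclideanreal G"
        unfolding G_def P_def using \<epsilon>[of k] j
        by (intro continuous_map_diff continuous_map_real_mult cp) auto
      show "G x = 0" if "\<And>i. i \<in> {1..j} \<Longrightarrow> \<bar>x i\<bar> \<le> \<epsilon> k" for x
      proof -
        have "\<bar>x 1\<bar> \<le> \<epsilon> k" "\<bar>x j\<bar> \<le> \<epsilon> k" using that[of 1] that[of j] j by auto
        moreover from this have "\<bar>x 1\<bar> \<le> 1" "\<bar>x j\<bar> \<le> 1" using \<epsilon>(2)[of k] by linarith+
        ultimately show ?thesis by (simp add: G_def P_def truncation_id)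
      qed
    qed (use \<nu>_sets X_meas \<epsilon> in \<open>auto simp: \<nu>'_def\<close>)
    then show ?thesis
      using j \<epsilon>[of k] unfolding G_def P_def b_def \<beta>_def f_def \<nu>'_def[symmetric]
      by (simp add: truncation_truncation)
  qed
  obtain C where C: "\<forall>\<^sub>F n in sequentially. \<bar>real n * expectation (f 1 n 1)\<bar> \<le> C"
    using truncated_mean_bounded[of 1] unfolding f_def by auto
  \<comment> \<open>\<open>a\<close> is approximated by \<open>b k\<close> within \<open>e k\<close>, uniformly for large \<open>n\<close>.\<close>
  define a where "a = (\<lambda>n. real n * covariance M (f 1 n 1) (f 1 n j))"
  define e where "e = (\<lambda>k. truncated_variance (\<epsilon> k) + 2 * \<epsilon> k)"
  have e0: "e \<longlonglongrightarrow> 0"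
  proof -
    have "e \<longlonglongrightarrow> 0 + 2 * 0"
      unfolding e_def \<epsilon>_def by (intro tendsto_add tendsto_mult tendsto_const truncated_variance_small LIMSEQ_Suc[OF lim_1_over_n])
    then show ?thesis by simp
  qed
  have shift: "expectation (\<lambda>\<omega>. g (X j \<omega>)) = expectation (\<lambda>\<omega>. g (X 1 \<omega>))"
    if [measurable]: "g \<in> borel_measurable borel" for g :: "real \<Rightarrow> real"
    by (rule expectation_shift1[OF that j1])
  have near: "\<forall>\<^sub>F n in sequentially. dist (a n) (b k n) \<le> e k" for k
  proof -
    have 1: "\<forall>\<^sub>F n in sequentially. real n * expectation (\<lambda>\<omega>. (f (\<epsilon> k) n 1 \<omega>)\<^sup>2) < truncated_variance (\<epsilon> k) + \<epsilon> k"
      unfolding f_def by (rule order_tendstoD(2)[OF truncated_second_moment]) (use \<epsilon>[of k] in auto)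
    have "(\<lambda>n. C\<^sup>2 * (1 / real n)) \<longlonglongrightarrow> C\<^sup>2 * 0" by (intro tendsto_mult tendsto_const lim_1_over_n)
    then have 2: "\<forall>\<^sub>F n in sequentially. C\<^sup>2 * (1 / real n) < \<epsilon> k"
      by (rule order_tendstoD(2)) (use \<epsilon>[of k] in simp)
    show ?thesis
      using 1 2 C eventually_gt_at_top[of 0]
    proof eventually_elim
      case (elim n)
      have bm: "bounded_rv M (\<lambda>\<omega>. f d n 1 \<omega> * f d n j \<omega>)" if "0 < d" for d
        by (intro bounded_rv_mult f_bd that)
      note bi = bounded_rv_integrable[OF bm]
      have Ej: "expectation (f 1 n j) = expectation (f 1 n 1)"
        unfolding f_def by (rule shift) measurable
      have "a n - b k n = real n * expectation (\<lambda>\<omega>. f (\<epsilon> k) n 1 \<omega> * f (\<epsilon> k) n j \<omega>) - real n * (expectation (f 1 n 1))\<^sup>2"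
        unfolding a_def b_def covariance_bounded[OF f_bd[OF zero_less_one]] Ej
        using bi[OF zero_less_one] bi[OF \<epsilon>(1)[of k]] by (simp add: algebra_simps power2_eq_square)
      also have "\<bar>\<dots>\<bar> \<le> real n * expectation (\<lambda>\<omega>. (f (\<epsilon> k) n 1 \<omega>)\<^sup>2) + C\<^sup>2 * (1 / real n)"
      proof -
        have sq: "bounded_rv M (\<lambda>\<omega>. (f (\<epsilon> k) n 1 \<omega>)\<^sup>2)" "bounded_rv M (\<lambda>\<omega>. (f (\<epsilon> k) n j \<omega>)\<^sup>2)"
          unfolding power2_eq_square by (intro bounded_rv_mult f_bd \<epsilon>)+
        have "\<bar>expectation (\<lambda>\<omega>. f (\<epsilon> k) n 1 \<omega> * f (\<epsilon> k) n j \<omega>)\<bar> \<le> expectation (\<lambda>\<omega>. \<bar>f (\<epsilon> k) n 1 \<omega> * f (\<epsilon> k) n j \<omega>\<bar>)"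
          by (rule integral_abs_bound)
        also have "\<dots> \<le> expectation (\<lambda>\<omega>. ((f (\<epsilon> k) n 1 \<omega>)\<^sup>2 + (f (\<epsilon> k) n j \<omega>)\<^sup>2) / 2)"
        proof (rule integral_mono)
          fix \<omega>
          show "\<bar>f (\<epsilon> k) n 1 \<omega> * f (\<epsilon> k) n j \<omega>\<bar> \<le> ((f (\<epsilon> k) n 1 \<omega>)\<^sup>2 + (f (\<epsilon> k) n j \<omega>)\<^sup>2) / 2"
            using sum_squares_bound[of "\<bar>f (\<epsilon> k) n 1 \<omega>\<bar>" "\<bar>f (\<epsilon> k) n j \<omega>\<bar>"] by (simp add: abs_mult)
        qed (use bi[OF \<epsilon>(1)[of k]] bounded_rv_integrable[OF sq(1)] bounded_rv_integrable[OF sq(2)] in \<open>auto intro!: integrable_abs\<close>)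
        also have "\<dots> = (expectation (\<lambda>\<omega>. (f (\<epsilon> k) n 1 \<omega>)\<^sup>2) + expectation (\<lambda>\<omega>. (f (\<epsilon> k) n j \<omega>)\<^sup>2)) / 2"
          using bounded_rv_integrable[OF sq(1)] bounded_rv_integrable[OF sq(2)] by simp
        also have "expectation (\<lambda>\<omega>. (f (\<epsilon> k) n j \<omega>)\<^sup>2) = expectation (\<lambda>\<omega>. (f (\<epsilon> k) n 1 \<omega>)\<^sup>2)"
          unfolding f_def by (rule shift[of "\<lambda>x. (truncation (\<epsilon> k) (x / B n))\<^sup>2"]) measurable
        finally have "\<bar>expectation (\<lambda>\<omega>. f (\<epsilon> k) n 1 \<omega> * f (\<epsilon> k) n j \<omega>)\<bar> \<le> expectation (\<lambda>\<omega>. (f (\<epsilon> k) n 1 \<omega>)\<^sup>2)" by simp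
        then have "\<bar>real n * expectation (\<lambda>\<omega>. f (\<epsilon> k) n 1 \<omega> * f (\<epsilon> k) n j \<omega>)\<bar> \<le> real n * expectation (\<lambda>\<omega>. (f (\<epsilon> k) n 1 \<omega>)\<^sup>2)"
          unfolding abs_mult by (simp add: mult_left_mono)
        moreover have "\<bar>real n * (expectation (f 1 n 1))\<^sup>2\<bar> \<le> C\<^sup>2 * (1 / real n)"
        proof -
          have "\<bar>real n * expectation (f 1 n 1)\<bar>\<^sup>2 \<le> C\<^sup>2" using elim(3) by (intro power_mono) auto
          then show ?thesis using elim(4) by (simp add: power_mult_distrib power2_eq_square field_simps)
        qed
        ultimately show ?thesis by linarith
      qed
      finally show ?case using elim(1,2) by (simp add: dist_real_def e_def)
    qed
  qed
  have "a \<longlonglongrightarrow> I" by (rule tendsto_of_approximations[OF b_lim \<beta> near e0])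
  then show ?thesis unfolding target a_def f_def by simp
qed

end

section \<open>Asymptotic independence of blocks\<close>

lemma tendsto_div_ratio:
  assumes m: "0 < m" shows "(\<lambda>n. real (n div m) / real n) \<longlonglongrightarrow> 1 / real m"
proof (rule tendsto_sandwich[OF _ _ _ tendsto_const])
  show "(\<lambda>n. 1 / real m - 1 / real n) \<longlonglongrightarrow> 1 / real m"
    using tendsto_diff[OF tendsto_const[of "1 / real m"] lim_1_over_n] by simp
  show "\<forall>\<^sub>F n in sequentially. 1 / real m - 1 / real n \<le> real (n div m) / real n"
    using eventually_gt_at_top[of 0]
  proof eventually_elim
    case (elim n)
    have "n \<le> (n div m) * m + m"
      using div_mult_mod_eq[of n m] mod_less_divisor[OF m, of n] by linarith
    then have "real n \<le> real ((n div m) * m + m)" by (simp only: of_nat_le_iff)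
    then have "real n / real m \<le> real (n div m) + 1" using m by (simp add: pos_divide_le_eq distrib_right)
    then have "(real n / real m - 1) / real n \<le> real (n div m) / real n" by (intro divide_right_mono) auto
    then show ?case using elim by (simp add: diff_divide_distrib)
  qed
  show "\<forall>\<^sub>F n in sequentially. real (n div m) / real n \<le> 1 / real m"
    using eventually_gt_at_top[of 0]
  proof eventually_elim
    case (elim n)
    have "real ((n div m) * m) \<le> real n" by (simp only: of_nat_le_iff div_times_less_eq_dividend)
    then show ?case using elim m by (simp add: field_simps)
  qed
qed

text \<open>
  The bound \<open>norm (w n) \<le> 1\<close> forces \<open>Re z \<le> 0\<close>; hence \<open>exp (z / n)\<close> also lies in the unit
  disc, where powers differ by at most the exponent times the difference of the bases.
\<close>

lemma power_tendsto_exp: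
  fixes w :: "nat \<Rightarrow> complex"
  assumes w1: "\<And>n. norm (w n) \<le> 1"
    and z: "(\<lambda>n. real n *\<^sub>R (w n - 1)) \<longlonglongrightarrow> z"
    and q: "(\<lambda>n. real (k n) / real n) \<longlonglongrightarrow> q"
  shows "(\<lambda>n. w n ^ k n) \<longlonglongrightarrow> exp (of_real q * z)"
proof -
  have Re_z: "Re z \<le> 0"
  proof (rule tendsto_upperbound[OF tendsto_Re[OF z]])
    have "Re (w n) \<le> 1" for n using complex_Re_le_cmod[of "w n"] w1[of n] by linarith
    then show "\<forall>\<^sub>F n in sequentially. Re (real n *\<^sub>R (w n - 1)) \<le> 0"
      by (intro always_eventually allI) (simp add: mult_le_0_iff)
  qed simp
  define v where "v = (\<lambda>n. exp (z / of_nat n))"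
  have v1: "norm (v n) \<le> 1" for n
    using Re_z by (simp add: v_def divide_le_0_iff)
  have v_lim: "(\<lambda>n. real n *\<^sub>R (v n - 1)) \<longlonglongrightarrow> z"
  proof -
    have "((\<lambda>h. exp (h * z)) has_field_derivative z) (at 0)"
      by (auto intro!: derivative_eq_intros)
    then have "((\<lambda>h. (exp (h * z) - 1) / h) \<longlongrightarrow> z) (at 0)"
      by (simp add: has_field_derivative_iff)
    moreover have "filterlim (\<lambda>n. complex_of_real (1 / real n)) (at 0) sequentially"
      unfolding filterlim_at
    proof
      have "(\<lambda>n. complex_of_real (1 / real n)) \<longlonglongrightarrow> of_real 0"
        by (intro tendsto_of_real lim_1_over_n)
      then show "(\<lambda>n. complex_of_real (1 / real n)) \<longlonglongrightarrow> 0" by simp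
      show "\<forall>\<^sub>F n in sequentially. complex_of_real (1 / real n) \<in> UNIV \<and> complex_of_real (1 / real n) \<noteq> 0"
        using eventually_gt_at_top[of 0] by eventually_elim auto
    qed
    ultimately have "(\<lambda>n. (exp (complex_of_real (1 / real n) * z) - 1) / complex_of_real (1 / real n)) \<longlonglongrightarrow> z"
      by (rule filterlim_compose)
    moreover have "(exp (complex_of_real (1 / real n) * z) - 1) / complex_of_real (1 / real n) = real n *\<^sub>R (v n - 1)" for n
      by (simp add: v_def scaleR_conv_of_real mult.commute)
    ultimately show ?thesis by simp
  qed
  have diff: "(\<lambda>n. w n ^ k n - v n ^ k n) \<longlonglongrightarrow> 0"
  proof (rule Lim_null_comparison)
    have "(\<lambda>n. real (k n) / real n * norm (real n *\<^sub>R (w n - 1) - real n *\<^sub>R (v n - 1))) \<longlonglongrightarrow> q * norm (z - z)"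
      by (intro tendsto_mult q tendsto_norm tendsto_diff z v_lim)
    then show "(\<lambda>n. real (k n) / real n * norm (real n *\<^sub>R (w n - 1) - real n *\<^sub>R (v n - 1))) \<longlonglongrightarrow> 0" by simp
    show "\<forall>\<^sub>F n in sequentially. norm (w n ^ k n - v n ^ k n) \<le> real (k n) / real n * norm (real n *\<^sub>R (w n - 1) - real n *\<^sub>R (v n - 1))"
      using eventually_gt_at_top[of 0]
    proof eventually_elim
      case (elim n)
      have "norm (real n *\<^sub>R (w n - 1) - real n *\<^sub>R (v n - 1)) = real n * norm (w n - v n)"
        by (simp add: scaleR_diff_right[symmetric])
      then show ?case using norm_power_diff[OF w1[of n] v1[of n], of "k n"] elim by simp
    qed
  qed
  have "(\<lambda>n. exp (of_real (real (k n) / real n) * z)) \<longlonglongrightarrow> exp (of_real q * z)"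
    by (intro tendsto_exp tendsto_mult tendsto_of_real q tendsto_const)
  moreover have "exp (of_real (real (k n) / real n) * z) = v n ^ k n" for n
    by (simp add: v_def exp_of_nat_mult[symmetric])
  ultimately have "(\<lambda>n. v n ^ k n) \<longlonglongrightarrow> exp (of_real q * z)" by simp
  from tendsto_add[OF diff this] show ?thesis by simp
qed

lemma (in prob_space) integrable_iexp:
  "Y \<in> borel_measurable M \<Longrightarrow> integrable M (\<lambda>\<omega>. iexp (Y \<omega>))"
  by (rule integrable_const_bound[of _ 1]) auto

lemma norm_iexp_sum_minus_1:
  "norm (iexp (\<Sum>i\<in>I. f i) - 1) \<le> (\<Sum>i\<in>I. norm (iexp (f i) - 1))"
proof (induction I rule: infinite_finite_induct)
  case (insert i I)
  have "iexp (\<Sum>i\<in>insert i I. f i) - 1 = iexp (f i) * (iexp (\<Sum>i\<in>I. f i) - 1) + (iexp (f i) - 1)"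
    using insert by (simp add: distrib_left exp_add right_diff_distrib)
  also have "norm \<dots> \<le> norm (iexp (f i)) * norm (iexp (\<Sum>i\<in>I. f i) - 1) + norm (iexp (f i) - 1)"
    by (rule order_trans[OF norm_triangle_ineq]) (simp add: norm_mult)
  finally show ?case using insert by simp
qed auto

lemma tight_of_eventually_bounded:
  assumes \<mu>: "\<And>n. real_distribution (\<mu> n)"
    and ev: "\<And>\<epsilon>. 0 < \<epsilon> \<Longrightarrow> \<exists>K. \<forall>\<^sub>F n in sequentially. measure (\<mu> n) {- K<..K} > 1 - \<epsilon>"
  shows "tight \<mu>"
  unfolding tight_def
proof (intro conjI allI impI \<mu>)
  fix \<epsilon> :: real assume \<epsilon>: "0 < \<epsilon>"
  have one: "\<exists>K. measure (\<mu> n) {- K<..K} > 1 - \<epsilon>" for n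
  proof -
    interpret real_distribution "\<mu> n" by (rule \<mu>)
    have "((\<lambda>K. cdf (\<mu> n) K - cdf (\<mu> n) (- K)) \<longlongrightarrow> 1 - 0) at_top"
      by (intro tendsto_diff cdf_lim_at_top_prob filterlim_compose[OF cdf_lim_at_bot] filterlim_uminus_at_bot_at_top)
    then have "\<forall>\<^sub>F K in at_top. 1 - \<epsilon> < cdf (\<mu> n) K - cdf (\<mu> n) (- K)"
      using \<epsilon> by (intro order_tendstoD(1)) auto
    then have "\<forall>\<^sub>F K in at_top. 1 - \<epsilon> < cdf (\<mu> n) K - cdf (\<mu> n) (- K) \<and> 0 < K"
      using eventually_gt_at_top[of 0] by (rule eventually_conj)
    then obtain K where K: "1 - \<epsilon> < cdf (\<mu> n) K - cdf (\<mu> n) (- K)" "0 < K"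
      unfolding eventually_at_top_linorder by blast
    then show ?thesis using cdf_diff_eq[of "- K" K] by auto
  qed
  then obtain K0 where K0: "\<And>n. measure (\<mu> n) {- K0 n<..K0 n} > 1 - \<epsilon>" by metis
  obtain K1 N where K1: "\<And>n. N \<le> n \<Longrightarrow> measure (\<mu> n) {- K1<..K1} > 1 - \<epsilon>"
    using ev[OF \<epsilon>] unfolding eventually_sequentially by blast
  define K where "K = Max (insert 1 (insert K1 (K0 ` {..<N})))"
  have K: "1 \<le> K" "K1 \<le> K" "\<And>n. n < N \<Longrightarrow> K0 n \<le> K"
    unfolding K_def by (rule Max_ge; simp)+
  have "measure (\<mu> n) {- K<..K} > 1 - \<epsilon>" for n
  proof -
    interpret real_distribution "\<mu> n" by (rule \<mu>)
    obtain K' where K': "K' \<le> K" "measure (\<mu> n) {- K'<..K'} > 1 - \<epsilon>"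
      using K K0[of n] K1[of n] by (cases "n < N") auto
    have "measure (\<mu> n) {- K'<..K'} \<le> measure (\<mu> n) {- K<..K}"
      using K'(1) by (intro finite_measure_mono) auto
    with K'(2) show ?thesis by linarith
  qed
  moreover have "- K < K" using K(1) by simp
  ultimately show "\<exists>a b. a < b \<and> (\<forall>n. 1 - \<epsilon> < measure (\<mu> n) {a<..b})" by blast
qed

text \<open>
  Adds association and the convergence of the total covariance at truncation level \<open>B n\<close>.
\<close>

locale associated_heavy_tailed_sequence =
  heavy_tailed_sequence M X \<alpha> B \<nu> + associated_sequence M X
  for M :: "'a measure" and X :: "nat \<Rightarrow> 'a \<Rightarrow> real" and \<alpha> :: real and B :: "nat \<Rightarrow> real"
    and \<nu> :: "nat \<Rightarrow> (nat \<Rightarrow> real) measure" +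
  assumes summable_cov: "0 < a \<Longrightarrow> summable (\<lambda>j. lag_cov (truncation a) (j + 1))"
    and summable_levy: "summable (\<lambda>j. LINT (x, y)|pair_levy_measure (j + 2) (\<nu> (j + 2)). truncation 1 x * truncation 1 y)"
    and cov_limit: "(\<lambda>n. real n * (\<Sum>j. lag_cov (\<lambda>x. truncation 1 (x / B n)) (j + 1))) \<longlonglongrightarrow>
       (\<Sum>j. LINT (x, y)|pair_levy_measure (j + 2) (\<nu> (j + 2)). truncation 1 x * truncation 1 y)"
begin

text \<open>
  Indexed by the lag: the pair consisting of \<open>X 1\<close> and \<open>X j\<close> has lag \<open>j - 1\<close>.
\<close>

definition levy_cov :: "nat \<Rightarrow> real" where
  "levy_cov d = (LINT (x, y)|pair_levy_measure (d + 1) (\<nu> (d + 1)). truncation 1 x * truncation 1 y)"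

definition levy_tail :: "nat \<Rightarrow> real" where
  "levy_tail p = (\<Sum>j. levy_cov (j + p))"

definition trunc :: "real \<Rightarrow> nat \<Rightarrow> real \<Rightarrow> real" where
  "trunc a n x = truncation a (x / B n)"

lemma mono_truncation: "0 < a \<Longrightarrow> mono (truncation a)"
  by (auto intro: monoI truncation_mono)

lemma mono_trunc: "0 < a \<Longrightarrow> 1 \<le> n \<Longrightarrow> mono (trunc a n)"
  unfolding trunc_def using norming_pos[of n]
  by (intro monoI truncation_mono) (auto intro: divide_right_mono)

lemma abs_trunc_le: "0 < a \<Longrightarrow> \<bar>trunc a n x\<bar> \<le> a"
  by (simp add: trunc_def abs_truncation_le)

lemma trunc_measurable [measurable]: "trunc a n \<in> borel_measurable borel"
  unfolding trunc_def by measurable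

lemma lag_cov_trunc:
  assumes a: "0 < a" and n: "1 \<le> n"
  shows "lag_cov (trunc a n) d = lag_cov (truncation (a * B n)) d / (B n)\<^sup>2"
proof -
  have Bn: "0 < B n" by (rule norming_pos[OF n])
  have ab: "0 < a * B n" using a Bn by simp
  have eq: "trunc a n x = (1 / B n) * truncation (a * B n) x" for x
    unfolding trunc_def using truncation_scale[OF a Bn] by simp
  note b = bounded_rv_X[OF mono_truncation[OF ab] abs_truncation_le[OF ab]]
  have scale: "covariance M (\<lambda>\<omega>. c * U \<omega>) (\<lambda>\<omega>. c * V \<omega>) = c * (c * covariance M U V)"
    if "bounded_rv M U" "bounded_rv M V" for c U V
    using that by (simp add: covariance_cmult_left covariance_cmult_right bounded_rv_cmult)
  have "lag_cov (trunc a n) d = 1 / B n * (1 / B n * lag_cov (truncation (a * B n)) d)"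
    unfolding lag_cov_def eq by (rule scale; rule b) auto
  then show ?thesis by (simp add: power2_eq_square)
qed

lemma cov_tail_trunc:
  assumes a: "0 < a" and n: "1 \<le> n" and p: "1 \<le> p"
  shows "summable (\<lambda>j. lag_cov (trunc a n) (j + 1))"
    and "cov_tail (trunc a n) p = cov_tail (truncation (a * B n)) p / (B n)\<^sup>2"
proof -
  have ab: "0 < a * B n" using a norming_pos[OF n] by simp
  show "summable (\<lambda>j. lag_cov (trunc a n) (j + 1))"
    unfolding lag_cov_trunc[OF a n] by (intro summable_divide summable_cov ab)
  have "summable (\<lambda>j. lag_cov (truncation (a * B n)) (j + p))"
    by (rule summable_lag_cov_shift[OF mono_truncation[OF ab] abs_truncation_le[OF ab] summable_cov[OF ab] p])
  then show "cov_tail (trunc a n) p = cov_tail (truncation (a * B n)) p / (B n)\<^sup>2"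
    unfolding cov_tail_def lag_cov_trunc[OF a n] by (rule suminf_divide)
qed

lemma cov_tail_trunc_nonneg: "0 < a \<Longrightarrow> 1 \<le> n \<Longrightarrow> 1 \<le> p \<Longrightarrow> 0 \<le> cov_tail (trunc a n) p"
  by (rule cov_tail_nonneg[OF mono_trunc abs_trunc_le cov_tail_trunc(1)])

text \<open>
  The total converges by assumption and each single lag by \<open>pair_covariance_limit\<close>; a tail
  differs from the total by finitely many lags.
\<close>

lemma cov_tail_limit:
  assumes p: "1 \<le> p"
  shows "(\<lambda>n. real n * cov_tail (trunc 1 n) p) \<longlonglongrightarrow> levy_tail p"
proof -
  have lag: "(\<lambda>n. real n * lag_cov (trunc 1 n) (i + 1)) \<longlonglongrightarrow> levy_cov (i + 1)" for i
    using pair_covariance_limit[of "i + 2"] unfolding lag_cov_def levy_cov_def trunc_def by simp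
  have total: "(\<lambda>n. real n * cov_tail (trunc 1 n) 1) \<longlonglongrightarrow> levy_tail 1"
    using cov_limit unfolding cov_tail_def levy_tail_def levy_cov_def trunc_def by simp
  have diff: "(\<lambda>n. real n * cov_tail (trunc 1 n) 1 - (\<Sum>i<p - 1. real n * lag_cov (trunc 1 n) (i + 1)))
      \<longlonglongrightarrow> levy_tail 1 - (\<Sum>i<p - 1. levy_cov (i + 1))"
    by (intro tendsto_diff total tendsto_sum lag)
  have split_eq: "levy_tail 1 - (\<Sum>i<p - 1. levy_cov (i + 1)) = levy_tail p"
  proof -
    have "summable (\<lambda>i. levy_cov (i + 1))" using summable_levy unfolding levy_cov_def by simp
    from suminf_split_initial_segment[OF this, of "p - 1"] show ?thesis
      using p by (simp add: levy_tail_def add.assoc)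
  qed
  show ?thesis
    unfolding split_eq[symmetric]
  proof (rule Lim_transform_eventually[OF diff])
    show "\<forall>\<^sub>F n in sequentially. real n * cov_tail (trunc 1 n) 1 - (\<Sum>i<p - 1. real n * lag_cov (trunc 1 n) (i + 1)) =
      real n * cov_tail (trunc 1 n) p"
    using eventually_ge_at_top[of 1]
  proof eventually_elim
    case (elim n)
    have "cov_tail (trunc 1 n) 1 = cov_tail (trunc 1 n) p + (\<Sum>i<p - 1. lag_cov (trunc 1 n) (i + 1))"
      using suminf_split_initial_segment[OF cov_tail_trunc(1)[OF zero_less_one elim order_refl], of "p - 1"] p
      by (simp add: cov_tail_def add.assoc)
      then show ?case by (simp add: sum_distrib_left distrib_left)
    qed
  qed
qed

lemma levy_tail_nonneg: "1 \<le> p \<Longrightarrow> 0 \<le> levy_tail p"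
proof (rule tendsto_lowerbound[OF cov_tail_limit])
  assume p: "1 \<le> p"
  show "\<forall>\<^sub>F n in sequentially. 0 \<le> real n * cov_tail (trunc 1 n) p"
    using eventually_ge_at_top[of 1]
    by eventually_elim (intro mult_nonneg_nonneg cov_tail_trunc_nonneg p, auto)
qed auto

text \<open>
  The norming constants themselves serve as a scale of levels: for an integer
  \<open>Q > a\<^sup>\<alpha>\<close> one has \<open>a B n < B (Q n) < K' B n\<close> eventually, and monotonicity in the level moves
  the problem to level one along the subsequence \<open>Q n\<close>.
\<close>

lemma cov_tail_bound:
  assumes a: "0 < a"
  obtains K where "0 \<le> K"
    "\<And>p \<eta>. 1 \<le> p \<Longrightarrow> 0 < \<eta> \<Longrightarrow> \<forall>\<^sub>F n in sequentially. real n * cov_tail (trunc a n) p \<le> K * (levy_tail p + \<eta>)"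
proof -
  obtain Q :: nat where Q: "a powr \<alpha> < real Q" using reals_Archimedean2 by blast
  have Q0: "0 < Q" using Q a by (metis gr0I less_asym of_nat_0 powr_gt_zero less_numeral_extra(3))
  \<comment> \<open>Any \<open>K'\<close> with \<open>K'\<^sup>\<alpha> > Q\<close> works.\<close>
  define K' where "K' = (real Q + 1) powr (1 / \<alpha>)"
  have K': "0 < K'" "real Q < K' powr \<alpha>" using index_pos Q0 by (auto simp: K'_def powr_powr)
  have k: "(\<lambda>n. real (Q * n) / real n) \<longlonglongrightarrow> real Q"
    by (rule tendsto_eventually) (use eventually_gt_at_top[of 0] in eventually_elim, simp)
  have ev: "\<forall>\<^sub>F n in sequentially. a * B n < B (Q * n)" "\<forall>\<^sub>F n in sequentially. B (Q * n) < K' * B n"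
    using norming_subsequence_gt[OF k a Q] norming_subsequence_lt[OF k K'(1) _ K'(2)] Q0 by auto
  have kk: "filterlim (\<lambda>n. Q * n) at_top sequentially"
    by (rule norming_subsequence_tail(2)[OF k]) (use Q0 in simp)
  show ?thesis
  proof (rule that)
    show "0 \<le> K'\<^sup>2 / real Q" by simp
    fix p :: nat and \<eta> :: real assume p: "1 \<le> p" and \<eta>: "0 < \<eta>"
    have "\<forall>\<^sub>F n in sequentially. real (Q * n) * cov_tail (trunc 1 (Q * n)) p < levy_tail p + \<eta>"
      by (rule order_tendstoD(2)[OF filterlim_compose[OF cov_tail_limit[OF p] kk]]) (use \<eta> in simp)
    then show "\<forall>\<^sub>F n in sequentially. real n * cov_tail (trunc a n) p \<le> K'\<^sup>2 / real Q * (levy_tail p + \<eta>)"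
      using ev eventually_ge_at_top[of 1]
    proof eventually_elim
      case (elim n)
      have n: "1 \<le> n" "1 \<le> Q * n" using elim Q0 by auto
      have Bn: "0 < B n" "0 < B (Q * n)" using norming_pos n by auto
      have ab: "0 < a * B n" using a Bn by simp
      have mono_cov: "cov_tail (truncation (a * B n)) p \<le> cov_tail (truncation (B (Q * n))) p"
        unfolding cov_tail_def
      proof (rule suminf_le)
        show "lag_cov (truncation (a * B n)) (j + p) \<le> lag_cov (truncation (B (Q * n))) (j + p)" for j
        proof (rule lag_cov_mono[where C = "B (Q * n)"])
          show "\<bar>truncation (a * B n) x\<bar> \<le> B (Q * n)" for x
            using abs_truncation_le[OF ab, of x] elim by linarith
          show "mono (\<lambda>x. truncation (B (Q * n)) x - truncation (a * B n) x)"
            using ab elim by (intro monoI truncation_diff_mono) auto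
        qed (use ab Bn in \<open>auto intro!: mono_truncation abs_truncation_le\<close>)
        show "summable (\<lambda>j. lag_cov (truncation (a * B n)) (j + p))"
          by (rule summable_lag_cov_shift[OF mono_truncation[OF ab] abs_truncation_le[OF ab] summable_cov[OF ab] p])
        show "summable (\<lambda>j. lag_cov (truncation (B (Q * n))) (j + p))"
          by (rule summable_lag_cov_shift[OF mono_truncation[OF Bn(2)] abs_truncation_le[OF Bn(2)] summable_cov[OF Bn(2)] p])
      qed
      have eq1: "cov_tail (truncation (B (Q * n))) p = cov_tail (trunc 1 (Q * n)) p * (B (Q * n))\<^sup>2"
        using cov_tail_trunc(2)[OF zero_less_one n(2) p] Bn by simp
      have "cov_tail (trunc a n) p = cov_tail (truncation (a * B n)) p / (B n)\<^sup>2"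
        by (rule cov_tail_trunc(2)[OF a n(1) p])
      also have "\<dots> \<le> cov_tail (trunc 1 (Q * n)) p * (B (Q * n))\<^sup>2 / (B n)\<^sup>2"
        using mono_cov unfolding eq1 by (intro divide_right_mono) auto
      also have "\<dots> = cov_tail (trunc 1 (Q * n)) p * (B (Q * n) / B n)\<^sup>2" by (simp add: power_divide)
      also have "\<dots> \<le> cov_tail (trunc 1 (Q * n)) p * K'\<^sup>2"
        using elim Bn cov_tail_trunc_nonneg[OF zero_less_one n(2) p]
        by (intro mult_left_mono power_mono) (auto simp: field_simps)
      finally have "real n * cov_tail (trunc a n) p \<le> real n * (cov_tail (trunc 1 (Q * n)) p * K'\<^sup>2)"
        by (intro mult_left_mono) auto
      also have "\<dots> = K'\<^sup>2 / real Q * (real (Q * n) * cov_tail (trunc 1 (Q * n)) p)" using Q0 by simp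
      also have "\<dots> \<le> K'\<^sup>2 / real Q * (levy_tail p + \<eta>)"
        using elim(1) by (intro mult_left_mono) auto
      finally show ?case .
    qed
  qed
qed

lemma levy_tail_cesaro: "(\<lambda>m. (\<Sum>p\<in>{1..m}. levy_tail p) / real m) \<longlonglongrightarrow> 0"
proof (rule LIMSEQ_I)
  fix r :: real assume r: "0 < r"
  have sm: "summable (\<lambda>i. levy_cov (i + 1))" using summable_levy unfolding levy_cov_def by simp
  obtain P where P: "\<And>p. P \<le> p \<Longrightarrow> norm (\<Sum>i. levy_cov (i + p + 1)) < r / 2"
    using suminf_exist_split[OF _ sm, of "r / 2"] r by auto
  have tail: "levy_tail p < r / 2" if "P + 1 \<le> p" for p
  proof -
    have "(\<Sum>i. levy_cov (i + (p - 1) + 1)) = levy_tail p" using that by (simp add: levy_tail_def add.assoc)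
    moreover have "P \<le> p - 1" using that by simp
    ultimately have "\<bar>levy_tail p\<bar> < r / 2" using P by (metis real_norm_def)
    then show ?thesis by simp
  qed
  define S where "S = (\<Sum>p\<in>{1..P}. levy_tail p)"
  have S0: "0 \<le> S" unfolding S_def by (intro sum_nonneg levy_tail_nonneg) auto
  obtain m0 :: nat where m0: "S / (r / 2) < real m0" using reals_Archimedean2 by blast
  show "\<exists>no. \<forall>m\<ge>no. norm ((\<Sum>p\<in>{1..m}. levy_tail p) / real m - 0) < r"
  proof (intro exI[of _ "max (max 1 P) m0"] allI impI)
    fix m assume "max (max 1 P) m0 \<le> m"
    then have m: "1 \<le> m" "P \<le> m" "m0 \<le> m" by auto
    have "(\<Sum>p\<in>{1..m}. levy_tail p) = S + (\<Sum>p\<in>{P+1..m}. levy_tail p)"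
      unfolding S_def using m sum.ub_add_nat[of 1 P levy_tail "m - P"] by simp
    also have "(\<Sum>p\<in>{P+1..m}. levy_tail p) \<le> real (card {P+1..m}) * (r / 2)"
      by (rule sum_bounded_above) (use tail in \<open>auto intro: less_imp_le\<close>)
    also have "\<dots> \<le> real m * (r / 2)" using r by (intro mult_right_mono) auto
    finally have "(\<Sum>p\<in>{1..m}. levy_tail p) \<le> S + real m * (r / 2)" by simp
    moreover have "S < real m * (r / 2)"
    proof -
      have "S < real m0 * (r / 2)" using m0 r by (simp add: field_simps)
      also have "\<dots> \<le> real m * (r / 2)" using m r by (intro mult_right_mono) auto
      finally show ?thesis .
    qed
    ultimately have "(\<Sum>p\<in>{1..m}. levy_tail p) / real m < r" using m by (simp add: field_simps)
    moreover have "0 \<le> (\<Sum>p\<in>{1..m}. levy_tail p) / real m"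
      by (intro divide_nonneg_nonneg sum_nonneg levy_tail_nonneg) auto
    ultimately show "norm ((\<Sum>p\<in>{1..m}. levy_tail p) / real m - 0) < r" by simp
  qed
qed

lemma char_truncation_error:
  assumes a: "0 < a" and n: "1 \<le> n"
  shows "norm ((CLINT \<omega>|M. iexp (t * ((\<Sum>i\<in>{1..N}. X i \<omega>) / B n))) - (CLINT \<omega>|M. iexp (t * (\<Sum>i\<in>{1..N}. trunc a n (X i \<omega>)))))
    \<le> 2 * real N * R (a * B n)"
proof -
  have Bn: "0 < B n" by (rule norming_pos[OF n])
  define E where "E = {\<omega> \<in> space M. \<exists>i\<in>{1..N}. a * B n < \<bar>X i \<omega>\<bar>}"
  have E: "E \<in> sets M" unfolding E_def by (rule exceeds_sets)
  define U where "U = (\<lambda>\<omega>. iexp (t * ((\<Sum>i\<in>{1..N}. X i \<omega>) / B n)))"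
  define V where "V = (\<lambda>\<omega>. iexp (t * (\<Sum>i\<in>{1..N}. trunc a n (X i \<omega>))))"
  have tm [measurable]: "(\<lambda>\<omega>. \<Sum>i\<in>{1..N}. trunc a n (X i \<omega>)) \<in> borel_measurable M"
    by (intro borel_measurable_sum measurable_compose[OF X_meas trunc_measurable]) auto
  have i: "integrable M U" "integrable M V"
    unfolding U_def V_def
    by (rule integrable_iexp; intro borel_measurable_times borel_measurable_divide borel_measurable_const sum_X_measurable tm)+
  have "norm ((LINT \<omega>|M. U \<omega>) - (LINT \<omega>|M. V \<omega>)) = norm (LINT \<omega>|M. U \<omega> - V \<omega>)" using i by simp
  also have "\<dots> \<le> (LINT \<omega>|M. norm (U \<omega> - V \<omega>))" by (rule integral_norm_bound)
  also have "\<dots> \<le> (LINT \<omega>|M. 2 * indicator E \<omega>)"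
  proof (rule integral_mono)
    fix \<omega> assume \<omega>: "\<omega> \<in> space M"
    show "norm (U \<omega> - V \<omega>) \<le> 2 * indicator E \<omega>"
    proof (cases "\<omega> \<in> E")
      case True
      have "norm (U \<omega> - V \<omega>) \<le> norm (U \<omega>) + norm (V \<omega>)" by (rule norm_triangle_ineq4)
      then show ?thesis using True by (simp add: U_def V_def)
    next
      case False
      have "trunc a n (X i \<omega>) = X i \<omega> / B n" if "i \<in> {1..N}" for i
        unfolding trunc_def
      proof (rule truncation_id)
        have "\<bar>X i \<omega>\<bar> \<le> a * B n" using False \<omega> that by (auto simp: E_def not_less)
        then show "\<bar>X i \<omega> / B n\<bar> \<le> a" using Bn by (simp add: abs_divide pos_divide_le_eq)
      qed
      then have "(\<Sum>i\<in>{1..N}. trunc a n (X i \<omega>)) = (\<Sum>i\<in>{1..N}. X i \<omega>) / B n"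
        by (simp add: sum_divide_distrib)
      then have "V \<omega> = U \<omega>" unfolding U_def V_def by (simp only:)
      then show ?thesis using False by simp
    qed
  qed (use i E in \<open>auto simp: less_top[symmetric]\<close>)
  also have "\<dots> = 2 * measure M E"
    using sets.sets_into_space[OF E] by (simp add: Int_absorb2)
  also have "\<dots> \<le> 2 * (real N * R (a * B n))"
    unfolding E_def by (intro mult_left_mono measure_exceeds_le) auto
  finally show ?thesis unfolding U_def V_def by (simp add: mult_ac)
qed

lemma single_char_error: "(\<lambda>n. LINT \<omega>|M. norm (iexp (t * (X 1 \<omega> / B n)) - 1)) \<longlonglongrightarrow> 0"
proof -
  have "(\<lambda>n. LINT \<omega>|M. norm (iexp (t * (X 1 \<omega> / B n)) - 1)) \<longlonglongrightarrow> (LINT \<omega>|M. 0)"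
  proof (rule integral_dominated_convergence[where w = "\<lambda>_. 2"])
    show "AE \<omega> in M. (\<lambda>n. norm (iexp (t * (X 1 \<omega> / B n)) - 1)) \<longlonglongrightarrow> 0"
    proof (intro AE_I2)
      fix \<omega>
      have "(\<lambda>n. X 1 \<omega> / B n) \<longlonglongrightarrow> 0"
        by (rule tendsto_divide_0[OF tendsto_const filterlim_at_top_imp_at_infinity[OF norming_at_top]])
      then have "(\<lambda>n. norm (iexp (t * (X 1 \<omega> / B n)) - 1)) \<longlonglongrightarrow> norm (iexp (t * 0) - 1)"
        by (intro tendsto_norm tendsto_diff tendsto_exp tendsto_mult tendsto_const tendsto_of_real)
      then show "(\<lambda>n. norm (iexp (t * (X 1 \<omega> / B n)) - 1)) \<longlonglongrightarrow> 0" by simp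
    qed
    show "AE \<omega> in M. norm (norm (iexp (t * (X 1 \<omega> / B n)) - 1)) \<le> 2" for n
      by (intro AE_I2) (simp only: real_norm_def abs_norm_cancel norm_iexp_minus_1')
  qed auto
  then show ?thesis by simp
qed

lemma char_remainder_error:
  assumes N: "N \<le> n"
  shows "norm ((CLINT \<omega>|M. iexp (t * ((\<Sum>i\<in>{1..n}. X i \<omega>) / b))) - (CLINT \<omega>|M. iexp (t * ((\<Sum>i\<in>{1..N}. X i \<omega>) / b))))
    \<le> real (n - N) * (LINT \<omega>|M. norm (iexp (t * (X 1 \<omega> / b)) - 1))"
proof -
  define U where "U = (\<lambda>n \<omega>. iexp (t * ((\<Sum>i\<in>{1..n}. X i \<omega>) / b)))"
  have U: "integrable M (U n)" for n
    unfolding U_def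
    by (rule integrable_iexp) (intro borel_measurable_times borel_measurable_divide borel_measurable_const sum_X_measurable)
  have d: "integrable M (\<lambda>\<omega>. norm (iexp (t * (X i \<omega> / b)) - 1))" if "1 \<le> i" for i
  proof (rule integrable_const_bound[where B = 2])
    show "AE \<omega> in M. norm (norm (iexp (t * (X i \<omega> / b)) - 1)) \<le> 2"
      by (intro AE_I2) (simp only: real_norm_def abs_norm_cancel norm_iexp_minus_1')
    show "(\<lambda>\<omega>. norm (iexp (t * (X i \<omega> / b)) - 1)) \<in> borel_measurable M"
      using X_meas[OF that] by measurable
  qed
  have "norm ((LINT \<omega>|M. U n \<omega>) - (LINT \<omega>|M. U N \<omega>)) = norm (LINT \<omega>|M. U n \<omega> - U N \<omega>)" using U by simp
  also have "\<dots> \<le> (LINT \<omega>|M. norm (U n \<omega> - U N \<omega>))" by (rule integral_norm_bound)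
  also have "\<dots> \<le> (LINT \<omega>|M. (\<Sum>i\<in>{N+1..n}. norm (iexp (t * (X i \<omega> / b)) - 1)))"
  proof (rule integral_mono)
    fix \<omega>
    have "(\<Sum>i\<in>{1..n}. X i \<omega>) = (\<Sum>i\<in>{1..N}. X i \<omega>) + (\<Sum>i\<in>{N+1..n}. X i \<omega>)"
      using sum.ub_add_nat[of 1 N "\<lambda>i. X i \<omega>" "n - N"] N by simp
    then have "t * ((\<Sum>i\<in>{1..n}. X i \<omega>) / b) = t * ((\<Sum>i\<in>{1..N}. X i \<omega>) / b) + (\<Sum>i\<in>{N+1..n}. t * (X i \<omega> / b))"
      by (simp add: add_divide_distrib distrib_left sum_divide_distrib sum_distrib_left)
    moreover have U1: "norm (U N \<omega>) = 1" unfolding U_def by (rule norm_exp_i_times)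
    moreover have "iexp (x + y) - iexp x = iexp x * (iexp y - 1)" for x y
      by (simp add: distrib_left exp_add right_diff_distrib)
    ultimately have "U n \<omega> - U N \<omega> = U N \<omega> * (iexp (\<Sum>i\<in>{N+1..n}. t * (X i \<omega> / b)) - 1)"
      unfolding U_def by (simp only:)
    then have "norm (U n \<omega> - U N \<omega>) = norm (iexp (\<Sum>i\<in>{N+1..n}. t * (X i \<omega> / b)) - 1)"
      by (simp only: norm_mult U1 mult_1_left)
    also have "\<dots> \<le> (\<Sum>i\<in>{N+1..n}. norm (iexp (t * (X i \<omega> / b)) - 1))" by (rule norm_iexp_sum_minus_1)
    finally show "norm (U n \<omega> - U N \<omega>) \<le> (\<Sum>i\<in>{N+1..n}. norm (iexp (t * (X i \<omega> / b)) - 1))" .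
    show "integrable M (\<lambda>\<omega>. norm (U n \<omega> - U N \<omega>))"
      by (intro integrable_norm Bochner_Integration.integrable_diff U)
    show "integrable M (\<lambda>\<omega>. \<Sum>i\<in>{N+1..n}. norm (iexp (t * (X i \<omega> / b)) - 1))"
      by (rule Bochner_Integration.integrable_sum, rule d) auto
  qed
  also have "\<dots> = (\<Sum>i\<in>{N+1..n}. LINT \<omega>|M. norm (iexp (t * (X i \<omega> / b)) - 1))"
    by (intro Bochner_Integration.integral_sum d) auto
  also have "\<dots> = (\<Sum>i\<in>{N+1..n}. LINT \<omega>|M. norm (iexp (t * (X 1 \<omega> / b)) - 1))"
    by (intro sum.cong refl expectation_shift1[of "\<lambda>x. norm (iexp (t * (x / b)) - 1)"]) auto
  finally show ?thesis unfolding U_def by simp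
qed

text \<open>
  With \<open>k = n div m\<close> blocks the error has four parts: the fewer than \<open>m\<close> variables that are
  left over, truncation of the whole sum, Newman's inequality, and removing the truncation from
  each block. The level \<open>a\<close> is fixed first, then \<open>m\<close> is chosen large, then \<open>n\<close>.
\<close>

lemma char_asymptotic_independence:
  assumes \<epsilon>: "0 < \<epsilon>"
  obtains m0 where "1 \<le> m0" "\<And>m. m0 \<le> m \<Longrightarrow> \<forall>\<^sub>F n in sequentially.
    norm ((CLINT \<omega>|M. iexp (t * ((\<Sum>i\<in>{1..n}. X i \<omega>) / B n))) -
      (CLINT \<omega>|M. iexp (t * ((\<Sum>i\<in>{1..m}. X i \<omega>) / B n))) ^ (n div m)) \<le> \<epsilon>"
proof -
  have "((\<lambda>a::real. a powr - \<alpha>) \<longlongrightarrow> 0) at_top"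
    using index_pos by (intro tendsto_neg_powr filterlim_ident) auto
  then have "\<forall>\<^sub>F a in at_top. (a::real) powr - \<alpha> < \<epsilon> / 16"
    using \<epsilon> by (intro order_tendstoD(2)) auto
  then have "\<forall>\<^sub>F a in at_top. (a::real) powr - \<alpha> < \<epsilon> / 16 \<and> 0 < a"
    using eventually_gt_at_top[of 0] by (rule eventually_conj)
  then obtain a :: real where a: "a powr - \<alpha> < \<epsilon> / 16" "0 < a"
    unfolding eventually_at_top_linorder by blast
  obtain K where K: "0 \<le> K"
    "\<And>p \<eta>. 1 \<le> p \<Longrightarrow> 0 < \<eta> \<Longrightarrow> \<forall>\<^sub>F n in sequentially. real n * cov_tail (trunc a n) p \<le> K * (levy_tail p + \<eta>)"
    using cov_tail_bound[OF a(2)] by blast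
  \<comment> \<open>The summand 1 only keeps \<open>D\<close> away from zero for the division below.\<close>
  define D where "D = 4 * t\<^sup>2 * K + 1"
  have D: "1 \<le> D" using K by (simp add: D_def)
  define \<eta> where "\<eta> = \<epsilon> / 4 / D"
  have \<eta>: "0 < \<eta>" using \<epsilon> D by (simp add: \<eta>_def)
  have "\<forall>\<^sub>F m in sequentially. (\<Sum>p\<in>{1..m}. levy_tail p) / real m < \<eta>"
    by (rule order_tendstoD(2)[OF levy_tail_cesaro \<eta>])
  then obtain m1 where m1: "\<And>m. m1 \<le> m \<Longrightarrow> (\<Sum>p\<in>{1..m}. levy_tail p) / real m < \<eta>"
    unfolding eventually_sequentially by blast
  show ?thesis
  proof (rule that[of "max 1 m1"])
    fix m assume "max 1 m1 \<le> m"
    then have m: "1 \<le> m" "m1 \<le> m" by auto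
    have ev_R: "\<forall>\<^sub>F n in sequentially. real n * R (a * B n) < \<epsilon> / 16"
      by (rule order_tendstoD(2)[OF scaled_tail[OF a(2)] a(1)])
    have "\<forall>\<^sub>F n in sequentially. \<forall>p\<in>{1..m}. real n * cov_tail (trunc a n) p \<le> K * (levy_tail p + \<eta>)"
      using K(2)[OF _ \<eta>] by (intro eventually_ball_finite) auto
    moreover have "\<forall>\<^sub>F n in sequentially. real m * (LINT \<omega>|M. norm (iexp (t * (X 1 \<omega> / B n)) - 1)) < \<epsilon> / 4"
      by (rule order_tendstoD(2)[OF tendsto_mult_right_zero[OF single_char_error]]) (use \<epsilon> in simp)
    ultimately show "\<forall>\<^sub>F n in sequentially.
      norm ((CLINT \<omega>|M. iexp (t * ((\<Sum>i\<in>{1..n}. X i \<omega>) / B n))) -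
        (CLINT \<omega>|M. iexp (t * ((\<Sum>i\<in>{1..m}. X i \<omega>) / B n))) ^ (n div m)) \<le> \<epsilon>"
      using ev_R eventually_ge_at_top[of 1]
    proof eventually_elim
      case (elim n)
      define k where "k = n div m"
      have km: "k * m \<le> n" "n - k * m \<le> m"
        using m by (auto simp: k_def minus_div_mult_eq_mod intro: less_imp_le)
      define \<phi> where "\<phi> = (\<lambda>N. (CLINT \<omega>|M. iexp (t * ((\<Sum>i\<in>{1..N}. X i \<omega>) / B n))))"
      define \<psi> where "\<psi> = (\<lambda>N. (CLINT \<omega>|M. iexp (t * (\<Sum>i\<in>{1..N}. trunc a n (X i \<omega>)))))"
      have \<phi>1: "norm (\<phi> m) \<le> 1" "norm (\<psi> m) \<le> 1"
        unfolding \<phi>_def \<psi>_def by (rule order_trans[OF integral_norm_bound], simp add: prob_space)+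
      have "norm (\<phi> n - \<phi> (k * m)) \<le> real (n - k * m) * (LINT \<omega>|M. norm (iexp (t * (X 1 \<omega> / B n)) - 1))"
        unfolding \<phi>_def by (rule char_remainder_error[OF km(1)])
      also have "\<dots> \<le> real m * (LINT \<omega>|M. norm (iexp (t * (X 1 \<omega> / B n)) - 1))"
        using km(2) by (intro mult_right_mono integral_nonneg_AE) (auto simp only: of_nat_le_iff norm_ge_zero intro!: AE_I2)
      finally have e1: "norm (\<phi> n - \<phi> (k * m)) \<le> \<epsilon> / 4" using elim(2) by linarith
      have kmR: "real (k * m) * R (a * B n) \<le> \<epsilon> / 16"
      proof -
        have "real (k * m) * R (a * B n) \<le> real n * R (a * B n)"
          using km(1) by (intro mult_right_mono) (simp_all only: of_nat_le_iff measure_nonneg)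
        then show ?thesis using elim(3) by linarith
      qed
      have "norm (\<phi> (k * m) - \<psi> (k * m)) \<le> 2 * real (k * m) * R (a * B n)"
        unfolding \<phi>_def \<psi>_def by (rule char_truncation_error[OF a(2) elim(4)])
      then have e2: "norm (\<phi> (k * m) - \<psi> (k * m)) \<le> \<epsilon> / 8" using kmR by simp
      have "norm (\<psi> (k * m) - \<psi> m ^ k) \<le> real k * (4 * t\<^sup>2 * (\<Sum>p\<in>{1..m}. cov_tail (trunc a n) p))"
        unfolding \<psi>_def
        by (rule char_block_sums[OF mono_trunc[OF a(2) elim(4)] abs_trunc_le[OF a(2)] cov_tail_trunc(1)[OF a(2) elim(4) order_refl]])
      also have "\<dots> \<le> (real n / real m) * (4 * t\<^sup>2 * (\<Sum>p\<in>{1..m}. cov_tail (trunc a n) p))"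
      proof (rule mult_right_mono)
        have "real k * real m \<le> real n" using km(1) by (metis of_nat_le_iff of_nat_mult)
        then show "real k \<le> real n / real m" using m by (simp add: field_simps)
        show "0 \<le> 4 * t\<^sup>2 * (\<Sum>p\<in>{1..m}. cov_tail (trunc a n) p)"
          using a elim(4) by (intro mult_nonneg_nonneg sum_nonneg cov_tail_trunc_nonneg) auto
      qed
      also have "\<dots> = 4 * t\<^sup>2 * ((\<Sum>p\<in>{1..m}. real n * cov_tail (trunc a n) p) / real m)"
        unfolding sum_distrib_left[symmetric] by simp
      also have "\<dots> \<le> 4 * t\<^sup>2 * ((\<Sum>p\<in>{1..m}. K * (levy_tail p + \<eta>)) / real m)"
        using elim(1) by (intro mult_left_mono divide_right_mono sum_mono) auto
      also have "(\<Sum>p\<in>{1..m}. K * (levy_tail p + \<eta>)) / real m = K * ((\<Sum>p\<in>{1..m}. levy_tail p) / real m + \<eta>)"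
        using m by (simp add: sum_distrib_left[symmetric] sum.distrib field_simps)
      also have "4 * t\<^sup>2 * (K * ((\<Sum>p\<in>{1..m}. levy_tail p) / real m + \<eta>)) \<le> 4 * t\<^sup>2 * (K * (\<eta> + \<eta>))"
        using m1[OF m(2)] K by (intro mult_left_mono) auto
      also have "\<dots> = (4 * t\<^sup>2 * K) * (2 * \<eta>)" by simp
      also have "\<dots> \<le> D * (2 * \<eta>)" using \<eta> by (intro mult_right_mono) (auto simp: D_def)
      also have "\<dots> = \<epsilon> / 2" using D by (simp add: \<eta>_def)
      finally have e3: "norm (\<psi> (k * m) - \<psi> m ^ k) \<le> \<epsilon> / 2" .
      have "norm (\<psi> m ^ k - \<phi> m ^ k) \<le> real k * norm (\<psi> m - \<phi> m)"
        by (rule norm_power_diff[OF \<phi>1(2,1)])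
      also have "\<dots> \<le> real k * (2 * real m * R (a * B n))"
        using char_truncation_error[OF a(2) elim(4), of t m]
        by (intro mult_left_mono) (simp_all add: \<phi>_def \<psi>_def norm_minus_commute)
      finally have e4: "norm (\<psi> m ^ k - \<phi> m ^ k) \<le> \<epsilon> / 8" using kmR by simp
      have "norm (\<phi> n - \<phi> m ^ k) = norm ((\<phi> n - \<phi> (k * m)) + (\<phi> (k * m) - \<psi> (k * m)) + (\<psi> (k * m) - \<psi> m ^ k) + (\<psi> m ^ k - \<phi> m ^ k))"
        by simp
      also have "\<dots> \<le> \<epsilon> / 4 + \<epsilon> / 8 + \<epsilon> / 2 + \<epsilon> / 8"
        by (intro order_trans[OF norm_triangle_ineq] add_mono e1 e2 e3 e4)
      also have "\<dots> = \<epsilon>" by simp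
      finally show ?case unfolding \<phi>_def k_def .
    qed
  qed simp
qed

section \<open>Tightness and identification of the limit\<close>

lemma trunc_sum_measurable [measurable]:
  "(\<lambda>\<omega>. \<Sum>i\<in>{1..N}. trunc a n (X i \<omega>)) \<in> borel_measurable M"
  by (intro borel_measurable_sum measurable_compose[OF X_meas trunc_measurable]) auto

lemma trunc_sum_bounded:
  assumes a: "0 < a" shows "bounded_rv M (\<lambda>\<omega>. \<Sum>i\<in>{1..N}. trunc a n (X i \<omega>))"
  by (intro bounded_rv_sum bounded_rvI[where C = a] abs_trunc_le a measurable_compose[OF X_meas trunc_measurable]) auto

lemma trunc_sum_square_integrable:
  "0 < a \<Longrightarrow> integrable M (\<lambda>\<omega>. (\<Sum>i\<in>{1..N}. trunc a n (X i \<omega>))\<^sup>2)"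
  unfolding power2_eq_square by (intro bounded_rv_integrable bounded_rv_mult trunc_sum_bounded)

lemma trunc_second_moment_le:
  assumes a: "0 < a" and n: "1 \<le> n"
  shows "expectation (\<lambda>\<omega>. (\<Sum>i\<in>{1..N}. trunc a n (X i \<omega>))\<^sup>2) \<le>
     real N * expectation (\<lambda>\<omega>. (trunc a n (X 1 \<omega>))\<^sup>2) + 2 * real N * cov_tail (trunc a n) 1 +
     (real N * expectation (\<lambda>\<omega>. trunc a n (X 1 \<omega>)))\<^sup>2"
  by (rule second_moment_sum_le[OF mono_trunc[OF a n] abs_trunc_le[OF a] cov_tail_trunc(1)[OF a n order_refl]])

text \<open>
  Either some variable is truncated, or the truncated sum is large and Chebyshev's inequality
  applies.
\<close>

lemma partial_sum_exceeds_le: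
  assumes a: "0 < a" and n: "1 \<le> n" and K: "0 < K"
  shows "measure M {\<omega> \<in> space M. K \<le> \<bar>(\<Sum>i\<in>{1..N}. X i \<omega>) / B n\<bar>} \<le>
    real N * R (a * B n) + expectation (\<lambda>\<omega>. (\<Sum>i\<in>{1..N}. trunc a n (X i \<omega>))\<^sup>2) / K\<^sup>2"
proof -
  have Bn: "0 < B n" by (rule norming_pos[OF n])
  define T where "T = (\<lambda>\<omega>. \<Sum>i\<in>{1..N}. trunc a n (X i \<omega>))"
  define E where "E = {\<omega> \<in> space M. \<exists>i\<in>{1..N}. a * B n < \<bar>X i \<omega>\<bar>}"
  define F where "F = {\<omega> \<in> space M. K \<le> \<bar>T \<omega>\<bar>}"
  have T_meas [measurable]: "T \<in> borel_measurable M" unfolding T_def by (rule trunc_sum_measurable)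
  have E: "E \<in> sets M" unfolding E_def by (rule exceeds_sets)
  have F: "F \<in> sets M" unfolding F_def by measurable
  have T2: "integrable M (\<lambda>\<omega>. (T \<omega>)\<^sup>2)" unfolding T_def by (rule trunc_sum_square_integrable[OF a])
  have "{\<omega> \<in> space M. K \<le> \<bar>(\<Sum>i\<in>{1..N}. X i \<omega>) / B n\<bar>} \<subseteq> E \<union> F"
  proof (rule subsetI, rule UnCI)
    fix \<omega> assume *: "\<omega> \<in> {\<omega> \<in> space M. K \<le> \<bar>(\<Sum>i\<in>{1..N}. X i \<omega>) / B n\<bar>}" "\<omega> \<notin> F"
    show "\<omega> \<in> E"
    proof (rule ccontr)
      assume "\<omega> \<notin> E"
      then have "trunc a n (X i \<omega>) = X i \<omega> / B n" if "i \<in> {1..N}" for i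
        unfolding trunc_def using that * Bn
        by (intro truncation_id) (auto simp: E_def not_less abs_divide pos_divide_le_eq)
      then have "T \<omega> = (\<Sum>i\<in>{1..N}. X i \<omega>) / B n"
        by (simp add: sum_divide_distrib T_def)
      with * show False by (auto simp: F_def)
    qed
  qed
  then have "measure M {\<omega> \<in> space M. K \<le> \<bar>(\<Sum>i\<in>{1..N}. X i \<omega>) / B n\<bar>} \<le> measure M (E \<union> F)"
    using E F by (intro finite_measure_mono) auto
  also have "\<dots> \<le> measure M E + measure M F" by (rule measure_Un_le[OF E F])
  also have "measure M F = expectation (indicator F)"
    using sets.sets_into_space[OF F] by (simp add: Int_absorb2)
  also have "\<dots> \<le> expectation (\<lambda>\<omega>. (T \<omega>)\<^sup>2 / K\<^sup>2)"
  proof (rule integral_mono)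
    fix \<omega>
    show "indicator F \<omega> \<le> (T \<omega>)\<^sup>2 / K\<^sup>2"
    proof (cases "\<omega> \<in> F")
      case True
      then have "K\<^sup>2 \<le> \<bar>T \<omega>\<bar>\<^sup>2" using K by (intro power_mono) (auto simp: F_def)
      then show ?thesis using True K by simp
    qed simp
  qed (use F T2 in \<open>auto simp: less_top[symmetric]\<close>)
  also have "\<dots> = expectation (\<lambda>\<omega>. (T \<omega>)\<^sup>2) / K\<^sup>2" by simp
  finally show ?thesis
    using measure_exceeds_le[of N "a * B n"] unfolding E_def T_def by linarith
qed

lemma trunc_variance_limit:
  "0 < a \<Longrightarrow> (\<lambda>n. real n * expectation (\<lambda>\<omega>. (trunc a n (X 1 \<omega>))\<^sup>2)) \<longlonglongrightarrow> truncated_variance a"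
  unfolding trunc_def by (rule truncated_second_moment)

lemma normalized_sum_tight:
  assumes \<epsilon>: "0 < \<epsilon>"
  shows "\<exists>K. \<forall>\<^sub>F n in sequentially. measure (distr M borel (\<lambda>\<omega>. (\<Sum>i\<in>{1..n}. X i \<omega>) / B n)) {- K<..K} > 1 - \<epsilon>"
proof -
  have "((\<lambda>a::real. a powr - \<alpha>) \<longlongrightarrow> 0) at_top"
    using index_pos by (intro tendsto_neg_powr filterlim_ident) auto
  then have "\<forall>\<^sub>F a in at_top. (a::real) powr - \<alpha> < \<epsilon> / 2"
    using \<epsilon> by (intro order_tendstoD(2)) auto
  then have "\<forall>\<^sub>F a in at_top. (a::real) powr - \<alpha> < \<epsilon> / 2 \<and> 0 < a"
    using eventually_gt_at_top[of 0] by (rule eventually_conj)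
  then obtain a :: real where a: "a powr - \<alpha> < \<epsilon> / 2" "0 < a"
    unfolding eventually_at_top_linorder by blast
  obtain K0 where K0: "0 \<le> K0"
    "\<And>p \<eta>. 1 \<le> p \<Longrightarrow> 0 < \<eta> \<Longrightarrow> \<forall>\<^sub>F n in sequentially. real n * cov_tail (trunc a n) p \<le> K0 * (levy_tail p + \<eta>)"
    using cov_tail_bound[OF a(2)] by blast
  obtain C0 where C0: "\<forall>\<^sub>F n in sequentially. \<bar>real n * expectation (\<lambda>\<omega>. trunc a n (X 1 \<omega>))\<bar> \<le> C0"
    using truncated_mean_bounded[OF a(2)] unfolding trunc_def by blast
  define C where "C = (truncated_variance a + 1) + 2 * (K0 * (levy_tail 1 + 1)) + C0\<^sup>2"
  have ev_V: "\<forall>\<^sub>F n in sequentially. real n * expectation (\<lambda>\<omega>. (trunc a n (X 1 \<omega>))\<^sup>2) < truncated_variance a + 1"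
    by (rule order_tendstoD(2)[OF trunc_variance_limit[OF a(2)]]) simp
  have ev_R: "\<forall>\<^sub>F n in sequentially. real n * R (a * B n) < \<epsilon> / 2"
    by (rule order_tendstoD(2)[OF scaled_tail[OF a(2)] a(1)])
  define K where "K = sqrt (2 * (\<bar>C\<bar> + 1) / \<epsilon>)"
  have C1: "0 < \<bar>C\<bar> + 1" by (rule add_nonneg_pos) auto
  have pos: "0 < 2 * (\<bar>C\<bar> + 1) / \<epsilon>"
    by (rule divide_pos_pos[OF mult_pos_pos[OF zero_less_numeral C1] \<epsilon>])
  have K: "0 < K" "K\<^sup>2 = 2 * (\<bar>C\<bar> + 1) / \<epsilon>"
    unfolding K_def by (rule real_sqrt_gt_zero[OF pos], rule real_sqrt_pow2[OF less_imp_le[OF pos]])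
  have "C < \<bar>C\<bar> + 1" using abs_ge_self[of C] by linarith
  then have "C / (\<bar>C\<bar> + 1) < 1" using C1 by simp
  then have "C / (\<bar>C\<bar> + 1) * (\<epsilon> / 2) < 1 * (\<epsilon> / 2)" using \<epsilon> by (intro mult_strict_right_mono) auto
  then have CK: "C / K\<^sup>2 < \<epsilon> / 2" unfolding K(2) by (simp add: mult.commute)
  show ?thesis
  proof (rule exI[of _ K])
    show "\<forall>\<^sub>F n in sequentially. 1 - \<epsilon> < measure (distr M borel (\<lambda>\<omega>. (\<Sum>i\<in>{1..n}. X i \<omega>) / B n)) {- K<..K}"
      using ev_V ev_R C0 K0(2)[OF order_refl zero_less_one] eventually_ge_at_top[of 1]
    proof eventually_elim
      case (elim n)
      have "expectation (\<lambda>\<omega>. (\<Sum>i\<in>{1..n}. trunc a n (X i \<omega>))\<^sup>2) \<le> C"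
      proof -
        have "(real n * expectation (\<lambda>\<omega>. trunc a n (X 1 \<omega>)))\<^sup>2 \<le> C0\<^sup>2"
          using elim(3) power_mono[OF elim(3), of 2] by simp
        then show ?thesis
          using trunc_second_moment_le[OF a(2) elim(5), of n] elim(1,4) unfolding C_def by linarith
      qed
      then have "expectation (\<lambda>\<omega>. (\<Sum>i\<in>{1..n}. trunc a n (X i \<omega>))\<^sup>2) / K\<^sup>2 \<le> C / K\<^sup>2"
        by (intro divide_right_mono) auto
      then have small: "measure M {\<omega> \<in> space M. K \<le> \<bar>(\<Sum>i\<in>{1..n}. X i \<omega>) / B n\<bar>} < \<epsilon>"
        using partial_sum_exceeds_le[OF a(2) elim(5) K(1), of n] elim(2) CK by linarith
      define S where "S = (\<lambda>\<omega>. (\<Sum>i\<in>{1..n}. X i \<omega>) / B n)"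
      have S: "S \<in> borel_measurable M"
        unfolding S_def by (intro borel_measurable_divide sum_X_measurable borel_measurable_const)
      have bad: "{\<omega> \<in> space M. K \<le> \<bar>S \<omega>\<bar>} \<in> sets M"
        by (rule borel_measurable_le[OF borel_measurable_const borel_measurable_abs[OF S]])
      have "1 - \<epsilon> < measure M (space M - {\<omega> \<in> space M. K \<le> \<bar>S \<omega>\<bar>})"
        using small prob_compl[OF bad] unfolding S_def by simp
      also have "\<dots> \<le> measure M (S -` {- K<..K} \<inter> space M)"
        by (rule finite_measure_mono) (auto simp: not_le abs_less_iff intro!: measurable_sets[OF S])
      also have "\<dots> = measure (distr M borel S) {- K<..K}"
        by (rule measure_distr[OF S, symmetric]) simp
      finally show ?case unfolding S_def .
    qed
  qed
qed

text \<open>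
  The second moment of a truncated block sum grows linearly in \<open>m\<close>; the square of its mean is
  of order \<open>m\<^sup>2 / n\<^sup>2\<close> and disappears in the limit. Linear growth is what keeps the normalized
  constants \<open>c / m\<close> bounded.
\<close>

lemma pareto_constant_linear_bound:
  obtains D where "\<And>m \<theta> c. 1 \<le> m \<Longrightarrow> \<bar>\<theta>\<bar> = 1 \<Longrightarrow>
    pareto_tails M (\<lambda>n \<omega>. \<theta> * ((\<Sum>i\<in>{1..m}. X i \<omega>) / B n)) \<alpha> c \<Longrightarrow> c \<le> real m * D"
proof (rule that)
  fix m \<theta> c assume m: "1 \<le> m" and \<theta>: "\<bar>\<theta>\<bar> = (1::real)"
    and tails: "pareto_tails M (\<lambda>n \<omega>. \<theta> * ((\<Sum>i\<in>{1..m}. X i \<omega>) / B n)) \<alpha> c"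
  obtain C0 where C0: "\<forall>\<^sub>F n in sequentially. \<bar>real n * expectation (\<lambda>\<omega>. trunc 1 n (X 1 \<omega>))\<bar> \<le> C0"
    using truncated_mean_bounded[OF zero_less_one] unfolding trunc_def by blast
  define V where "V = (\<lambda>n. expectation (\<lambda>\<omega>. (trunc 1 n (X 1 \<omega>))\<^sup>2))"
  have lim: "(\<lambda>n. real n * measure M {\<omega> \<in> space M. 1 < \<theta> * ((\<Sum>i\<in>{1..m}. X i \<omega>) / B n)}) \<longlonglongrightarrow> c"
    using tails unfolding pareto_tails_def by (auto dest!: spec[of _ "1::real"])
  have "(\<lambda>n. real m * (real n * R (1 * B n)) + (real m * (real n * V n) + 2 * real m * (real n * cov_tail (trunc 1 n) 1) + (real m)\<^sup>2 * C0\<^sup>2 * (1 / real n)))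
      \<longlonglongrightarrow> real m * 1 powr - \<alpha> + (real m * truncated_variance 1 + 2 * real m * levy_tail 1 + (real m)\<^sup>2 * C0\<^sup>2 * 0)"
    unfolding V_def
    by (intro tendsto_add tendsto_mult tendsto_const scaled_tail trunc_variance_limit cov_tail_limit lim_1_over_n) auto
  moreover have "\<forall>\<^sub>F n in sequentially. real n * measure M {\<omega> \<in> space M. 1 < \<theta> * ((\<Sum>i\<in>{1..m}. X i \<omega>) / B n)} \<le>
      real m * (real n * R (1 * B n)) + (real m * (real n * V n) + 2 * real m * (real n * cov_tail (trunc 1 n) 1) + (real m)\<^sup>2 * C0\<^sup>2 * (1 / real n))"
    using C0 eventually_ge_at_top[of 1]
  proof eventually_elim
    case (elim n)
    define S where "S = (\<lambda>\<omega>. (\<Sum>i\<in>{1..m}. X i \<omega>) / B n)"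
    define W where "W = expectation (\<lambda>\<omega>. (\<Sum>i\<in>{1..m}. trunc 1 n (X i \<omega>))\<^sup>2)"
    define \<mu> where "\<mu> = expectation (\<lambda>\<omega>. trunc 1 n (X 1 \<omega>))"
    have S [measurable]: "S \<in> borel_measurable M"
      unfolding S_def by (intro borel_measurable_divide sum_X_measurable borel_measurable_const)
    have "measure M {\<omega> \<in> space M. 1 < \<theta> * S \<omega>} \<le> measure M {\<omega> \<in> space M. 1 \<le> \<bar>S \<omega>\<bar>}"
    proof (rule finite_measure_mono)
      show "{\<omega> \<in> space M. 1 < \<theta> * S \<omega>} \<subseteq> {\<omega> \<in> space M. 1 \<le> \<bar>S \<omega>\<bar>}"
        using \<theta> by (auto simp: abs_if split: if_splits)
    qed measurable
    also have "\<dots> \<le> real m * R (1 * B n) + W / 1\<^sup>2"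
      unfolding S_def W_def by (rule partial_sum_exceeds_le[OF zero_less_one elim(2) zero_less_one])
    also have "W / 1\<^sup>2 \<le> real m * V n + 2 * real m * cov_tail (trunc 1 n) 1 + (real m * \<mu>)\<^sup>2"
      using trunc_second_moment_le[OF zero_less_one elim(2), of m] unfolding W_def V_def \<mu>_def by simp
    finally have "real n * measure M {\<omega> \<in> space M. 1 < \<theta> * S \<omega>} \<le>
        real n * (real m * R (1 * B n) + (real m * V n + 2 * real m * cov_tail (trunc 1 n) 1 + (real m * \<mu>)\<^sup>2))"
      by (intro mult_left_mono) auto
    also have "\<dots> = real m * (real n * R (1 * B n)) + (real m * (real n * V n) + 2 * real m * (real n * cov_tail (trunc 1 n) 1) + (real m)\<^sup>2 * (real n * \<mu>\<^sup>2))"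
      by (simp add: distrib_left power_mult_distrib mult_ac)
    also have "real n * \<mu>\<^sup>2 \<le> C0\<^sup>2 * (1 / real n)"
    proof -
      have "\<bar>real n * \<mu>\<bar>\<^sup>2 \<le> C0\<^sup>2" using elim(1) unfolding \<mu>_def by (intro power_mono) auto
      then show ?thesis using elim(2) by (simp add: power_mult_distrib power2_eq_square field_simps)
    qed
    finally show ?case unfolding S_def by (simp add: mult_left_mono mult.assoc)
  qed
  ultimately have "c \<le> real m * 1 powr - \<alpha> + (real m * truncated_variance 1 + 2 * real m * levy_tail 1 + (real m)\<^sup>2 * C0\<^sup>2 * 0)"
    by (rule tendsto_le[OF sequentially_bot _ lim])
  also have "\<dots> = real m * (1 + truncated_variance 1 + 2 * levy_tail 1)" by (simp add: algebra_simps)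
  finally show "c \<le> real m * (1 + truncated_variance 1 + 2 * levy_tail 1)" .
qed

lemma symmetric_partial_sum:
  assumes "\<alpha> = 1" "1 \<le> m"
  shows "distr M borel (\<lambda>\<omega>. - ((\<Sum>i\<in>{1..m}. X i \<omega>) / b)) = distr M borel (\<lambda>\<omega>. (\<Sum>i\<in>{1..m}. X i \<omega>) / b)"
proof -
  define s where "s = (\<lambda>x :: nat \<Rightarrow> real. (\<Sum>i\<in>{1..m}. x i) / b)"
  have s: "s \<in> borel_measurable (\<Pi>\<^sub>M i\<in>{1..m}. borel)"
    unfolding s_def by (intro borel_measurable_divide borel_measurable_sum measurable_component_singleton borel_measurable_const)
  have "distr (joint_law M Y {1..m}) borel s = distr M borel (\<lambda>\<omega>. (\<Sum>i\<in>{1..m}. Y i \<omega>) / b)"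
    if Y: "\<And>i. i \<in> {1..m} \<Longrightarrow> Y i \<in> borel_measurable M" for Y
  proof -
    have V: "(\<lambda>\<omega>. \<lambda>i\<in>{1..m}. Y i \<omega>) \<in> measurable M (\<Pi>\<^sub>M i\<in>{1..m}. borel)"
      using Y by (rule measurable_restrict)
    show ?thesis unfolding joint_law_def distr_distr[OF s V]
      by (rule arg_cong[where f = "distr M borel"]) (auto simp: s_def o_def)
  qed
  from this[of X] this[of "\<lambda>i \<omega>. - X i \<omega>"] show ?thesis
    using symmetric[OF assms] X_meas unfolding symmetric_vector_def by (simp add: sum_negf)
qed

lemma integrable_X:
  assumes j: "1 \<le> j" shows "integrable M (X j) \<longleftrightarrow> integrable M (X 1)"
proof -
  have "joint_law M (\<lambda>i. X (i + (j - 1))) {1..1} = joint_law M X {1..1}"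
    using stationary unfolding strictly_stationary_def by blast
  then have "integrable (joint_law M (\<lambda>i. X (i + (j - 1))) {1..1}) (\<lambda>x. x 1) = integrable (joint_law M X {1..1}) (\<lambda>x. x 1)"
    by simp
  then show ?thesis
    unfolding joint_law_def
    by (subst (asm) (1 2) integrable_distr_eq) (use X_meas j in \<open>auto intro!: measurable_restrict\<close>)
qed

text \<open>
  Tightness supplies a limit law along a subsequence. Its characteristic function is the limit of
  the block exponentials \<open>\<psi> m\<close>, which do not depend on the subsequence, so the whole sequence
  converges; a convergent subsequence of their coefficients identifies the limit as stable.
\<close>

theorem strictly_stable_limit:
  "\<exists>\<mu>. strictly_stable \<alpha> \<mu> \<and> weak_conv_m (\<lambda>n. distr M borel (\<lambda>\<omega>. (\<Sum>i\<in>{1..n}. X i \<omega>) / B n)) \<mu>"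
proof -
  define \<mu>n where "\<mu>n = (\<lambda>n. distr M borel (\<lambda>\<omega>. (\<Sum>i\<in>{1..n}. X i \<omega>) / B n))"
  have S_meas: "(\<lambda>\<omega>. (\<Sum>i\<in>{1..n}. X i \<omega>) / b) \<in> borel_measurable M" for n b
    by (intro borel_measurable_divide sum_X_measurable borel_measurable_const)
  have rd: "real_distribution (\<mu>n n)" for n
    unfolding \<mu>n_def by (rule real_distribution_distr[OF S_meas])
  define w where "w = (\<lambda>m n t. (CLINT \<omega>|M. iexp (t * ((\<Sum>i\<in>{1..m}. X i \<omega>) / B n))))"
  have char_w: "char (\<mu>n n) t = w n n t" for n t
    unfolding char_def \<mu>n_def w_def by (rule integral_distr[OF S_meas]) measurable
  have w1: "norm (w m n t) \<le> 1" for m n t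
    unfolding w_def by (rule order_trans[OF integral_norm_bound]) (simp add: prob_space)
  have ex: "\<exists>c. 0 \<le> c \<and> pareto_tails M (\<lambda>n \<omega>. \<theta> * ((\<Sum>i\<in>{1..m}. X i \<omega>) / B n)) \<alpha> c"
    if m\<theta>: "1 \<le> m" "\<bar>\<theta>\<bar> = 1" for m \<theta>
    by (rule partial_sum_pareto_tails[OF m\<theta>]) blast
  \<comment> \<open>For \<open>\<theta> = 1\<close> and \<open>\<theta> = - 1\<close> these are the tail constants of \<open>S\<^sub>m\<close> and \<open>- S\<^sub>m\<close>.\<close>
  define c where "c = (\<lambda>\<theta> m. SOME c. 0 \<le> c \<and> pareto_tails M (\<lambda>n \<omega>. \<theta> * ((\<Sum>i\<in>{1..m}. X i \<omega>) / B n)) \<alpha> c)"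
  have c: "0 \<le> c \<theta> m \<and> pareto_tails M (\<lambda>n \<omega>. \<theta> * ((\<Sum>i\<in>{1..m}. X i \<omega>) / B n)) \<alpha> (c \<theta> m)"
    if m\<theta>: "1 \<le> m" "\<bar>\<theta>\<bar> = 1" for m \<theta>
    unfolding c_def by (rule someI_ex[OF ex[OF m\<theta>]])
  define cp where "cp = c 1"
  define cm where "cm = c (- 1)"
  have cp: "0 \<le> cp m \<and> pareto_tails M (\<lambda>n \<omega>. 1 * ((\<Sum>i\<in>{1..m}. X i \<omega>) / B n)) \<alpha> (cp m)" if "1 \<le> m" for m
    unfolding cp_def using that by (rule c) simp
  have cm: "0 \<le> cm m \<and> pareto_tails M (\<lambda>n \<omega>. - 1 * ((\<Sum>i\<in>{1..m}. X i \<omega>) / B n)) \<alpha> (cm m)" if "1 \<le> m" for m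
    unfolding cm_def using that by (rule c) simp
  have cp_cm: "cp m = cm m" if "\<alpha> = 1" and m: "1 \<le> m" for m
  proof -
    have eq: "measure M {\<omega> \<in> space M. 1 < - 1 * ((\<Sum>i\<in>{1..m}. X i \<omega>) / B n)} = measure M {\<omega> \<in> space M. 1 < 1 * ((\<Sum>i\<in>{1..m}. X i \<omega>) / B n)}" for n
    proof -
      have "measure (distr M borel (\<lambda>\<omega>. - ((\<Sum>i\<in>{1..m}. X i \<omega>) / B n))) {1<..} = measure (distr M borel (\<lambda>\<omega>. (\<Sum>i\<in>{1..m}. X i \<omega>) / B n)) {1<..}"
        using symmetric_partial_sum[OF that] by simp
      moreover have "measure (distr M borel Y) {1<..} = measure M {\<omega> \<in> space M. 1 < Y \<omega>}"
        if Y: "Y \<in> borel_measurable M" for Y :: "'a \<Rightarrow> real"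
        by (subst measure_distr[OF Y]) (auto intro!: arg_cong[where f = "measure M"])
      ultimately show ?thesis
        using S_meas[of m "B n"] borel_measurable_uminus[OF S_meas[of m "B n"]] by (simp only: mult_1 mult_minus1)
    qed
    have "(\<lambda>n. real n * measure M {\<omega> \<in> space M. 1 < 1 * ((\<Sum>i\<in>{1..m}. X i \<omega>) / B n)}) \<longlonglongrightarrow> cp m * 1 powr - \<alpha>"
      using cp[OF m] zero_less_one unfolding pareto_tails_def by blast
    moreover have "(\<lambda>n. real n * measure M {\<omega> \<in> space M. 1 < 1 * ((\<Sum>i\<in>{1..m}. X i \<omega>) / B n)}) \<longlonglongrightarrow> cm m * 1 powr - \<alpha>"
      unfolding eq[symmetric] using cm[OF m] zero_less_one unfolding pareto_tails_def by blast
    ultimately have "cp m * 1 powr - \<alpha> = cm m * 1 powr - \<alpha>" by (rule LIMSEQ_unique)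
    then show ?thesis by simp
  qed
  \<comment> \<open>Blocks have length \<open>Suc m\<close>, so that the normalization divides by a positive number.\<close>
  define p where "p = (\<lambda>m. cp (Suc m) * \<alpha> / real (Suc m))"
  define q where "q = (\<lambda>m. cm (Suc m) * \<alpha> / real (Suc m))"
  define \<psi> where "\<psi> = (\<lambda>m t. exp (of_real (p m) * levy_exponent \<alpha> t + of_real (q m) * levy_exponent \<alpha> (- t)))"
  have block: "(\<lambda>n. w (Suc m) n t ^ (n div Suc m)) \<longlonglongrightarrow> \<psi> m t" for m t
  proof -
    let ?m = "Suc m"
    have m: "1 \<le> ?m" by simp
    define Z where "Z = (\<lambda>n \<omega>. (\<Sum>i\<in>{1..?m}. X i \<omega>) / B n)"
    have centred_Z: "integrable M (Z n)" "(LINT \<omega>|M. Z n \<omega>) = 0" if "1 < \<alpha>" for n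
    proof -
      have i: "integrable M (X i)" "expectation (X i) = 0" if i: "1 \<le> i" for i
        using integrable_X[OF i] centred[OF \<open>1 < \<alpha>\<close>] expectation_shift1[of "\<lambda>x. x", OF _ i] by auto
      show "integrable M (Z n)" unfolding Z_def using i by (intro integrable_divide_zero Bochner_Integration.integrable_sum) auto
      show "(LINT \<omega>|M. Z n \<omega>) = 0" unfolding Z_def using i by (simp add: Bochner_Integration.integral_sum del: One_nat_def sum.cl_ivl_Suc)
    qed
    have "(\<lambda>n. real n *\<^sub>R ((CLINT \<omega>|M. iexp (t * Z n \<omega>)) - 1)) \<longlonglongrightarrow>
        of_real (cp ?m * \<alpha>) * levy_exponent \<alpha> t + of_real (cm ?m * \<alpha>) * levy_exponent \<alpha> (- t)"
    proof (rule char_pareto_tails)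
      show "Z n \<in> borel_measurable M" for n unfolding Z_def by (rule S_meas)
      show "pareto_tails M Z \<alpha> (cp ?m)" "pareto_tails M (\<lambda>n \<omega>. - Z n \<omega>) \<alpha> (cm ?m)"
        using cp[OF m] cm[OF m] unfolding Z_def by (simp_all only: mult_1 mult_minus1)
      show "distr M borel (\<lambda>\<omega>. - Z n \<omega>) = distr M borel (Z n)" if "\<alpha> = 1" for n
        unfolding Z_def by (rule symmetric_partial_sum[OF that m])
    qed (use index_pos index_lt_2 cp_cm[OF _ m] centred_Z prob_space_axioms in auto)
    then have lim: "(\<lambda>n. real n *\<^sub>R (w ?m n t - 1)) \<longlonglongrightarrow>
        of_real (cp ?m * \<alpha>) * levy_exponent \<alpha> t + of_real (cm ?m * \<alpha>) * levy_exponent \<alpha> (- t)"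
      unfolding w_def Z_def .
    have "(\<lambda>n. real (n div ?m) / real n) \<longlonglongrightarrow> 1 / real ?m"
      by (rule tendsto_div_ratio) simp
    from power_tendsto_exp[OF w1 lim this] show ?thesis
      unfolding \<psi>_def p_def q_def by (simp add: add_divide_distrib distrib_left mult_ac)
  qed
  have mixing: "\<exists>m0. \<forall>m\<ge>m0. \<forall>\<^sub>F n in sequentially. norm (w n n t - \<psi> m t) \<le> \<epsilon>" if \<epsilon>: "0 < \<epsilon>" for t \<epsilon>
  proof -
    obtain m0 where m0: "\<And>m. m0 \<le> m \<Longrightarrow> \<forall>\<^sub>F n in sequentially. norm (w n n t - w m n t ^ (n div m)) \<le> \<epsilon> / 2"
    proof (rule char_asymptotic_independence[OF half_gt_zero[OF \<epsilon>], of t])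
      fix m0 assume "\<And>m. m0 \<le> m \<Longrightarrow> \<forall>\<^sub>F n in sequentially.
        norm ((CLINT \<omega>|M. iexp (t * ((\<Sum>i\<in>{1..n}. X i \<omega>) / B n))) -
          (CLINT \<omega>|M. iexp (t * ((\<Sum>i\<in>{1..m}. X i \<omega>) / B n))) ^ (n div m)) \<le> \<epsilon> / 2"
      then show thesis by (rule that[unfolded w_def])
    qed
    show ?thesis
    proof (intro exI[of _ m0] allI impI)
      fix m assume "m0 \<le> m"
      then have "\<forall>\<^sub>F n in sequentially. norm (w n n t - w (Suc m) n t ^ (n div Suc m)) \<le> \<epsilon> / 2" by (intro m0) simp
      moreover have "\<forall>\<^sub>F n in sequentially. dist (w (Suc m) n t ^ (n div Suc m)) (\<psi> m t) < \<epsilon> / 2"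
        by (rule tendstoD[OF block]) (use \<epsilon> in simp)
      ultimately show "\<forall>\<^sub>F n in sequentially. norm (w n n t - \<psi> m t) \<le> \<epsilon>"
      proof eventually_elim
        case (elim n)
        have "norm (w n n t - \<psi> m t) \<le> norm (w n n t - w (Suc m) n t ^ (n div Suc m)) + norm (w (Suc m) n t ^ (n div Suc m) - \<psi> m t)"
          using norm_triangle_ineq[of "w n n t - w (Suc m) n t ^ (n div Suc m)" "w (Suc m) n t ^ (n div Suc m) - \<psi> m t"] by simp
        then show ?case using elim unfolding dist_norm by linarith
      qed
    qed
  qed
  have "tight \<mu>n"
    by (rule tight_of_eventually_bounded[OF rd]) (use normalized_sum_tight in \<open>simp add: \<mu>n_def\<close>)
  from tight_imp_convergent_subsubsequence[OF this strict_mono_id]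
  obtain r \<mu> where r: "strict_mono (r :: nat \<Rightarrow> nat)" and \<mu>: "real_distribution \<mu>" and conv_r: "weak_conv_m (\<mu>n \<circ> r) \<mu>"
    by (auto simp: o_def id_def)
  have char_r: "(\<lambda>k. w (r k) (r k) t) \<longlonglongrightarrow> char \<mu> t" for t
    using levy_continuity1[OF _ \<mu> conv_r] rd by (simp add: char_w)
  have near_\<mu>: "\<exists>m0. \<forall>m\<ge>m0. norm (char \<mu> t - \<psi> m t) \<le> \<epsilon>" if \<epsilon>: "0 < \<epsilon>" for t \<epsilon>
  proof -
    obtain m0 where m0: "\<And>m. m0 \<le> m \<Longrightarrow> \<forall>\<^sub>F n in sequentially. norm (w n n t - \<psi> m t) \<le> \<epsilon>"
      using mixing[OF \<epsilon>] by blast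
    have "norm (char \<mu> t - \<psi> m t) \<le> \<epsilon>" if m: "m0 \<le> m" for m
    proof (rule tendsto_upperbound)
      show "(\<lambda>k. norm (w (r k) (r k) t - \<psi> m t)) \<longlonglongrightarrow> norm (char \<mu> t - \<psi> m t)"
        by (intro tendsto_norm tendsto_diff char_r tendsto_const)
      show "\<forall>\<^sub>F k in sequentially. norm (w (r k) (r k) t - \<psi> m t) \<le> \<epsilon>"
        by (rule eventually_subseq[OF r m0[OF m]])
    qed simp
    then show ?thesis by blast
  qed
  have \<psi>_lim: "(\<lambda>m. \<psi> m t) \<longlonglongrightarrow> char \<mu> t" for t
  proof (rule LIMSEQ_I)
    fix \<epsilon> :: real assume "0 < \<epsilon>"
    then obtain m0 where "\<And>m. m0 \<le> m \<Longrightarrow> norm (char \<mu> t - \<psi> m t) \<le> \<epsilon> / 2" using near_\<mu>[of "\<epsilon> / 2" t] by auto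
    then show "\<exists>m0. \<forall>m\<ge>m0. norm (\<psi> m t - char \<mu> t) < \<epsilon>"
      using \<open>0 < \<epsilon>\<close> by (intro exI[of _ m0]) (force simp: norm_minus_commute)
  qed
  have char_lim: "(\<lambda>n. char (\<mu>n n) t) \<longlonglongrightarrow> char \<mu> t" for t
  proof (rule tendstoI)
    fix \<epsilon> :: real assume \<epsilon>: "0 < \<epsilon>"
    obtain m0 where m0: "\<And>m. m0 \<le> m \<Longrightarrow> \<forall>\<^sub>F n in sequentially. norm (w n n t - \<psi> m t) \<le> \<epsilon> / 3"
      using mixing[of "\<epsilon> / 3" t] \<epsilon> by auto
    obtain m1 where m1: "\<And>m. m1 \<le> m \<Longrightarrow> norm (char \<mu> t - \<psi> m t) \<le> \<epsilon> / 3" using near_\<mu>[of "\<epsilon> / 3" t] \<epsilon> by auto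
    show "\<forall>\<^sub>F n in sequentially. dist (char (\<mu>n n) t) (char \<mu> t) < \<epsilon>"
      using m0[OF max.cobounded1[of m0 m1]]
    proof eventually_elim
      case (elim n)
      have "norm (w n n t - char \<mu> t) \<le> norm (w n n t - \<psi> (max m0 m1) t) + norm (char \<mu> t - \<psi> (max m0 m1) t)"
        using norm_triangle_ineq4[of "w n n t - \<psi> (max m0 m1) t" "char \<mu> t - \<psi> (max m0 m1) t"] by simp
      then show ?case using elim m1[OF max.cobounded2[of m1 m0]] \<epsilon> by (simp add: char_w dist_norm)
    qed
  qed
  have wc: "weak_conv_m \<mu>n \<mu>" by (rule levy_continuity[OF rd \<mu> char_lim])
  obtain D where D: "\<And>m \<theta> c. 1 \<le> m \<Longrightarrow> \<bar>\<theta>\<bar> = 1 \<Longrightarrow>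
    pareto_tails M (\<lambda>n \<omega>. \<theta> * ((\<Sum>i\<in>{1..m}. X i \<omega>) / B n)) \<alpha> c \<Longrightarrow> c \<le> real m * D"
    using pareto_constant_linear_bound by blast
  have pq: "(p m, q m) \<in> {0..\<alpha> * D} \<times> {0..\<alpha> * D}" for m
  proof -
    have "cp (Suc m) \<le> real (Suc m) * D" "cm (Suc m) \<le> real (Suc m) * D"
      using D[of "Suc m" 1 "cp (Suc m)"] D[of "Suc m" "-1" "cm (Suc m)"] cp[of "Suc m"] cm[of "Suc m"] by auto
    then have "cp (Suc m) * \<alpha> \<le> real (Suc m) * D * \<alpha>" "cm (Suc m) * \<alpha> \<le> real (Suc m) * D * \<alpha>"
      using index_pos by (auto intro!: mult_right_mono)
    then have "p m \<le> \<alpha> * D" "q m \<le> \<alpha> * D"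
      unfolding p_def q_def by (auto simp: pos_divide_le_eq mult_ac)
    moreover have "0 \<le> p m" "0 \<le> q m"
      unfolding p_def q_def using cp[of "Suc m"] cm[of "Suc m"] index_pos by auto
    ultimately show ?thesis by simp
  qed
  have "compact ({0..\<alpha> * D} \<times> {0..\<alpha> * D})" by (intro compact_Times compact_Icc)
  then have sc: "seq_compact ({0..\<alpha> * D} \<times> {0..\<alpha> * D})" by (rule compact_imp_seq_compact)
  have "\<forall>m. (\<lambda>m. (p m, q m)) m \<in> {0..\<alpha> * D} \<times> {0..\<alpha> * D}" using pq by blast
  from seq_compactE[OF sc this] obtain l s where l: "l \<in> {0..\<alpha> * D} \<times> {0..\<alpha> * D}" and s: "strict_mono (s :: nat \<Rightarrow> nat)"
    and ls: "((\<lambda>m. (p m, q m)) \<circ> s) \<longlonglongrightarrow> l"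
    by blast
  define p' where "p' = fst l"
  define q' where "q' = snd l"
  have p'q': "0 \<le> p'" "0 \<le> q'" using l by (auto simp: p'_def q'_def)
  have plim: "(\<lambda>k. p (s k)) \<longlonglongrightarrow> p'" "(\<lambda>k. q (s k)) \<longlonglongrightarrow> q'"
    using tendsto_fst[OF ls] tendsto_snd[OF ls] by (simp_all add: p'_def q'_def o_def)
  have char_\<mu>: "char \<mu> t = exp (of_real p' * levy_exponent \<alpha> t + of_real q' * levy_exponent \<alpha> (- t))" for t
  proof (rule LIMSEQ_unique)
    show "(\<lambda>k. \<psi> (s k) t) \<longlonglongrightarrow> char \<mu> t" using LIMSEQ_subseq_LIMSEQ[OF \<psi>_lim s] by (simp add: o_def)
    show "(\<lambda>k. \<psi> (s k) t) \<longlonglongrightarrow> exp (of_real p' * levy_exponent \<alpha> t + of_real q' * levy_exponent \<alpha> (- t))"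
      unfolding \<psi>_def by (intro tendsto_exp tendsto_add tendsto_mult tendsto_of_real plim tendsto_const)
  qed
  have p'_q': "p' = q'" if "\<alpha> = 1"
    using plim cp_cm[OF that] LIMSEQ_unique[OF plim(1)] by (simp add: p_def q_def)
  \<comment> \<open>The weight \<open>p'\<close> of positive jumps sits at \<open>1\<close>, the weight \<open>q'\<close> of negative jumps at \<open>-1\<close>.\<close>
  define \<Gamma> where "\<Gamma> = point_measure {-1, 1 :: real} (\<lambda>s. ennreal (if s = 1 then p' else q'))"
  have \<Gamma>_sets: "sets \<Gamma> = sets (count_space {-1, 1})" by (simp add: \<Gamma>_def sets_point_measure)
  have \<Gamma>_emeasure: "emeasure \<Gamma> A = (\<Sum>s\<in>A. ennreal (if s = 1 then p' else q'))" if "A \<subseteq> {-1, 1}" for A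
    unfolding \<Gamma>_def using that by (intro emeasure_point_measure_finite) auto
  have \<Gamma>_finite: "finite_measure \<Gamma>"
    by (rule finite_measureI) (subst \<Gamma>_emeasure, auto simp: \<Gamma>_def space_point_measure)
  have \<Gamma>_meas: "measure \<Gamma> {1} = p'" "measure \<Gamma> {-1} = q'"
    using p'q' by (simp_all add: measure_def \<Gamma>_emeasure)
  have \<Gamma>_int: "(CLINT s|\<Gamma>. CLINT r:{0<..}|lborel. stable_kernel \<alpha> t s r / of_real (r powr (\<alpha> + 1))) =
      of_real p' * levy_exponent \<alpha> t + of_real q' * levy_exponent \<alpha> (- t)" for t
  proof -
    have "stable_kernel \<alpha> t (-1) r = stable_kernel \<alpha> (- t) 1 r" for r by (simp add: stable_kernel_def)
    then show ?thesis
      unfolding \<Gamma>_def levy_exponent_def using p'q'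
      by (subst lebesgue_integral_point_measure_finite) (auto simp: scaleR_conv_of_real)
  qed
  have "strictly_stable \<alpha> \<mu>"
    unfolding strictly_stable_def
  proof (intro conjI index_pos index_lt_2 \<mu> exI[of _ 0] exI[of _ \<Gamma>] \<Gamma>_sets \<Gamma>_finite allI)
    show "if \<alpha> = 1 then measure \<Gamma> {1} = measure \<Gamma> {-1} else (0::real) = 0"
      using \<Gamma>_meas p'_q' by simp
    show "char \<mu> t = exp (\<i> * of_real (0 * t) + (CLINT s|\<Gamma>. CLINT r:{0<..}|lborel. stable_kernel \<alpha> t s r / of_real (r powr (\<alpha> + 1))))" for t
      unfolding \<Gamma>_int char_\<mu> by simp
  qed
  with wc show ?thesis unfolding \<mu>n_def by blast
qed

end

text \<open>
  The stable domain of attraction is packaged in the locale; the only conversion is that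
  a tail of the form \<open>x\<^sup>-\<^sup>\<alpha> L(x)\<close> with \<open>L\<close> slowly varying is everywhere
  positive and has ratio limits \<open>c\<^sup>-\<^sup>\<alpha>\<close>.
\<close>

theorem theorem4:
  fixes M :: "'a measure"
    and X :: "nat \<Rightarrow> 'a \<Rightarrow> real"
    and \<alpha> :: real
    and L :: "real \<Rightarrow> real"
    and B :: "nat \<Rightarrow> real"
    and \<nu> :: "nat \<Rightarrow> (nat \<Rightarrow> real) measure"
  assumes "prob_space M"
    and "\<And>j. j \<ge> 1 \<Longrightarrow> X j \<in> borel_measurable M"
    and "0 < \<alpha>" and "\<alpha> < 2"
    and stationary: "strictly_stationary M X"
    and association: "associated_family M X {1..}"
    and i_tail: "\<And>x. x > 0 \<Longrightarrow> measure M {\<omega> \<in> space M. \<bar>X 1 \<omega>\<bar> > x} = x powr (- \<alpha>) * L x"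
    and i_slowly_varying: "slowly_varying L"
    and i_B_pos: "\<And>n. n \<ge> 1 \<Longrightarrow> B n > 0"
    and i_B: "(\<lambda>n. real n * measure M {\<omega> \<in> space M. \<bar>X 1 \<omega>\<bar> > B n}) \<longlonglongrightarrow> 1"
    and ii_levy: "\<And>N. N \<ge> 1 \<Longrightarrow> levy_measure N (\<nu> N)"
    and ii_vague: "\<And>N. N \<ge> 1 \<Longrightarrow>
          vaguely_converges (extended_punctured N)
            (\<lambda>n. scale_measure (of_nat n)
                    (to_extended N (joint_law M (\<lambda>i \<omega>. X i \<omega> / B n) {1..N})))
            (to_extended N (\<nu> N))"
    and iii_symmetric: "\<And>N. \<alpha> = 1 \<Longrightarrow> N \<ge> 1 \<Longrightarrow> symmetric_vector M X N"
    and iii_centered: "1 < \<alpha> \<Longrightarrow> integrable M (X 1) \<and> (LINT \<omega>|M. X 1 \<omega>) = 0"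
    and iv_finite: "\<And>a. a > 0 \<Longrightarrow>
          summable (\<lambda>j. covariance M (\<lambda>\<omega>. truncation a (X 1 \<omega>)) (\<lambda>\<omega>. truncation a (X (j + 2) \<omega>)))"
    and iv_regularly_varying: "regularly_varying
          (\<lambda>a. \<Sum>j. covariance M (\<lambda>\<omega>. truncation a (X 1 \<omega>)) (\<lambda>\<omega>. truncation a (X (j + 2) \<omega>)))"
    and v_finite: "summable (\<lambda>j. LINT (x, y)|pair_levy_measure (j + 2) (\<nu> (j + 2)).
          truncation 1 x * truncation 1 y)"
    and v_limit: "(\<lambda>n. real n * (\<Sum>j. covariance M (\<lambda>\<omega>. truncation 1 (X 1 \<omega> / B n))
                                               (\<lambda>\<omega>. truncation 1 (X (j + 2) \<omega> / B n))))
          \<longlonglongrightarrow> (\<Sum>j. LINT (x, y)|pair_levy_measure (j + 2) (\<nu> (j + 2)).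
                        truncation 1 x * truncation 1 y)"
  shows "\<exists>\<mu>. strictly_stable \<alpha> \<mu> \<and>
           weak_conv_m (\<lambda>n. distr M borel (\<lambda>\<omega>. (\<Sum>j = 1..n. X j \<omega>) / B n)) \<mu>"
proof -
  interpret prob_space M by fact
  interpret A: associated_sequence M X
    by unfold_locales (use assms(2) stationary association in auto)
  define R where "R = (\<lambda>x. measure M {\<omega> \<in> space M. \<bar>X 1 \<omega>\<bar> > x})"
  have X1: "X 1 \<in> borel_measurable M" by (rule assms(2)) simp
  have R_mono: "R y \<le> R x" if "x \<le> y" for x y
  proof -
    have "{\<omega> \<in> space M. \<bar>X 1 \<omega>\<bar> > x} \<in> sets M" using X1 by measurable
    then show ?thesis unfolding R_def using that by (intro finite_measure_mono) auto
  qed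
  obtain a where a: "0 < a" "\<And>x. a \<le> x \<Longrightarrow> 0 < L x"
    using i_slowly_varying unfolding slowly_varying_def regularly_varying_index_def by blast
  have L_ratio: "((\<lambda>x. L (c * x) / L x) \<longlongrightarrow> 1) at_top" if "0 < c" for c
    using i_slowly_varying that unfolding slowly_varying_def regularly_varying_index_def by force
  have R_pos: "0 < R x" for x
  proof -
    have "0 < R (max x a)"
      unfolding R_def using a by (subst i_tail) (auto intro!: mult_pos_pos simp: less_max_iff_disj)
    also have "\<dots> \<le> R x" by (rule R_mono) simp
    finally show ?thesis .
  qed
  have R_ratio: "((\<lambda>x. R (c * x) / R x) \<longlongrightarrow> c powr - \<alpha>) at_top" if c: "0 < c" for c
  proof -
    have "((\<lambda>x. c powr - \<alpha> * (L (c * x) / L x)) \<longlongrightarrow> c powr - \<alpha> * 1) at_top"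
      by (intro tendsto_mult tendsto_const L_ratio c)
    moreover have "\<forall>\<^sub>F x in at_top. c powr - \<alpha> * (L (c * x) / L x) = R (c * x) / R x"
      using eventually_gt_at_top[of 0]
    proof eventually_elim
      case (elim x)
      have "R (c * x) = (c * x) powr - \<alpha> * L (c * x)" "R x = x powr - \<alpha> * L x"
        unfolding R_def using c elim i_tail[of "c * x"] i_tail[of x] by auto
      then show ?case using c elim by (simp add: powr_mult)
    qed
    ultimately show ?thesis by (simp add: tendsto_cong)
  qed
  interpret associated_heavy_tailed_sequence M X \<alpha> B \<nu>
  proof unfold_locales
    show "measure M {\<omega> \<in> space M. y < \<bar>X 1 \<omega>\<bar>} \<le> measure M {\<omega> \<in> space M. x < \<bar>X 1 \<omega>\<bar>}" if "x \<le> y" for x y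
      using R_mono[OF that] unfolding R_def .
    show "0 < measure M {\<omega> \<in> space M. x < \<bar>X 1 \<omega>\<bar>}" for x
      using R_pos[of x] unfolding R_def .
    show "((\<lambda>x. measure M {\<omega> \<in> space M. c * x < \<bar>X 1 \<omega>\<bar>} / measure M {\<omega> \<in> space M. x < \<bar>X 1 \<omega>\<bar>})
        \<longlongrightarrow> c powr - \<alpha>) at_top" if "0 < c" for c
      using R_ratio[OF that] unfolding R_def .
    show "summable (\<lambda>j. A.lag_cov (truncation a) (j + 1))" if "0 < a" for a
      using iv_finite[OF that] by (simp add: A.lag_cov_def)
    show "(\<lambda>n. real n * (\<Sum>j. A.lag_cov (\<lambda>x. truncation 1 (x / B n)) (j + 1))) \<longlonglongrightarrow>
        (\<Sum>j. LINT (x, y)|pair_levy_measure (j + 2) (\<nu> (j + 2)). truncation 1 x * truncation 1 y)"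
      using v_limit by (simp add: A.lag_cov_def)
  qed (use iii_centered assms(3,4) iii_symmetric ii_levy ii_vague i_B i_B_pos v_finite prob_le_1 in blast)+
  show ?thesis by (rule strictly_stable_limit)
qed

end
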